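(* Let $\mathcal{L}=\{L_1,\dots,L_k\}$ be a set of lines in $\mathbb{R}^d$ in general position, and let $G=(\mathcal{V},\mathcal{E})$, $\mathcal{V}=\bigcup_{i=1}^k V_i$, be a crossing partitioned graph. Suppose that $p\in\mathcal{L}^{\mathcal{V}}$ is $\mathcal{L}$-generic and that the $\mathcal{L}$-constrained framework $(G,p)$ is globally $\mathcal{L}$-rigid. Then $G$ is generically globally $\mathcal{L}$-rigid.
   Context: Every line in $\mathbb{R}^d$ has a unique standard equation $Ax=b$ with $(A,b)$ a $(d-1)\times(d+1)$ matrix in reduced row echelon form; $A_i x=b_i$ is that of $L_i$. $\mathbb{Q}(\mathcal{L})$ is the smallest subfield of $\mathbb{R}$ containing all entries of all $(A_i,b_i)$. Three pairwise non-parallel lines $L_1,L_2,L_3$ are weakly concurrent if the closest point in $L_1$ to $L_2$ coincides with the closest point in $L_1$ to $L_3$. $\mathcal{L}$ is in general position if no two lines in $\mathcal{L}$ are parallel, no two are perpendicular, and no three (in any order) are weakly concurrent. A partitioned graph is a finite (simple, undirected) graph $G=(\mathcal{V},\mathcal{E})$ with a partition $\mathcal{V}=\bigcup_{i=1}^k V_i$ (some $V_i$ may be empty; edges inside a part are allowed). $G$ is crossing if at least two of the $V_i$ are non-empty. $\mathcal{L}[G]=\{L_i: V_i\neq\emptyset\}$. $\mathcal{L}^{\mathcal{V}}$ is the set of $p:\mathcal{V}\to\mathbb{R}^d$ with $p(V_i)\subset L_i$ for all $i$; $(G,p)$ with $p\in\mathcal{L}^{\mathcal{V}}$ is an $\mathcal{L}$-constrained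 framework. $\mathbb{Q}(\mathcal{L},p)$ is the smallest subfield of $\mathbb{R}$ containing $\mathbb{Q}(\mathcal{L})$ and all coordinates of all $p(v)$; $p$ is $\mathcal{L}$-generic if the transcendence degree of $\mathbb{Q}(\mathcal{L},p)$ over $\mathbb{Q}(\mathcal{L})$ is $|\mathcal{V}|$. $M_G(p)=(\|p(u)-p(v)\|^2)_{uv\in\mathcal{E}}$. For a set of lines $\mathcal{M}$, $\mathrm{Isom}(\mathcal{M})$ is the group of maps $\theta:\bigcup_{L\in\mathcal{M}}L\to\bigcup_{L\in\mathcal{M}}L$ preserving Euclidean distances and satisfying $\theta(L)=L$ for all $L\in\mathcal{M}$. $(G,p)$ is globally $\mathcal{L}$-rigid if for $q\in\mathcal{L}^{\mathcal{V}}$, $M_G(q)=M_G(p)$ implies $q=\theta\circ p$ for some $\theta\in\mathrm{Isom}(\mathcal{L}[G])$. $G$ is generically globally $\mathcal{L}$-rigid if $(G,p)$ is globally $\mathcal{L}$-rigid for every $\mathcal{L}$-generic $p\in\mathcal{L}^{\mathcal{V}}$. *)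

theory Defs
  imports
    "HOL-Analysis.Analysis"
    "HOL-Library.Poly_Mapping"
    "HOL-Library.Extended_Nat"
    "HOL-Algebra.Algebraic_Closure_Type"
    "Jordan_Normal_Form.Gauss_Jordan_Elimination"
    "Graph_Theory.Pair_Digraph"
begin

text \<open>The symbol \<open>$\<close> always means the coordinate of a point of \<^typ>\<open>real ^ 'n\<close> here; entries of
  Jordan-Normal-Form vectors and matrices are written with \<open>vec_index\<close> and \<open>$$\<close>.\<close>

no_notation Matrix.vec_index (infixl "$" 100)
no_notation fps_nth (infixl "$" 75)

section \<open>Subfields of the reals and transcendence degree\<close>

definition field_generated_by :: "real set \<Rightarrow> real set" where
  "field_generated_by T = (\<lambda>K. subfield K ring_of_type_algebra) hull T"

text \<open>A multivariate polynomial is a finitely supported map from monomials to coefficients, a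
  monomial being a finitely supported map from variables to exponents. Here the variables are real
  numbers themselves, and each variable is evaluated at itself. So \<open>S\<close> is algebraically independent
  over \<open>K\<close> if no nonzero polynomial over \<open>K\<close> in the variables \<open>S\<close> evaluates to zero.\<close>

definition poly_value :: "((real \<Rightarrow>\<^sub>0 nat) \<Rightarrow>\<^sub>0 real) \<Rightarrow> real" where
  "poly_value P = (\<Sum>m\<in>Poly_Mapping.keys P.
      Poly_Mapping.lookup P m * (\<Prod>x\<in>Poly_Mapping.keys m. x ^ Poly_Mapping.lookup m x))"

definition algebraically_independent :: "real set \<Rightarrow> real set \<Rightarrow> bool" where
  "algebraically_independent K S \<longleftrightarrow>
    (\<forall>P. (\<forall>m\<in>Poly_Mapping.keys P. Poly_Mapping.lookup P m \<in> K \<and> Poly_Mapping.keys m \<subseteq> S) \<and>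
         poly_value P = 0 \<longrightarrow> P = 0)"

text \<open>Transcendence degree of \<open>F\<close> over \<open>K\<close>: the largest size of an algebraically independent subset
  of \<open>F\<close>, and \<open>\<infinity>\<close> if these sizes are unbounded.\<close>

definition transcendence_degree :: "real set \<Rightarrow> real set \<Rightarrow> enat" where
  "transcendence_degree K F =
    (SUP S\<in>{S. finite S \<and> S \<subseteq> F \<and> algebraically_independent K S}. enat (card S))"

section \<open>Lines\<close>

text \<open>The ambient space is \<^typ>\<open>real ^ 'n\<close>, so the dimension is \<open>d = CARD('n)\<close>. The linear order on the
  index type is the order of the coordinates, which reduced row echelon form depends on.\<close>

definition is_line :: "(real ^ 'n) set \<Rightarrow> bool" where
  "is_line L \<longleftrightarrow> affine L \<and> aff_dim L = 1"

definition coordinate_vector :: "real ^ 'n::{finite,linorder} \<Rightarrow> real Matrix.vec" where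
  "coordinate_vector x = Matrix.vec CARD('n) (\<lambda>j. x $ (sorted_list_of_set UNIV ! j))"

definition augmented_matrix :: "'a Matrix.mat \<Rightarrow> 'a Matrix.vec \<Rightarrow> 'a Matrix.mat" where
  "augmented_matrix A b = Matrix.mat (dim_row A) (dim_col A + 1)
     (\<lambda>(i, j). if j < dim_col A then A $$ (i, j) else vec_index b i)"

text \<open>\<^const>\<open>row_echelon_form\<close> is the reduced form: it also requires the pivots to be 1 and to be the
  only nonzero entries of their columns.\<close>

definition standard_equation ::
    "(real ^ 'n::{finite,linorder}) set \<Rightarrow> real Matrix.mat \<Rightarrow> real Matrix.vec \<Rightarrow> bool" where
  "standard_equation L A b \<longleftrightarrow>
     A \<in> carrier_mat (CARD('n) - 1) CARD('n) \<and> b \<in> carrier_vec (CARD('n) - 1) \<and>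
     row_echelon_form (augmented_matrix A b) \<and>
     L = {x. A *\<^sub>v coordinate_vector x = b}"

definition line_entries :: "(real ^ 'n::{finite,linorder}) set set \<Rightarrow> real set" where
  "line_entries \<L> = \<Union>{elements_mat (augmented_matrix A b) | A b. \<exists>L\<in>\<L>. standard_equation L A b}"

definition field_of_lines :: "(real ^ 'n::{finite,linorder}) set set \<Rightarrow> real set" where
  "field_of_lines \<L> = field_generated_by (line_entries \<L>)"

text \<open>Perpendicularity is a condition on directions; the lines need not meet.\<close>

definition perpendicular :: "(real ^ 'n) set \<Rightarrow> (real ^ 'n) set \<Rightarrow> bool" where
  "perpendicular L M \<longleftrightarrow> (\<forall>x\<in>L. \<forall>x'\<in>L. \<forall>y\<in>M. \<forall>y'\<in>M. Linear_Algebra.orthogonal (x - x') (y - y'))"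

definition closest_point_to_line :: "(real ^ 'n) set \<Rightarrow> (real ^ 'n) set \<Rightarrow> real ^ 'n \<Rightarrow> bool" where
  "closest_point_to_line L M x \<longleftrightarrow> is_arg_min (\<lambda>y. infdist y M) (\<lambda>y. y \<in> L) x"

text \<open>The closest points are unique because the lines are not parallel.\<close>

definition weakly_concurrent ::
    "(real ^ 'n) set \<Rightarrow> (real ^ 'n) set \<Rightarrow> (real ^ 'n) set \<Rightarrow> bool" where
  "weakly_concurrent L1 L2 L3 \<longleftrightarrow>
     \<not> affine_parallel L1 L2 \<and> \<not> affine_parallel L1 L3 \<and> \<not> affine_parallel L2 L3 \<and>
     (\<exists>x. closest_point_to_line L1 L2 x \<and> closest_point_to_line L1 L3 x)"

definition general_position :: "(real ^ 'n) set set \<Rightarrow> bool" where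
  "general_position \<L> \<longleftrightarrow>
     (\<forall>L\<in>\<L>. \<forall>M\<in>\<L>. L \<noteq> M \<longrightarrow> \<not> affine_parallel L M \<and> \<not> perpendicular L M) \<and>
     (\<forall>L1\<in>\<L>. \<forall>L2\<in>\<L>. \<forall>L3\<in>\<L>. distinct [L1, L2, L3] \<longrightarrow> \<not> weakly_concurrent L1 L2 L3)"

section \<open>Partitioned graphs\<close>

text \<open>Finite simple undirected graphs are the library's \<^locale>\<open>pair_graph\<close>s: an edge \<open>uv\<close> is present
  as both \<open>(u, v)\<close> and \<open>(v, u)\<close>.\<close>

definition partitioned_graph :: "nat \<Rightarrow> 'v pair_pre_digraph \<Rightarrow> (nat \<Rightarrow> 'v set) \<Rightarrow> bool" where
  "partitioned_graph k G V \<longleftrightarrow>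
     pair_graph G \<and> disjoint_family_on V {1..k} \<and> pverts G = (\<Union>i\<in>{1..k}. V i)"

definition crossing :: "nat \<Rightarrow> (nat \<Rightarrow> 'v set) \<Rightarrow> bool" where
  "crossing k V \<longleftrightarrow> 2 \<le> card {i\<in>{1..k}. V i \<noteq> {}}"

definition used_lines ::
    "nat \<Rightarrow> (nat \<Rightarrow> (real ^ 'n) set) \<Rightarrow> (nat \<Rightarrow> 'v set) \<Rightarrow> (real ^ 'n) set set" where
  "used_lines k L V = {L i | i. i \<in> {1..k} \<and> V i \<noteq> {}}"

section \<open>Line-constrained frameworks\<close>

text \<open>Maps with domain \<open>X\<close> are represented by functions that are \<open>undefined\<close> outside \<open>X\<close>, so that
  equality of maps is equality of functions.\<close>

definition placements ::
    "nat \<Rightarrow> (nat \<Rightarrow> (real ^ 'n) set) \<Rightarrow> 'v pair_pre_digraph \<Rightarrow> (nat \<Rightarrow> 'v set) \<Rightarrow>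
     ('v \<Rightarrow> real ^ 'n) set" where
  "placements k L G V = {p \<in> extensional (pverts G). \<forall>i\<in>{1..k}. p ` V i \<subseteq> L i}"

definition field_of_placement ::
    "(real ^ 'n::{finite,linorder}) set set \<Rightarrow> 'v pair_pre_digraph \<Rightarrow>
     ('v \<Rightarrow> real ^ 'n::{finite,linorder}) \<Rightarrow> real set"
  where
  "field_of_placement \<L> G p =
     field_generated_by (field_of_lines \<L> \<union> {p v $ j | v j. v \<in> pverts G})"

definition generic_placement ::
    "(real ^ 'n::{finite,linorder}) set set \<Rightarrow> 'v pair_pre_digraph \<Rightarrow>
     ('v \<Rightarrow> real ^ 'n::{finite,linorder}) \<Rightarrow> bool"
  where
  "generic_placement \<L> G p \<longleftrightarrow>
     transcendence_degree (field_of_lines \<L>) (field_of_placement \<L> G p) = enat (card (pverts G))"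

definition measurement :: "'v pair_pre_digraph \<Rightarrow> ('v \<Rightarrow> real ^ 'n) \<Rightarrow> 'v \<times> 'v \<Rightarrow> real" where
  "measurement G p = (\<lambda>(u, v)\<in>parcs G. (norm (p u - p v))\<^sup>2)"

definition line_isometries :: "(real ^ 'n) set set \<Rightarrow> (real ^ 'n \<Rightarrow> real ^ 'n) set" where
  "line_isometries \<M> = {\<theta> \<in> \<Union>\<M> \<rightarrow>\<^sub>E \<Union>\<M>.
     (\<forall>x\<in>\<Union>\<M>. \<forall>y\<in>\<Union>\<M>. dist (\<theta> x) (\<theta> y) = dist x y) \<and> (\<forall>L\<in>\<M>. \<theta> ` L = L)}"

definition globally_rigid ::
    "nat \<Rightarrow> (nat \<Rightarrow> (real ^ 'n) set) \<Rightarrow> 'v pair_pre_digraph \<Rightarrow> (nat \<Rightarrow> 'v set) \<Rightarrow>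
     ('v \<Rightarrow> real ^ 'n) \<Rightarrow> bool" where
  "globally_rigid k L G V p \<longleftrightarrow>
     (\<forall>q\<in>placements k L G V. measurement G q = measurement G p \<longrightarrow>
        (\<exists>\<theta>\<in>line_isometries (used_lines k L V). q = compose (pverts G) \<theta> p))"

definition generically_globally_rigid ::
    "nat \<Rightarrow> (nat \<Rightarrow> (real ^ 'n::{finite,linorder}) set) \<Rightarrow> 'v pair_pre_digraph \<Rightarrow>
     (nat \<Rightarrow> 'v set) \<Rightarrow> bool" where
  "generically_globally_rigid k L G V \<longleftrightarrow>
     (\<forall>p\<in>placements k L G V. generic_placement (L ` {1..k}) G p \<longrightarrow> globally_rigid k L G V p)"

end

theory Submission
  imports Defs
begin

text \<open>Parametrise each line, so that a placement becomes a family \<open>x\<close> of reals and each edge length a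
  quadratic polynomial in two of them. Genericity of \<open>x\<close> is used through derivations of \<open>\<real>\<close> that kill
  the field of the lines and are dual to \<open>x\<close>. Edges joining different lines are called cross edges.

  If \<open>x\<close> is globally rigid, no set of vertices on one line has at most one neighbour outside it (it
  could be reflected), no proper union of components lies in two lines, and deleting a cross edge that is not a
  bridge from a component leaves another such edge: otherwise the remaining component is a tree of
  rigid inline pieces, \<open>x\<close> lies on a closed loop of its configurations, and the deleted length changes
  sign along this loop at \<open>x\<close> and hence at a further point. Conversely, let these three
  combinatorial conditions hold, let \<open>x\<close> be generic and let \<open>y\<close> have the same edge lengths. A cycle
  with a cross edge determines its vertices up to finitely many choices, which makes most partial
  derivatives of \<open>y\<close> with respect to \<open>x\<close> vanish; in the end \<open>y v\<close> depends on \<open>x v\<close> only, and the edge equations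
  force \<open>y = x\<close> or the reflection of two lines in their common perpendicular.\<close>

section \<open>Derivations of the reals\<close>

text \<open>A second solution \<open>y\<close> is just another tuple of real numbers, with no
  function of \<open>x\<close> behind it. Derivations supply a calculus nonetheless: one that kills
  the field of the lines and has prescribed values at the independent numbers \<open>x v\<close>
  extends by Zorn's lemma to all reals. So \<open>\<Delta> w (y v)\<close> makes sense and plays the
  role of a partial derivative, and differentiating an edge equation is a purely algebraic step. The
  three combinatorial conditions can pass from one generic configuration to another because they
  mention the graph and the labels only. The obstacle in deriving them is that a loop may regain the
  deleted length at the reflection of \<open>x\<close> in a common perpendicular, which is congruent
  to \<open>x\<close>. This can happen only if all vertices lie on two lines. An edge within one
  line excludes it, because loops translate such edges; without such edges the loop is started at a
  vertex with two edges of different lengths, the longer of which never changes sheet, while the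
  reflection would require that.\<close>

definition derivation :: "real set \<Rightarrow> (real \<Rightarrow> real) \<Rightarrow> bool" where
  "derivation K D \<longleftrightarrow> (\<forall>a b. D (a + b) = D a + D b) \<and> (\<forall>a b. D (a * b) = D a * b + a * D b) \<and> (\<forall>r\<in>K. D r = 0)"

definition real_subring :: "real set \<Rightarrow> bool" where
  "real_subring A \<longleftrightarrow> 1 \<in> A \<and> (\<forall>a\<in>A. - a \<in> A) \<and> (\<forall>a\<in>A. \<forall>b\<in>A. a + b \<in> A \<and> a * b \<in> A)"

text \<open>Subrings rather than subfields serve as domains: adjoining a number to a ring takes only
  polynomials in it, no quotients.\<close>

definition partial_derivation :: "real set \<Rightarrow> (real \<Rightarrow> real) \<Rightarrow> bool" where
  "partial_derivation A D \<longleftrightarrow> real_subring A \<and> (\<forall>a\<in>A. \<forall>b\<in>A. D (a + b) = D a + D b \<and> D (a * b) = D a * b + a * D b)"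

lemma real_subringD:
  assumes "real_subring A"
  shows "1 \<in> A" "0 \<in> A" "a \<in> A \<Longrightarrow> - a \<in> A" "a \<in> A \<Longrightarrow> b \<in> A \<Longrightarrow> a + b \<in> A"
    "a \<in> A \<Longrightarrow> b \<in> A \<Longrightarrow> a * b \<in> A" "of_nat n \<in> A"
proof -
  show 1: "1 \<in> A" "a \<in> A \<Longrightarrow> - a \<in> A" "a \<in> A \<Longrightarrow> b \<in> A \<Longrightarrow> a + b \<in> A"
    "a \<in> A \<Longrightarrow> b \<in> A \<Longrightarrow> a * b \<in> A" for a b
    using assms by (auto simp: real_subring_def)
  show 0: "0 \<in> A" using 1(1) 1(2)[of 1] 1(3)[of 1 "-1"] by auto
  show "of_nat n \<in> A" by (induction n) (use 0 1 in auto)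
qed

lemma real_subring_sum:
  assumes "real_subring A" "\<And>i. i \<in> I \<Longrightarrow> f i \<in> A"
  shows "sum f I \<in> A"
  using assms(2) by (induction I rule: infinite_finite_induct) (auto simp: real_subringD[OF assms(1)])

section \<open>Polynomials over a subring and the adjunction of one number\<close>

definition polys_in :: "real set \<Rightarrow> real poly set" where
  "polys_in A = {g. \<forall>i. Polynomial.coeff g i \<in> A}"

lemma polys_in_add: "real_subring A \<Longrightarrow> f \<in> polys_in A \<Longrightarrow> g \<in> polys_in A \<Longrightarrow> f + g \<in> polys_in A"
  by (auto simp: polys_in_def real_subringD)

lemma polys_in_mult: "real_subring A \<Longrightarrow> f \<in> polys_in A \<Longrightarrow> g \<in> polys_in A \<Longrightarrow> f * g \<in> polys_in A"
  by (auto simp: polys_in_def coeff_mult intro!: real_subring_sum real_subringD)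

lemma polys_in_uminus: "real_subring A \<Longrightarrow> f \<in> polys_in A \<Longrightarrow> - f \<in> polys_in A"
  by (auto simp: polys_in_def real_subringD)

lemma polys_in_monom: "real_subring A \<Longrightarrow> c \<in> A \<Longrightarrow> Polynomial.monom c n \<in> polys_in A"
  by (auto simp: polys_in_def real_subringD)

lemma polys_in_pderiv: "real_subring A \<Longrightarrow> f \<in> polys_in A \<Longrightarrow> pderiv f \<in> polys_in A"
  unfolding polys_in_def by (auto simp: coeff_pderiv simp del: of_nat_Suc intro!: real_subringD(5) real_subringD(6))

context
  fixes A :: "real set" and D :: "real \<Rightarrow> real"
  assumes pd: "partial_derivation A D"
begin

lemma partial_derivation_subring: "real_subring A"
  using pd by (simp add: partial_derivation_def)

lemma partial_derivation_add: "a \<in> A \<Longrightarrow> b \<in> A \<Longrightarrow> D (a + b) = D a + D b"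
  and partial_derivation_mult: "a \<in> A \<Longrightarrow> b \<in> A \<Longrightarrow> D (a * b) = D a * b + a * D b"
  using pd by (auto simp: partial_derivation_def)

lemma partial_derivation_0: "D 0 = 0" using partial_derivation_add[of 0 0] real_subringD[OF partial_derivation_subring] by auto

lemma partial_derivation_1: "D 1 = 0" using partial_derivation_mult[of 1 1] real_subringD[OF partial_derivation_subring] by auto

lemma partial_derivation_minus: "a \<in> A \<Longrightarrow> D (- a) = - D a" using partial_derivation_add[of a "-a"] real_subringD[OF partial_derivation_subring] partial_derivation_0 by auto

lemma partial_derivation_sum: "(\<And>i. i \<in> I \<Longrightarrow> f i \<in> A) \<Longrightarrow> D (sum f I) = (\<Sum>i\<in>I. D (f i))"
  by (induction I rule: infinite_finite_induct) (auto simp: partial_derivation_0 partial_derivation_add real_subring_sum[OF partial_derivation_subring])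

lemma map_poly_D_add: "f \<in> polys_in A \<Longrightarrow> g \<in> polys_in A \<Longrightarrow> map_poly D (f + g) = map_poly D f + map_poly D g"
  by (intro poly_eqI) (auto simp: coeff_map_poly partial_derivation_0 partial_derivation_add polys_in_def)

lemma map_poly_D_mult:
  "f \<in> polys_in A \<Longrightarrow> g \<in> polys_in A \<Longrightarrow> map_poly D (f * g) = map_poly D f * g + f * map_poly D g"
  by (intro poly_eqI)
    (auto simp: coeff_map_poly partial_derivation_0 partial_derivation_sum partial_derivation_mult polys_in_def coeff_mult sum.distrib real_subringD[OF partial_derivation_subring] intro!: sum.cong)

text \<open>By the chain rule this is the value at \<open>poly g r\<close> that an extension of
  \<open>D\<close> with value \<open>w\<close> at \<open>r\<close> has to take.\<close>

definition extended_value :: "real \<Rightarrow> real \<Rightarrow> real poly \<Rightarrow> real" where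
  "extended_value r w g = poly (map_poly D g) r + poly (pderiv g) r * w"

lemma extended_value_add: "f \<in> polys_in A \<Longrightarrow> g \<in> polys_in A \<Longrightarrow> extended_value r w (f + g) = extended_value r w f + extended_value r w g"
  by (simp add: extended_value_def map_poly_D_add pderiv_add algebra_simps)

lemma extended_value_mult: "f \<in> polys_in A \<Longrightarrow> g \<in> polys_in A \<Longrightarrow> extended_value r w (f * g) = extended_value r w f * poly g r + poly f r * extended_value r w g"
  by (simp add: extended_value_def map_poly_D_mult pderiv_mult algebra_simps)

lemma map_poly_D_const: "map_poly D [:c:] = [:D c:]"
  by (intro poly_eqI) (auto simp: coeff_map_poly partial_derivation_0 coeff_pCons split: nat.splits)

text \<open>The ring generated by \<open>A\<close> and \<open>r\<close> consists of the values
  \<open>poly g r\<close>. Two polynomials with the same value differ by one that vanishes at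
  \<open>r\<close>, so the hypothesis makes \<open>extended_value\<close> a function of the value
  alone.\<close>

lemma extend_transfer:
  assumes wd: "\<And>g. g \<in> polys_in A \<Longrightarrow> poly g r = 0 \<Longrightarrow> extended_value r w g = 0"
  shows "\<exists>A' D'. partial_derivation A' D' \<and> A \<subseteq> A' \<and> (\<forall>a\<in>A. D' a = D a) \<and> r \<in> A' \<and> D' r = w"
proof -
  define A' where "A' = (\<lambda>g. poly g r) ` polys_in A"
  define D' where "D' a = extended_value r w (SOME g. g \<in> polys_in A \<and> poly g r = a)" for a
  have D': "D' (poly g r) = extended_value r w g" if g: "g \<in> polys_in A" for g
  proof -
    define h where "h = (SOME h. h \<in> polys_in A \<and> poly h r = poly g r)"
    have h: "h \<in> polys_in A \<and> poly h r = poly g r"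
      unfolding h_def by (rule someI[of _ g]) (use g in auto)
    have "extended_value r w (h + (- g)) = 0"
      by (rule wd, intro polys_in_add partial_derivation_subring polys_in_uminus) (use h g in auto)
    moreover have "extended_value r w (g + (- g)) = 0"
      by (rule wd, intro polys_in_add partial_derivation_subring polys_in_uminus) (use g in auto)
    ultimately show ?thesis
      using extended_value_add[of g "-g"] extended_value_add[of h "-g"] h g polys_in_uminus[OF partial_derivation_subring g]
      by (auto simp: D'_def h_def)
  qed
  have c: "[:a:] \<in> polys_in A" if "a \<in> A" for a
    using that real_subringD(2)[OF partial_derivation_subring] by (auto simp: polys_in_def coeff_pCons split: nat.splits)
  have x: "[:0,1:] \<in> polys_in A"
    using real_subringD[OF partial_derivation_subring] by (auto simp: polys_in_def coeff_pCons split: nat.splits)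
  have "real_subring A'"
    unfolding real_subring_def
  proof (intro conjI ballI)
    show "1 \<in> A'" unfolding A'_def by (rule image_eqI[OF _ c[of 1]]) (use real_subringD[OF partial_derivation_subring] in auto)
    show "- a \<in> A'" if "a \<in> A'" for a
      using that unfolding A'_def by (auto intro!: image_eqI[OF _ polys_in_uminus[OF partial_derivation_subring]])
    fix a b assume "a \<in> A'" "b \<in> A'"
    then show "a + b \<in> A'" "a * b \<in> A'" unfolding A'_def
      by (force intro: image_eqI[OF _ polys_in_add[OF partial_derivation_subring]] image_eqI[OF _ polys_in_mult[OF partial_derivation_subring]])+
  qed
  moreover have "D' (a + b) = D' a + D' b \<and> D' (a * b) = D' a * b + a * D' b"
    if ab: "a \<in> A'" "b \<in> A'" for a b
  proof -
    obtain f g where fg: "a = poly f r" "b = poly g r" "f \<in> polys_in A" "g \<in> polys_in A"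
      using ab by (auto simp: A'_def)
    show ?thesis
      using D'[OF polys_in_add[OF partial_derivation_subring fg(3,4)]] D'[OF polys_in_mult[OF partial_derivation_subring fg(3,4)]]
      by (auto simp: fg D' extended_value_add extended_value_mult)
  qed
  ultimately have "partial_derivation A' D'" by (auto simp: partial_derivation_def)
  moreover have "a \<in> A' \<and> D' a = D a" if "a \<in> A" for a
    using D'[OF c[OF that]] c[OF that]
    by (auto simp: A'_def extended_value_def map_poly_D_const intro!: image_eqI[of _ _ "[:a:]"])
  moreover have "r \<in> A' \<and> D' r = w"
  proof -
    have "map_poly D [:0,1:] = 0"
      by (intro poly_eqI) (auto simp: coeff_map_poly partial_derivation_0 partial_derivation_1 coeff_pCons split: nat.splits)
    then show ?thesis
      using D'[OF x] x by (auto simp: A'_def extended_value_def pderiv_pCons intro!: image_eqI[of _ _ "[:0,1:]"])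
  qed
  ultimately show ?thesis by blast
qed

lemma extend_transcendental:
  assumes "\<And>g. g \<in> polys_in A \<Longrightarrow> poly g r = 0 \<Longrightarrow> g = 0"
  shows "\<exists>A' D'. partial_derivation A' D' \<and> A \<subseteq> A' \<and> (\<forall>a\<in>A. D' a = D a) \<and> r \<in> A' \<and> D' r = w"
proof (rule extend_transfer)
  fix g assume "g \<in> polys_in A" "poly g r = 0"
  then have "g = 0" by (rule assms)
  then show "extended_value r w g = 0" by (simp add: extended_value_def)
qed

text \<open>If \<open>r\<close> is algebraic over \<open>A\<close>, a polynomial \<open>p\<close> of
  least degree vanishing at \<open>r\<close> has nonzero derivative there, and \<open>p\<close>
  dictates the value \<open>w\<close> at \<open>r\<close>. Every other polynomial vanishing at
  \<open>r\<close> is reduced to lower degree by means of \<open>p\<close>.\<close>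

lemma extend_one: "\<exists>A' D'. partial_derivation A' D' \<and> A \<subseteq> A' \<and> (\<forall>a\<in>A. D' a = D a) \<and> r \<in> A'"
proof (cases "\<exists>p. p \<in> polys_in A \<and> p \<noteq> 0 \<and> poly p r = 0")
  case False
  then show ?thesis using extend_transcendental[of r 0] by blast
next
  case True
  define p where "p = arg_min Polynomial.degree (\<lambda>p. p \<in> polys_in A \<and> p \<noteq> 0 \<and> poly p r = 0)"
  obtain p0 where p0: "p0 \<in> polys_in A \<and> p0 \<noteq> 0 \<and> poly p0 r = 0" using True by blast
  have p: "p \<in> polys_in A" "p \<noteq> 0" "poly p r = 0"
    using arg_min_natI[of "\<lambda>p. p \<in> polys_in A \<and> p \<noteq> 0 \<and> poly p r = 0", OF p0, of Polynomial.degree] unfolding p_def by auto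
  have pmin: "q = 0" if "q \<in> polys_in A" "poly q r = 0" "Polynomial.degree q < Polynomial.degree p" for q
    using arg_min_nat_le[of "\<lambda>p. p \<in> polys_in A \<and> p \<noteq> 0 \<and> poly p r = 0" q Polynomial.degree] that
    unfolding p_def by auto
  have dp: "Polynomial.degree p \<noteq> 0"
  proof
    assume "Polynomial.degree p = 0"
    then obtain c where "p = [:c:]" by (metis degree_eq_zeroE)
    then show False using p by auto
  qed
  have "poly (pderiv p) r \<noteq> 0"
  proof
    assume "poly (pderiv p) r = 0"
    then have "pderiv p = 0"
      by (intro pmin polys_in_pderiv partial_derivation_subring p) (use dp in \<open>auto simp: degree_pderiv\<close>)
    then show False using dp pderiv_eq_0_iff[of p] by auto
  qed
  define w where "w = - poly (map_poly D p) r / poly (pderiv p) r"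
  have value_p: "extended_value r w p = 0"
    using \<open>poly (pderiv p) r \<noteq> 0\<close> by (simp add: extended_value_def w_def)
  have "extended_value r w g = 0" if "g \<in> polys_in A" "poly g r = 0" for g
    using that
  proof (induction "Polynomial.degree g" arbitrary: g rule: less_induct)
    case less
    show ?case
    proof (cases "g = 0")
      case True
      then show ?thesis by (simp add: extended_value_def)
    next
      case False
      have dg: "Polynomial.degree p \<le> Polynomial.degree g" using pmin[of g] less False by force
      \<comment> \<open>Pseudo-division: inverses are missing in \<open>A\<close>, so
        \<open>g\<close> is multiplied by the leading coefficient of \<open>p\<close> before its
        leading term is cancelled.\<close>
      define m where "m = Polynomial.monom (Polynomial.lead_coeff g) (Polynomial.degree g - Polynomial.degree p)"
      define c where "c = [:Polynomial.lead_coeff p:]"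
      define h where "h = c * g + - (m * p)"
      have mA: "m \<in> polys_in A" unfolding m_def using less by (intro polys_in_monom partial_derivation_subring) (auto simp: polys_in_def)
      have cA: "c \<in> polys_in A"
        using p real_subringD(2)[OF partial_derivation_subring] by (auto simp: c_def polys_in_def coeff_pCons split: nat.splits)
      have hA: "h \<in> polys_in A" unfolding h_def
        by (intro polys_in_add polys_in_mult polys_in_uminus partial_derivation_subring mA cA p less.prems)
      have hr: "poly h r = 0" by (simp add: h_def p less.prems)
      have deg: "Polynomial.degree (c * g) = Polynomial.degree g" "Polynomial.degree (m * p) = Polynomial.degree g" and
        lc: "Polynomial.coeff (c * g) (Polynomial.degree g) = Polynomial.coeff (m * p) (Polynomial.degree g)"
      proof -
        have "m \<noteq> 0" using False by (simp add: m_def)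
        then show 2: "Polynomial.degree (m * p) = Polynomial.degree g" using p False dg
          by (subst degree_mult_eq) (auto simp: m_def degree_monom_eq)
        show 1: "Polynomial.degree (c * g) = Polynomial.degree g" using p False by (simp add: c_def)
        show "Polynomial.coeff (c * g) (Polynomial.degree g) = Polynomial.coeff (m * p) (Polynomial.degree g)"
          using 1 2 lead_coeff_mult[of m p] lead_coeff_mult[of c g] False
          by (simp add: m_def c_def degree_monom_eq)
      qed
      have "h = 0 \<or> Polynomial.degree h < Polynomial.degree g"
      proof (rule ccontr)
        assume n: "\<not> ?thesis"
        then have "Polynomial.degree h \<ge> Polynomial.degree g" by auto
        moreover have "Polynomial.degree h \<le> Polynomial.degree g" unfolding h_def
          by (rule degree_add_le) (use deg in auto)
        ultimately have "Polynomial.degree h = Polynomial.degree g" by simp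
        moreover have "Polynomial.coeff h (Polynomial.degree g) = 0" using lc by (simp add: h_def)
        ultimately show False using n leading_coeff_0_iff[of h] by auto
      qed
      then have "extended_value r w h = 0"
      proof
        assume "h = 0" then show ?thesis by (simp add: extended_value_def)
      next
        assume "Polynomial.degree h < Polynomial.degree g" then show ?thesis using less.hyps hA hr by blast
      qed
      have e: "c * g = h + m * p" by (simp add: h_def)
      have "extended_value r w (c * g) = extended_value r w h + extended_value r w (m * p)"
        unfolding e by (rule extended_value_add[OF hA polys_in_mult[OF partial_derivation_subring mA p(1)]])
      also have "\<dots> = 0"
        using \<open>extended_value r w h = 0\<close> value_p p by (simp add: extended_value_mult[OF mA p(1)])
      finally have "extended_value r w (c * g) = 0" .
      then have "Polynomial.lead_coeff p * extended_value r w g = 0"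
        using extended_value_mult[OF cA less.prems(1), of r w] less.prems by (simp add: c_def)
      then show ?thesis using p by simp
    qed
  qed
  from extend_transfer[of r w, OF this] show ?thesis by blast
qed

end

text \<open>Graphs turn extension into inclusion of sets, as suits Zorn's lemma. The last clause
  together with additivity makes the relation single-valued.\<close>

definition derivation_graph :: "(real \<times> real) set \<Rightarrow> bool" where
  "derivation_graph G \<longleftrightarrow> (1, 0) \<in> G \<and> (\<forall>a a'. (a, a') \<in> G \<longrightarrow> (- a, - a') \<in> G) \<and>
     (\<forall>a a' b b'. (a, a') \<in> G \<longrightarrow> (b, b') \<in> G \<longrightarrow> (a + b, a' + b') \<in> G \<and> (a * b, a' * b + a * b') \<in> G) \<and>
     (\<forall>c. (0, c) \<in> G \<longrightarrow> c = 0)"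

lemma graph_of_partial_derivation:
  assumes pd: "partial_derivation A D"
  shows "derivation_graph ((\<lambda>a. (a, D a)) ` A)"
proof -
  have mem: "(a, a') \<in> (\<lambda>a. (a, D a)) ` A \<longleftrightarrow> a \<in> A \<and> a' = D a" for a a'
    by (simp only: image_iff prod.inject) (rule iffI; elim bexE conjE; simp)
  show ?thesis
    unfolding derivation_graph_def mem
    using real_subringD[OF partial_derivation_subring[OF pd]] partial_derivation_0[OF pd] partial_derivation_1[OF pd] partial_derivation_minus[OF pd] partial_derivation_add[OF pd] partial_derivation_mult[OF pd]
    by simp
qed

lemma partial_derivation_of_graph:
  assumes G: "derivation_graph G"
  obtains D where "partial_derivation (fst ` G) D" "\<And>a b. (a, b) \<in> G \<Longrightarrow> D a = b"
proof -
  have cl: "(1, 0) \<in> G" "(a, a') \<in> G \<Longrightarrow> (- a, - a') \<in> G"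
    "(a, a') \<in> G \<Longrightarrow> (b, b') \<in> G \<Longrightarrow> (a + b, a' + b') \<in> G"
    "(a, a') \<in> G \<Longrightarrow> (b, b') \<in> G \<Longrightarrow> (a * b, a' * b + a * b') \<in> G"
    "(0, c) \<in> G \<Longrightarrow> c = 0" for a a' b b' c
    using G by (simp_all add: derivation_graph_def)
  define D where "D a = (SOME b. (a, b) \<in> G)" for a
  have D: "D a = b" if ab: "(a, b) \<in> G" for a b
  proof -
    have "(a, D a) \<in> G" unfolding D_def using ab by (rule someI)
    from cl(3)[OF this cl(2)[OF ab]] have "(0, D a - b) \<in> G" by simp
    from cl(5)[OF this] show ?thesis by simp
  qed
  have ex: "(a, D a) \<in> G" if a: "a \<in> fst ` G" for a
  proof -
    obtain q where "q \<in> G" "a = fst q" using a by (rule imageE)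
    then have "(a, snd q) \<in> G" by simp
    with D[OF this] show ?thesis by simp
  qed
  have mem: "a \<in> fst ` G" if "(a, b) \<in> G" for a b
    using that by (metis fst_conv imageI)
  have "real_subring (fst ` G)"
    unfolding real_subring_def using mem[OF cl(1)] mem[OF cl(2)[OF ex]] mem[OF cl(3)[OF ex ex]] mem[OF cl(4)[OF ex ex]]
    by simp
  moreover have "D (a + b) = D a + D b" "D (a * b) = D a * b + a * D b"
    if "a \<in> fst ` G" "b \<in> fst ` G" for a b
    using D[OF cl(3)[OF ex ex], OF that] D[OF cl(4)[OF ex ex], OF that] by simp_all
  ultimately have "partial_derivation (fst ` G) D" by (simp add: partial_derivation_def)
  then show thesis using D that by metis
qed

lemma extend_derivation:
  assumes "partial_derivation A D"
  obtains D' where "partial_derivation UNIV D'" "\<And>a. a \<in> A \<Longrightarrow> D' a = D a"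
proof -
  define G0 where "G0 = (\<lambda>a. (a, D a)) ` A"
  define GG where "GG = {G. derivation_graph G \<and> G0 \<subseteq> G}"
  have "G0 \<in> GG" using graph_of_partial_derivation[OF assms] unfolding GG_def G0_def by simp
  then have "GG \<noteq> {}" by blast
  then have "\<exists>M\<in>GG. \<forall>Z\<in>GG. M \<subseteq> Z \<longrightarrow> Z = M"
  proof (rule subset_Zorn_nonempty)
    fix C assume C: "C \<noteq> {}" "subset.chain GG C"
    have CG: "derivation_graph G" "G0 \<subseteq> G" if "G \<in> C" for G
      using C(2) that unfolding subset_chain_def GG_def by blast+
    have ch: "\<exists>G\<in>C. p \<in> G \<and> q \<in> G" if pq: "p \<in> \<Union>C" "q \<in> \<Union>C" for p q
    proof -
      obtain G where G: "G \<in> C" "p \<in> G" using pq by (rule_tac UnionE)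
      obtain H where H: "H \<in> C" "q \<in> H" using pq by (rule_tac UnionE)
      have "G \<subseteq> H \<or> H \<subseteq> G" using C(2) G(1) H(1) unfolding subset_chain_def by simp
      then show ?thesis using G H by (metis subsetD)
    qed
    have "derivation_graph (\<Union>C)"
      unfolding derivation_graph_def
    proof (intro conjI allI impI)
      obtain G where "G \<in> C" using C(1) by (metis ex_in_conv)
      moreover from CG(1)[OF this] have "(1, 0) \<in> G" by (simp add: derivation_graph_def)
      ultimately show "(1, 0) \<in> \<Union>C" by (rule UnionI)
    next
      fix a a' assume "(a, a') \<in> \<Union>C"
      then obtain G where G: "G \<in> C" "(a, a') \<in> G" by (rule UnionE)
      then have "(- a, - a') \<in> G" using CG(1)[OF G(1)] by (simp add: derivation_graph_def)
      with G(1) show "(- a, - a') \<in> \<Union>C" by (rule UnionI)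
    next
      fix c assume "(0, c) \<in> \<Union>C"
      then obtain G where G: "G \<in> C" "(0, c) \<in> G" by (rule UnionE)
      then show "c = 0" using CG(1)[OF G(1)] by (simp add: derivation_graph_def)
    next
      fix a a' b b' assume "(a, a') \<in> \<Union>C" "(b, b') \<in> \<Union>C"
      from ch[OF this] obtain G where G: "G \<in> C" "(a, a') \<in> G" "(b, b') \<in> G" by blast
      then have "(a + b, a' + b') \<in> G" "(a * b, a' * b + a * b') \<in> G"
        using CG(1)[OF G(1)] by (simp_all add: derivation_graph_def)
      with G(1) show "(a + b, a' + b') \<in> \<Union>C" "(a * b, a' * b + a * b') \<in> \<Union>C"
        by blast+
    qed
    moreover have "G0 \<subseteq> \<Union>C" using C(1) CG(2) by (metis Sup_upper2 ex_in_conv)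
    ultimately show "\<Union>C \<in> GG" unfolding GG_def by simp
  qed
  then obtain M where M: "M \<in> GG" "\<And>Z. Z \<in> GG \<Longrightarrow> M \<subseteq> Z \<Longrightarrow> Z = M" by metis
  then have dM: "derivation_graph M" and G0M: "G0 \<subseteq> M" by (simp_all add: GG_def)
  obtain E where E: "partial_derivation (fst ` M) E" "\<And>a b. (a, b) \<in> M \<Longrightarrow> E a = b"
    using partial_derivation_of_graph[OF dM] by metis
  \<comment> \<open>By maximality: adjoining \<open>r\<close> with \<open>extend_one\<close> gives a
    graph containing \<open>M\<close>, hence \<open>M\<close> itself.\<close>
  have "r \<in> fst ` M" for r
  proof -
    obtain A' D' where A': "partial_derivation A' D'" "fst ` M \<subseteq> A'" "\<forall>a\<in>fst ` M. D' a = E a" "r \<in> A'"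
      using extend_one[OF E(1), of r] by metis
    define Z where "Z = (\<lambda>a. (a, D' a)) ` A'"
    have MX: "M \<subseteq> Z"
    proof
      fix q assume q: "q \<in> M"
      then have 1: "E (fst q) = snd q" using E(2)[of "fst q" "snd q"] by simp
      have 2: "fst q \<in> fst ` M" using q by (rule imageI)
      then have "q = (fst q, D' (fst q))" using A'(3) 1 by (metis prod.collapse)
      moreover have "fst q \<in> A'" using A'(2) 2 by (rule subsetD)
      ultimately show "q \<in> Z" unfolding Z_def by (rule image_eqI)
    qed
    have "derivation_graph Z" unfolding Z_def by (rule graph_of_partial_derivation[OF A'(1)])
    then have "Z \<in> GG" using MX G0M unfolding GG_def by simp
    then have "Z = M" using M(2) MX by simp
    moreover have "(r, D' r) \<in> Z" using A'(4) unfolding Z_def by (rule imageI)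
    ultimately show ?thesis by (metis fst_conv imageI)
  qed
  then have "fst ` M = UNIV" by blast
  moreover have "E a = D a" if "a \<in> A" for a
  proof -
    have "(a, D a) \<in> G0" using that unfolding G0_def by (rule imageI)
    then show ?thesis using E(2) G0M by (metis subsetD)
  qed
  ultimately show thesis using that[of E] E(1) by simp
qed

section \<open>Linear algebra and algebraic independence\<close>

text \<open>Gaussian elimination, by induction on the equations: an unknown \<open>a0\<close> that
  occurs in equation \<open>b0\<close> is eliminated from the others and finally computed from
  \<open>b0\<close>.\<close>

lemma linear_dependence:
  fixes M :: "'a \<Rightarrow> 'b \<Rightarrow> real"
  assumes "finite B" "finite A" "card B < card A"
  shows "\<exists>c. (\<exists>a\<in>A. c a \<noteq> 0) \<and> (\<forall>b\<in>B. (\<Sum>a\<in>A. c a * M a b) = 0)"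
  using assms
proof (induction B arbitrary: A M rule: finite_induct)
  case empty
  then show ?case by (intro exI[of _ "\<lambda>_. 1"]) (auto simp: card_gt_0_iff)
next
  case (insert b0 B)
  show ?case
  proof (cases "\<forall>a\<in>A. M a b0 = 0")
    case True
    have "card B < card A" using insert by simp
    from insert.IH[OF insert.prems(1) this, of M] show ?thesis using True by auto
  next
    case False
    then obtain a0 where a0: "a0 \<in> A" "M a0 b0 \<noteq> 0" by blast
    have "card B < card (A - {a0})" using insert a0 by simp
    from insert.IH[OF _ this, of "\<lambda>a b. M a b - M a b0 / M a0 b0 * M a0 b"] insert.prems(1)
    obtain c where c: "\<exists>a\<in>A - {a0}. c a \<noteq> 0"
      "\<And>b. b \<in> B \<Longrightarrow> (\<Sum>a\<in>A - {a0}. c a * (M a b - M a b0 / M a0 b0 * M a0 b)) = 0"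
      by auto
    define s where "s = (\<Sum>a\<in>A - {a0}. c a * M a b0)"
    define c' where "c' = c(a0 := - s / M a0 b0)"
    have split: "(\<Sum>a\<in>A. c' a * M a b) = - s / M a0 b0 * M a0 b + (\<Sum>a\<in>A - {a0}. c a * M a b)" for b
      using insert.prems(1) a0 by (subst sum.remove[of _ a0]) (auto simp: c'_def intro!: sum.cong)
    have "(\<Sum>a\<in>A. c' a * M a b) = 0" if "b \<in> B" for b
    proof -
      have "(\<Sum>a\<in>A - {a0}. c a * (M a b - M a b0 / M a0 b0 * M a0 b)) =
          (\<Sum>a\<in>A - {a0}. c a * M a b) - s / M a0 b0 * M a0 b"
      proof -
        have "s / M a0 b0 * M a0 b = (\<Sum>a\<in>A - {a0}. c a * (M a b0 / M a0 b0 * M a0 b))"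
          unfolding s_def sum_divide_distrib sum_distrib_right by (intro sum.cong refl) simp
        then show ?thesis by (simp add: right_diff_distrib sum_subtractf)
      qed
      then show ?thesis using c(2)[OF that] unfolding split by simp
    qed
    moreover have "(\<Sum>a\<in>A. c' a * M a b0) = 0" using a0 by (simp add: split s_def)
    moreover have "\<exists>a\<in>A. c' a \<noteq> 0" using c(1) by (auto simp: c'_def)
    ultimately show ?thesis by (intro exI[of _ c']) auto
  qed
qed

text \<open>The right-hand side becomes one more unknown, \<open>None\<close>, so that there are
  more unknowns than equations. Injectivity makes its coefficient in a dependence nonzero, and
  dividing by it solves the system.\<close>

lemma linear_solvable:
  fixes M :: "'a \<Rightarrow> 'b \<Rightarrow> real"
  assumes "finite A" "finite B" "card A = card B"
    and inj: "\<And>c. (\<forall>b\<in>B. (\<Sum>a\<in>A. c a * M a b) = 0) \<Longrightarrow> \<forall>a\<in>A. c a = 0"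
  shows "\<exists>c. \<forall>b\<in>B. (\<Sum>a\<in>A. c a * M a b) = g b"
proof -
  define A' where "A' = insert None (Some ` A)"
  have fin: "finite A'" using assms(1) by (simp add: A'_def)
  have "card (Some ` A) = card A" by (rule card_image) simp
  then have crd: "card B < card A'" using assms(1,3) by (simp add: A'_def)
  define M' where "M' a b = (case a of None \<Rightarrow> g b | Some a \<Rightarrow> M a b)" for a b
  from linear_dependence[OF assms(2) fin crd, of M']
  obtain c where c1: "\<exists>a\<in>A'. c a \<noteq> 0" and c2: "\<forall>b\<in>B. (\<Sum>a\<in>A'. c a * M' a b) = 0"
    by (elim exE conjE)
  have split: "(\<Sum>a\<in>A'. c a * M' a b) =
      c None * g b + (\<Sum>a\<in>A. c (Some a) * M a b)" for b
  proof -
    have "None \<notin> Some ` A" by blast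
    then show ?thesis using assms(1) by (simp add: A'_def M'_def sum.reindex)
  qed
  have "c None \<noteq> 0"
  proof
    assume z: "c None = 0"
    have "\<forall>b\<in>B. (\<Sum>a\<in>A. c (Some a) * M a b) = 0"
      using c2 z unfolding split by simp
    then have "\<forall>a\<in>A. c (Some a) = 0" by (rule inj)
    then show False using c1 z unfolding A'_def by blast
  qed
  have "(\<Sum>a\<in>A. (- c (Some a) / c None) * M a b) = g b" if "b \<in> B" for b
  proof -
    have "(\<Sum>a\<in>A. (- c (Some a) / c None) * M a b) = - (\<Sum>a\<in>A. c (Some a) * M a b) / c None"
      unfolding sum_divide_distrib by (subst sum_negf[symmetric], subst sum_divide_distrib) (rule sum.cong, simp_all)
    also have "\<dots> = g b"
    proof -
      have "- (\<Sum>a\<in>A. c (Some a) * M a b) = c None * g b"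
      proof -
        have "c None * g b + (\<Sum>a\<in>A. c (Some a) * M a b) = 0" using c2 that unfolding split by blast
        then show ?thesis by linarith
      qed
      then show ?thesis using \<open>c None \<noteq> 0\<close> by simp
    qed
    finally show ?thesis .
  qed
  then show ?thesis by (intro exI[of _ "\<lambda>a. - c (Some a) / c None"] ballI)
qed

section \<open>Evaluation of multivariate polynomials\<close>

definition monomial_value :: "(real \<Rightarrow>\<^sub>0 nat) \<Rightarrow> real" where
  "monomial_value m = (\<Prod>x\<in>Poly_Mapping.keys m. x ^ Poly_Mapping.lookup m x)"

lemma monomial_value_superset:
  "finite Y \<Longrightarrow> Poly_Mapping.keys m \<subseteq> Y \<Longrightarrow> monomial_value m = (\<Prod>x\<in>Y. x ^ Poly_Mapping.lookup m x)"
  unfolding monomial_value_def by (rule prod.mono_neutral_left) (auto simp: in_keys_iff)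

lemma monomial_value_add: "monomial_value (m + n) = monomial_value m * monomial_value n"
proof -
  define Y where "Y = Poly_Mapping.keys m \<union> Poly_Mapping.keys n"
  have Y: "finite Y" "Poly_Mapping.keys m \<subseteq> Y" "Poly_Mapping.keys n \<subseteq> Y" "Poly_Mapping.keys (m + n) \<subseteq> Y"
    using Poly_Mapping.keys_add[of m n] by (auto simp: Y_def)
  show ?thesis
    using Y by (simp add: monomial_value_superset[OF Y(1)] lookup_add power_add prod.distrib)
qed

lemma monomial_value_single: "monomial_value (Poly_Mapping.single x i) = x ^ i"
  by (simp add: monomial_value_superset[of "{x}"])

lemma poly_value_superset:
  "finite Y \<Longrightarrow> Poly_Mapping.keys P \<subseteq> Y \<Longrightarrow>
    poly_value P = (\<Sum>m\<in>Y. Poly_Mapping.lookup P m * monomial_value m)"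
  unfolding poly_value_def monomial_value_def by (rule sum.mono_neutral_left) (auto simp: in_keys_iff)

lemma poly_value_add: "poly_value (P + Q) = poly_value P + poly_value Q"
proof -
  define Y where "Y = Poly_Mapping.keys P \<union> Poly_Mapping.keys Q"
  have Y: "finite Y" "Poly_Mapping.keys P \<subseteq> Y" "Poly_Mapping.keys Q \<subseteq> Y" "Poly_Mapping.keys (P + Q) \<subseteq> Y"
    using Poly_Mapping.keys_add[of P Q] by (auto simp: Y_def)
  show ?thesis
    using Y by (simp add: poly_value_superset[OF Y(1)] lookup_add ring_distribs sum.distrib)
qed

lemma poly_value_0: "poly_value 0 = 0"
  by (simp add: poly_value_def)

lemma poly_value_single: "poly_value (Poly_Mapping.single m c) = c * monomial_value m"
  by (simp add: poly_value_superset[of "{m}"])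

lemma poly_value_sum: "poly_value (\<Sum>i\<in>I. f i) = (\<Sum>i\<in>I. poly_value (f i))"
  by (induction I rule: infinite_finite_induct) (auto simp: poly_value_add poly_value_0)

definition polys_over :: "real set \<Rightarrow> real set \<Rightarrow> ((real \<Rightarrow>\<^sub>0 nat) \<Rightarrow>\<^sub>0 real) set" where
  "polys_over K S = {P. \<forall>m\<in>Poly_Mapping.keys P. Poly_Mapping.lookup P m \<in> K \<and> Poly_Mapping.keys m \<subseteq> S}"

lemma polys_over_0: "0 \<in> polys_over K S"
  by (simp add: polys_over_def)

lemma polys_over_single:
  "c \<in> K \<Longrightarrow> Poly_Mapping.keys m \<subseteq> S \<Longrightarrow> Poly_Mapping.single m c \<in> polys_over K S"
  by (auto simp: polys_over_def)

lemma polys_over_lookup: "real_subring K \<Longrightarrow> P \<in> polys_over K S \<Longrightarrow> Poly_Mapping.lookup P m \<in> K"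
  using real_subringD(2)[of K] by (cases "m \<in> Poly_Mapping.keys P") (auto simp: polys_over_def in_keys_iff)

lemma polys_over_add:
  assumes K: "real_subring K" and PQ: "P \<in> polys_over K S" "Q \<in> polys_over K S"
  shows "P + Q \<in> polys_over K S"
proof -
  have "Poly_Mapping.lookup (P + Q) m \<in> K" for m
    using PQ by (auto simp: lookup_add intro!: real_subringD(4)[OF K] polys_over_lookup[OF K])
  moreover have "Poly_Mapping.keys m \<subseteq> S" if "m \<in> Poly_Mapping.keys (P + Q)" for m
    using that PQ Poly_Mapping.keys_add[of P Q] unfolding polys_over_def by blast
  ultimately show ?thesis by (auto simp: polys_over_def)
qed

lemma polys_over_sum:
  assumes "real_subring K" "\<And>i. i \<in> I \<Longrightarrow> f i \<in> polys_over K S"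
  shows "sum f I \<in> polys_over K S"
  using assms(2) by (induction I rule: infinite_finite_induct) (auto intro!: polys_over_add assms(1) polys_over_0)

text \<open>This is the ring generated by \<open>K\<close> and \<open>S\<close>, the domain from
  which a derivation will be extended to a further independent number.\<close>

lemma real_subring_values:
  assumes K: "real_subring K"
  shows "real_subring (poly_value ` polys_over K S)"
  unfolding real_subring_def
proof (intro conjI ballI)
  show "1 \<in> poly_value ` polys_over K S"
    by (rule image_eqI[OF _ polys_over_single[of 1 K 0]])
      (simp_all add: poly_value_single real_subringD[OF K] monomial_value_def del: single_one)
next
  fix a assume "a \<in> poly_value ` polys_over K S"
  then obtain P where P: "a = poly_value P" "P \<in> polys_over K S" by blast
  show "- a \<in> poly_value ` polys_over K S"
  proof (rule image_eqI)
    show "- a = poly_value (- P)" by (simp add: P(1) poly_value_def sum_negf)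
    show "- P \<in> polys_over K S" using P(2) real_subringD(3)[OF K] by (auto simp: polys_over_def)
  qed
  fix b assume "b \<in> poly_value ` polys_over K S"
  then obtain Q where Q: "b = poly_value Q" "Q \<in> polys_over K S" by blast
  show "a + b \<in> poly_value ` polys_over K S"
    by (rule image_eqI[OF _ polys_over_add[OF K P(2) Q(2)]]) (simp add: P Q poly_value_add)
  define R where "R = (\<Sum>m\<in>Poly_Mapping.keys P. \<Sum>n\<in>Poly_Mapping.keys Q.
    Poly_Mapping.single (m + n) (Poly_Mapping.lookup P m * Poly_Mapping.lookup Q n))"
  show "a * b \<in> poly_value ` polys_over K S"
  proof (rule image_eqI)
    show "a * b = poly_value R"
      unfolding R_def P(1) Q(1) poly_value_sum poly_value_single monomial_value_add
      unfolding poly_value_def monomial_value_def[symmetric] sum_product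
      by (simp add: mult_ac)
    show "R \<in> polys_over K S"
      unfolding R_def
    proof (intro polys_over_sum K polys_over_single)
      fix m n assume "m \<in> Poly_Mapping.keys P" "n \<in> Poly_Mapping.keys Q"
      then show "Poly_Mapping.keys (m + n) \<subseteq> S"
        "Poly_Mapping.lookup P m * Poly_Mapping.lookup Q n \<in> K"
        using P(2) Q(2) Poly_Mapping.keys_add[of m n] real_subringD(5)[OF K] unfolding polys_over_def by blast+
    qed
  qed
qed

text \<open>Writing the coefficients of \<open>g\<close> as polynomials \<open>P i\<close> in the
  other elements turns \<open>poly g s = 0\<close> into one polynomial relation \<open>R\<close>
  over \<open>K\<close> in \<open>S\<close>, which must be trivial. Since the coefficients of
  \<open>R\<close> are those of the \<open>P i\<close>, these vanish too.\<close>

lemma transcendental_over_others: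
  assumes K: "real_subring K" and ind: "algebraically_independent K S" and s: "s \<in> S"
    and g: "g \<in> polys_in (poly_value ` polys_over K (S - {s}))" and root: "poly g s = 0"
  shows "g = 0"
proof -
  have "\<forall>i. \<exists>P. P \<in> polys_over K (S - {s}) \<and> poly_value P = Polynomial.coeff g i"
  proof
    fix i
    have "Polynomial.coeff g i \<in> poly_value ` polys_over K (S - {s})" using g by (simp add: polys_in_def)
    then show "\<exists>P. P \<in> polys_over K (S - {s}) \<and> poly_value P = Polynomial.coeff g i" by force
  qed
  then obtain P where P: "\<And>i. P i \<in> polys_over K (S - {s})" "\<And>i. poly_value (P i) = Polynomial.coeff g i"
    by metis
  define N where "N = Polynomial.degree g"
  define R where "R = (\<Sum>i\<le>N. \<Sum>m\<in>Poly_Mapping.keys (P i).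
    Poly_Mapping.single (m + Poly_Mapping.single s i) (Poly_Mapping.lookup (P i) m))"
  have "poly_value R = (\<Sum>i\<le>N. Polynomial.coeff g i * s ^ i)"
    unfolding R_def poly_value_sum poly_value_single monomial_value_add monomial_value_single
      P(2)[symmetric] unfolding poly_value_def monomial_value_def[symmetric] sum_distrib_right
    by (simp add: mult_ac)
  also have "\<dots> = 0" using root by (simp add: poly_altdef N_def)
  finally have "poly_value R = 0" .
  moreover have "R \<in> polys_over K S"
    unfolding R_def
  proof (intro polys_over_sum K polys_over_single)
    fix i m assume "m \<in> Poly_Mapping.keys (P i)"
    then have "Poly_Mapping.keys m \<subseteq> S - {s}" "Poly_Mapping.lookup (P i) m \<in> K"
      using P(1)[of i] unfolding polys_over_def by blast+
    then show "Poly_Mapping.keys (m + Poly_Mapping.single s i) \<subseteq> S" "Poly_Mapping.lookup (P i) m \<in> K"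
      using Poly_Mapping.keys_add[of m "Poly_Mapping.single s i"] s by (auto split: if_splits)
  qed
  ultimately have R0: "R = 0"
    using ind unfolding algebraically_independent_def polys_over_def by blast
  have "P i = 0" if i: "i \<le> N" for i
  proof (rule ccontr)
    assume "P i \<noteq> 0"
    then obtain m where m: "m \<in> Poly_Mapping.keys (P i)" by (metis keys_eq_empty ex_in_conv)
    \<comment> \<open>No monomial of a \<open>P j\<close> contains \<open>s\<close>, so the exponent
      of \<open>s\<close> in \<open>n + Poly_Mapping.single s j\<close> reveals \<open>j\<close>,
      and no two terms of \<open>R\<close> merge.\<close>
    have sm: "Poly_Mapping.lookup n s = 0" if "n \<in> Poly_Mapping.keys (P j)" for n j
    proof -
      have "Poly_Mapping.keys n \<subseteq> S - {s}" using that P(1)[of j] unfolding polys_over_def by blast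
      then have "s \<notin> Poly_Mapping.keys n" by blast
      then show ?thesis by (simp add: in_keys_iff)
    qed
    have key: "n + Poly_Mapping.single s j = m + Poly_Mapping.single s i \<longleftrightarrow> n = m \<and> j = i"
      if "n \<in> Poly_Mapping.keys (P j)" for n j
    proof
      assume e: "n + Poly_Mapping.single s j = m + Poly_Mapping.single s i"
      then have "Poly_Mapping.lookup (n + Poly_Mapping.single s j) s = Poly_Mapping.lookup (m + Poly_Mapping.single s i) s"
        by simp
      then have "j = i" using sm[OF that] sm[OF m] by (simp add: lookup_add)
      then show "n = m \<and> j = i" using e by simp
    qed auto
    have "Poly_Mapping.lookup R (m + Poly_Mapping.single s i) =
       (\<Sum>j\<le>N. \<Sum>n\<in>Poly_Mapping.keys (P j). if n = m \<and> j = i then Poly_Mapping.lookup (P j) n else 0)"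
      unfolding R_def lookup_sum
      by (intro sum.cong refl) (auto simp: lookup_single when_def key)
    also have "\<dots> = (\<Sum>j\<le>N. if j = i then Poly_Mapping.lookup (P i) m else 0)"
      using m by (intro sum.cong refl) auto
    also have "\<dots> = Poly_Mapping.lookup (P i) m" using i by simp
    finally show False using R0 m by (simp add: in_keys_iff)
  qed
  then have "Polynomial.coeff g i = 0" if "i \<le> N" for i using P(2)[of i] that by (simp add: poly_value_0)
  then show ?thesis by (metis N_def leading_coeff_0_iff order_refl)
qed

text \<open>The derivation is zero on the ring generated by \<open>K\<close> and the other elements
  of \<open>S\<close>; as \<open>s\<close> is transcendental over that ring, the value 1 may be
  prescribed at \<open>s\<close>.\<close>

lemma independent_derivation:
  assumes K: "real_subring K" and ind: "algebraically_independent K S" and s: "s \<in> S"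
  obtains D where "derivation K D" "\<And>t. t \<in> S \<Longrightarrow> D t = (if t = s then 1 else 0)"
proof -
  define A where "A = poly_value ` polys_over K (S - {s})"
  have "partial_derivation A (\<lambda>_. 0)" using real_subring_values[OF K] by (simp add: partial_derivation_def A_def)
  from extend_transcendental[OF this, of s 1] transcendental_over_others[OF K ind s]
  obtain A' D' where A': "partial_derivation A' D'" "A \<subseteq> A'" "\<forall>a\<in>A. D' a = 0" "s \<in> A'" "D' s = 1"
    unfolding A_def by blast
  obtain D where D: "partial_derivation UNIV D" "\<And>a. a \<in> A' \<Longrightarrow> D a = D' a" using extend_derivation[OF A'(1)] by blast
  have "r \<in> A" if "r \<in> K" for r
    unfolding A_def
    by (rule image_eqI[OF _ polys_over_single[of r K 0]])
      (use that in \<open>auto simp: poly_value_single monomial_value_def\<close>)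
  moreover have "t \<in> A" if "t \<in> S" "t \<noteq> s" for t
    unfolding A_def
    by (rule image_eqI[OF _ polys_over_single[of 1 K "Poly_Mapping.single t 1"]])
      (use that in \<open>auto simp: poly_value_single monomial_value_single real_subringD[OF K]\<close>)
  ultimately show thesis using A' D by (intro that[of D]) (auto simp: derivation_def partial_derivation_def subset_iff)
qed

section \<open>Distances between points of lines\<close>

text \<open>\<open>real\<close> is a Euclidean ring in this context, and these rewrite rules for \<open>div\<close> undo the
  combination of fractions by \<open>field_simps\<close>.\<close>

declare div_add [simp del] div_diff [simp del] div_mult_self1 [simp del] div_mult_self2 [simp del]
  div_mult_self3 [simp del] div_mult_self4 [simp del]

lemma derivationD:
  assumes "derivation K D"
  shows "D (a + b) = D a + D b" "D (a * b) = D a * b + a * D b" "r \<in> K \<Longrightarrow> D r = 0"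
    "D 0 = 0" "D 1 = 0" "D (- a) = - D a" "D (a - b) = D a - D b" "D (numeral n) = 0"
    "D (inverse a) = - D a / a\<^sup>2" "D (a / b) = D a / b - a * D b / b\<^sup>2" "D (a\<^sup>2) = 2 * a * D a"
proof -
  show add: "D (a + b) = D a + D b" and mul: "D (a * b) = D a * b + a * D b" for a b
    using assms by (simp_all add: derivation_def)
  show "r \<in> K \<Longrightarrow> D r = 0" using assms by (simp add: derivation_def)
  show 0: "D 0 = 0" using add[of 0 0] by simp
  show 1: "D 1 = 0" using mul[of 1 1] by simp
  show neg: "D (- a) = - D a" for a
  proof -
    have "D 0 = D a + D (- a)" using add[of a "-a"] by (simp only: right_minus)
    then show ?thesis using 0 by linarith
  qed
  show "D (a - b) = D a - D b" using add[of a "-b"] neg[of b] by (simp only: diff_conv_add_uminus)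
  have nat: "D (of_nat m) = 0" for m by (induction m) (simp_all add: 0 1 add)
  from nat[of "numeral n"] show "D (numeral n) = 0" by simp
  show inv: "D (inverse a) = - D a / a\<^sup>2" for a
  proof (cases "a = 0")
    case True
    then show ?thesis by (simp add: 0)
  next
    case False
    have "D a * inverse a + a * D (inverse a) = D 1"
      using mul[of a "inverse a"] False by (simp only: right_inverse not_False_eq_True)
    then have "a * D (inverse a) = - D a * inverse a" using 1 by linarith
    then have "inverse a * (a * D (inverse a)) = inverse a * (- D a * inverse a)" by simp
    then have "(inverse a * a) * D (inverse a) = - D a * (inverse a * inverse a)"
      by (simp only: mult_ac)
    then show ?thesis using False by (simp add: power2_eq_square divide_inverse)
  qed
  have "D (a / b) = D a * inverse b + a * (- D b / b\<^sup>2)"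
    unfolding divide_inverse[of a b] mul inv ..
  then show "D (a / b) = D a / b - a * D b / b\<^sup>2" by (simp add: divide_inverse)
  show "D (a\<^sup>2) = 2 * a * D a" unfolding power2_eq_square mul by simp
qed

text \<open>Logarithmic derivatives turn the products of edge ratios in \<open>rigid_vertex\<close>
  into sums.\<close>

lemma derivation_log:
  assumes D: "derivation K D" and nz: "\<rho> \<noteq> 0" "p \<noteq> 0" "r \<noteq> 0"
  shows "D (- \<rho> * p / r) / (- \<rho> * p / r) = D \<rho> / \<rho> + D p / p - D r / r"
proof -
  have "D (- \<rho> * p / r) = (- D \<rho> * p + - \<rho> * D p) / r - (- \<rho> * p) * D r / r\<^sup>2"
    unfolding derivationD(10)[OF D] derivationD(2)[OF D] derivationD(6)[OF D] ..
  moreover have "((- a * p + - \<rho> * b) / r - (- \<rho> * p) * c / r\<^sup>2) / (- \<rho> * p / r) = a / \<rho> + b / p - c / r"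
    for a b c
    using nz by (simp add: field_simps power2_eq_square)
  ultimately show ?thesis by simp
qed

lemma derivation_sum: "derivation K D \<Longrightarrow> D (sum f I) = (\<Sum>i\<in>I. D (f i))"
  by (induction I rule: infinite_finite_induct) (auto simp: derivationD)

lemma derivation_lin_comb:
  assumes "\<And>i. i \<in> I \<Longrightarrow> derivation K (D i)"
  shows "derivation K (\<lambda>r. \<Sum>i\<in>I. c i * D i r)"
  using assms
  by (induction I rule: infinite_finite_induct) (auto simp: derivation_def algebra_simps)

text \<open>The commutator of two members of a dual family kills every \<open>x v\<close>. By
  rigidity it then kills the coordinates of a solution, whose mixed partial derivatives therefore
  commute.\<close>

lemma derivation_commutator:
  assumes "derivation K D" "derivation K E"
  shows "derivation K (\<lambda>r. D (E r) - E (D r))"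
  using derivationD(1-4)[OF assms(1)] derivationD(1-4)[OF assms(2)] unfolding derivation_def by (simp add: algebra_simps)

text \<open>A family of derivations dual to \<open>x\<close> is how algebraic independence of the \<open>x v\<close> over \<open>K\<close> is used.\<close>

definition dual :: "real set \<Rightarrow> 'v set \<Rightarrow> ('v \<Rightarrow> real) \<Rightarrow> ('v \<Rightarrow> real \<Rightarrow> real) \<Rightarrow> bool" where
  "dual K W x \<Delta> \<longleftrightarrow> (\<forall>v\<in>W. derivation K (\<Delta> v) \<and> (\<forall>w\<in>W. \<Delta> v (x w) = (if w = v then 1 else 0)))"

lemma dualD:
  assumes "dual K W x \<Delta>" "v \<in> W"
  shows "derivation K (\<Delta> v)" "w \<in> W \<Longrightarrow> \<Delta> v (x w) = (if w = v then 1 else 0)"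
  using assms by (auto simp: dual_def)

lemma dual_subset: "dual K W x \<Delta> \<Longrightarrow> U \<subseteq> W \<Longrightarrow> dual K U x \<Delta>"
  unfolding dual_def by blast

text \<open>The matrix of the values \<open>D a (y w)\<close> is square and injective, hence
  invertible; its inverse gives the combinations of the \<open>D a\<close> that are dual to
  \<open>y\<close>.\<close>

lemma dual_transfer:
  assumes "finite A" "finite W" "card A = card W" and D: "\<And>a. a \<in> A \<Longrightarrow> derivation K (D a)"
    and inj: "\<And>c. (\<And>w. w \<in> W \<Longrightarrow> (\<Sum>a\<in>A. c a * D a (y w)) = 0) \<Longrightarrow> \<forall>a\<in>A. c a = 0"
  obtains \<Delta> where "dual K W y \<Delta>"
proof -
  have "\<exists>c. \<forall>w\<in>W. (\<Sum>a\<in>A. c a * D a (y w)) = (if w = v then 1 else 0)" for v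
    by (rule linear_solvable[OF assms(1-3)]) (use inj in blast)
  then obtain c where c: "\<And>v w. w \<in> W \<Longrightarrow> (\<Sum>a\<in>A. c v a * D a (y w)) = (if w = v then 1 else 0)"
    by metis
  have "dual K W y (\<lambda>v r. \<Sum>a\<in>A. c v a * D a r)"
    unfolding dual_def using c derivation_lin_comb[OF D] by auto
  then show thesis by (rule that)
qed

definition delete_edge :: "('v \<times> 'v) set \<Rightarrow> 'v \<Rightarrow> 'v \<Rightarrow> ('v \<times> 'v) set" where
  "delete_edge F a b = F - {(a, b), (b, a)}"

definition induced :: "('v \<times> 'v) set \<Rightarrow> 'v set \<Rightarrow> ('v \<times> 'v) set" where
  "induced F W = F \<inter> W \<times> W"

text \<open>\<open>A\<close> and \<open>B\<close> are inner products of direction vectors,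
  \<open>F\<close> the least squared distance of two lines. General position enters three times:
  \<open>B_nz\<close> says that lines are not perpendicular, \<open>CS\<close>, the strict
  Cauchy-Schwarz inequality, that they are not parallel, and \<open>c_distinct\<close> that no three
  are weakly concurrent. The conventions for equal indices let one formula cover distances on a
  single line.\<close>

locale line_data =
  fixes K :: "real set" and I :: "'i set"
    and A :: "'i \<Rightarrow> real" and B c F :: "'i \<Rightarrow> 'i \<Rightarrow> real" and l :: "'v \<Rightarrow> 'i"
  assumes A_pos: "i \<in> I \<Longrightarrow> 0 < A i"
    and B_sym: "i \<in> I \<Longrightarrow> j \<in> I \<Longrightarrow> B i j = B j i" and B_same: "i \<in> I \<Longrightarrow> B i i = A i"
    and c_same: "i \<in> I \<Longrightarrow> c i i = 0" and F_sym: "i \<in> I \<Longrightarrow> j \<in> I \<Longrightarrow> F i j = F j i"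
    and F_same: "i \<in> I \<Longrightarrow> F i i = 0"
    and B_nz: "i \<in> I \<Longrightarrow> j \<in> I \<Longrightarrow> B i j \<noteq> 0"
    and CS: "i \<in> I \<Longrightarrow> j \<in> I \<Longrightarrow> i \<noteq> j \<Longrightarrow> B i j * B i j < A i * A j"
    and c_distinct: "i \<in> I \<Longrightarrow> j \<in> I \<Longrightarrow> m \<in> I \<Longrightarrow> i \<noteq> j \<Longrightarrow> i \<noteq> m \<Longrightarrow> j \<noteq> m \<Longrightarrow> c i j \<noteq> c i m"
    and derivation_const: "derivation K D \<Longrightarrow> i \<in> I \<Longrightarrow> j \<in> I \<Longrightarrow> D (A i) = 0 \<and> D (B i j) = 0 \<and> D (c i j) = 0"
begin

text \<open>\<open>q i j s t\<close> is the squared distance between the points with parameters \<open>s\<close> and \<open>t\<close> on lines \<open>i\<close>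
  and \<open>j\<close>, and \<open>h i j s t\<close> is its derivative in \<open>s\<close>; \<open>c i j\<close> is the parameter of the point of line \<open>i\<close>
  closest to line \<open>j\<close>.\<close>

definition q :: "'i \<Rightarrow> 'i \<Rightarrow> real \<Rightarrow> real \<Rightarrow> real" where
  "q i j s t = A i * (s - c i j)\<^sup>2 - 2 * B i j * (s - c i j) * (t - c j i) + A j * (t - c j i)\<^sup>2 + F i j"

definition h :: "'i \<Rightarrow> 'i \<Rightarrow> real \<Rightarrow> real \<Rightarrow> real" where
  "h i j s t = 2 * A i * (s - c i j) - 2 * B i j * (t - c j i)"

definition Q :: "('v \<Rightarrow> real) \<Rightarrow> 'v \<Rightarrow> 'v \<Rightarrow> real" where
  "Q y u v = q (l u) (l v) (y u) (y v)"

definition H :: "('v \<Rightarrow> real) \<Rightarrow> 'v \<Rightarrow> 'v \<Rightarrow> real" where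
  "H y u v = h (l u) (l v) (y u) (y v)"

lemma Q_sym: "l u \<in> I \<Longrightarrow> l v \<in> I \<Longrightarrow> Q y u v = Q y v u"
  by (simp add: Q_def q_def B_sym[of "l u" "l v"] F_sym[of "l u" "l v"] algebra_simps)

lemma derivation_H:
  assumes "derivation K D" "l u \<in> I" "l v \<in> I"
  shows "D (H y u v) = 2 * A (l u) * D (y u) - 2 * B (l u) (l v) * D (y v)"
  using derivation_const[OF assms] derivation_const[OF assms(1,3,2)]
  by (simp add: H_def h_def derivationD[OF assms(1)])

text \<open>The product rule applied to an edge equation, with the constant \<open>F\<close>
  subtracted on both sides first; \<open>H\<close> collects the partial derivatives of
  \<open>Q\<close>.\<close>

lemma derivation_Q_eq:
  assumes "derivation K D" "l u \<in> I" "l v \<in> I" "Q y u v = Q x u v"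
  shows "H y u v * D (y u) + H y v u * D (y v) = H x u v * D (x u) + H x v u * D (x v)"
proof -
  have "D (Q y u v - F (l u) (l v)) = D (Q x u v - F (l u) (l v))" using assms(4) by simp
  then show ?thesis
    using derivation_const[OF assms(1-3)] derivation_const[OF assms(1,3,2)]
    by (simp add: Q_def q_def H_def h_def derivationD[OF assms(1)] B_sym[OF assms(3,2)] power2_eq_square algebra_simps)
qed

section \<open>Infinitesimal rigidity from a cycle with a cross edge\<close>

lemma H_nz:
  assumes "dual K W x \<Delta>" "u \<in> W" "v \<in> W" "u \<noteq> v" "l u \<in> I" "l v \<in> I"
  shows "H x u v \<noteq> 0"
proof
  assume "H x u v = 0"
  then have "\<Delta> u (H x u v) = 0" using derivationD(4)[OF dualD(1)[OF assms(1,2)]] by simp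
  then show False
    using derivation_H[OF dualD(1)[OF assms(1,2)] assms(5,6)] dualD(2)[OF assms(1,2)] assms A_pos[OF assms(5)] by simp
qed

text \<open>\<open>z\<close> is an infinitesimal motion. Along the path from \<open>a\<close> to
  \<open>b\<close> that avoids their edge, \<open>z b = \<rho> * z a\<close> with \<rho> a product
  of ratios of values of \<open>H\<close>. No edge of the path involves both \<open>x a\<close> and
  \<open>x b\<close>, so the mixed second derivative of log \<rho> vanishes. The edge
  \<open>ab\<close> itself gives \<open>\<rho> = - P / R\<close>, for which that derivative is not
  zero if the lines differ.\<close>

lemma rigid_vertex:
  assumes du: "dual K W x \<Delta>" and F: "Fe \<subseteq> W \<times> W" "irrefl Fe" "sym Fe" and lI: "l ` W \<subseteq> I"
    and e: "(a, b) \<in> Fe" "l a \<noteq> l b" and conn: "(a, b) \<in> (delete_edge Fe a b)\<^sup>*"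
    and z: "\<And>u v. (u, v) \<in> Fe \<Longrightarrow> H x u v * z u + H x v u * z v = 0"
  shows "z a = 0"
proof (rule ccontr)
  assume za: "z a \<noteq> 0"
  have ab: "a \<in> W" "b \<in> W" "a \<noteq> b" using e F by auto
  have I: "l a \<in> I" "l b \<in> I" using ab lI by auto
  define Da where "Da = \<Delta> a"
  define Db where "Db = \<Delta> b"
  have Da: "derivation K Da" and Db: "derivation K Db" using dualD(1)[OF du] ab by (auto simp: Da_def Db_def)
  note dsimps = derivationD[OF Da] derivationD[OF Db]
  have dx: "w \<in> W \<Longrightarrow> Da (x w) = (if w = a then 1 else 0)" "w \<in> W \<Longrightarrow> Db (x w) = (if w = b then 1 else 0)" for w
    using dualD(2)[OF du] ab by (auto simp: Da_def Db_def)
  have key: "\<exists>\<rho>. z w = \<rho> * z a \<and> \<rho> \<noteq> 0 \<and> Da (Db \<rho> / \<rho>) = 0" if "(a, w) \<in> (delete_edge Fe a b)\<^sup>*" for w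
    using that
  proof (induction rule: rtrancl_induct)
    case base
    show ?case by (intro exI[of _ 1]) (simp add: dsimps)
  next
    case (step w v)
    then obtain \<rho> where \<rho>: "z w = \<rho> * z a" "\<rho> \<noteq> 0" "Da (Db \<rho> / \<rho>) = 0" by blast
    have wv: "(w, v) \<in> Fe" "(w, v) \<noteq> (a, b)" "(w, v) \<noteq> (b, a)" using step by (auto simp: delete_edge_def)
    then have wv': "w \<in> W" "v \<in> W" "w \<noteq> v" "l w \<in> I" "l v \<in> I" using F lI by (auto simp: irrefl_def)
    have nz: "H x w v \<noteq> 0" "H x v w \<noteq> 0" using H_nz[OF du] wv' by auto
    have mix: "Da (Db (H x s t) / H x s t) = 0"
      if st: "s \<in> {w, v}" "t \<in> {w, v}" "s \<noteq> t" and n: "H x s t \<noteq> 0" for s t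
    proof (cases "b \<in> {s, t}")
      case False
      have "Db (H x s t) = 0" using st wv' False by (subst derivation_H[OF Db]) (auto simp: dx)
      then show ?thesis by (simp add: dsimps)
    next
      case True
      then have "a \<noteq> s" "a \<noteq> t" using st wv ab by auto
      then have "Da (H x s t) = 0" using st wv' by (subst derivation_H[OF Da]) (auto simp: dx)
      moreover have "Da (Db (H x s t)) = 0"
        using st wv' True derivation_const[OF Da, of "l s" "l t"] by (subst derivation_H[OF Db]) (auto simp: dx dsimps)
      ultimately show ?thesis by (simp add: dsimps)
    qed
    define \<sigma> where "\<sigma> = - \<rho> * H x w v / H x v w"
    have "H x v w * z v = - H x w v * z w" using z[OF wv(1)] by simp
    then have "z v = \<sigma> * z a" using nz by (simp add: \<sigma>_def \<rho> field_simps)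
    moreover have "\<sigma> \<noteq> 0" using nz \<rho> by (simp add: \<sigma>_def)
    moreover have "Db \<sigma> / \<sigma> = Db \<rho> / \<rho> + Db (H x w v) / H x w v - Db (H x v w) / H x v w"
      unfolding \<sigma>_def by (rule derivation_log[OF Db \<rho>(2) nz])
    then have "Da (Db \<sigma> / \<sigma>) = 0"
      using mix[of w v] mix[of v w] nz wv' \<rho>(3) by (simp add: derivationD(1,7)[OF Da])
    ultimately show ?case by blast
  qed
  obtain \<rho> where \<rho>: "z b = \<rho> * z a" "\<rho> \<noteq> 0" "Da (Db \<rho> / \<rho>) = 0" using key[OF conn] by blast
  define P where "P = H x a b"
  define R where "R = H x b a"
  define \<beta> where "\<beta> = B (l a) (l b)"
  have nz: "P \<noteq> 0" "R \<noteq> 0" using H_nz[OF du] ab I by (auto simp: P_def R_def)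
  have dP: "Da P = 2 * A (l a)" "Db P = - 2 * \<beta>" "Da R = - 2 * \<beta>" "Db R = 2 * A (l b)"
    using ab I dx derivation_H[OF Da] derivation_H[OF Db] B_sym[OF I] by (auto simp: P_def R_def \<beta>_def)
  have dc: "Da \<beta> = 0" "Da (A (l a)) = 0" "Da (A (l b)) = 0"
    using derivation_const[OF Da I] derivation_const[OF Da I(2) I(2)] by (auto simp: \<beta>_def)
  have "P * z a + R * (\<rho> * z a) = 0" using z[OF e(1)] \<rho>(1) by (simp add: P_def R_def)
  then have "(P + R * \<rho>) * z a = 0" by (simp add: algebra_simps)
  then have "P + R * \<rho> = 0" using za by simp
  then have "R * \<rho> = - P" by linarith
  then have \<rho>': "\<rho> = - 1 * P / R" using nz by (simp add: field_simps)
  have "Db \<rho> / \<rho> = (- 2 * \<beta>) / P - (2 * A (l b)) / R"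
    unfolding \<rho>' derivation_log[OF Db one_neq_zero nz] dP derivationD(5)[OF Db] by simp
  then have "Da ((- 2 * \<beta>) / P - (2 * A (l b)) / R) = 0" using \<rho>(3) by simp
  then have "- (- 2 * \<beta>) * (2 * A (l a)) / P\<^sup>2 + (2 * A (l b)) * (- 2 * \<beta>) / R\<^sup>2 = 0"
    unfolding derivationD(7,10,2,6,8)[OF Da] dP dc by simp
  then have "\<beta> * (A (l a) * R\<^sup>2 - A (l b) * P\<^sup>2) = 0" using nz by (simp add: divide_simps)
  \<comment> \<open>\<open>P\<close> and \<open>R\<close> are linear forms. Differentiating this
    relation twice in \<open>x a\<close> leaves
    \<open>\<beta> * \<beta> = A (l a) * A (l b)\<close>, the excluded case of parallel
    lines.\<close>
  then have 1: "A (l a) * (R * R) = A (l b) * (P * P)"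
    using B_nz[OF I] by (simp add: \<beta>_def power2_eq_square)
  then have "Da (A (l a) * (R * R)) = Da (A (l b) * (P * P))" by simp
  then have 2: "A (l a) * (- \<beta> * R) = A (l a) * (A (l b) * P)" by (simp add: dsimps dP dc algebra_simps)
  then have "- \<beta> * R = A (l b) * P"
    by (rule mult_left_cancel[THEN iffD1, rotated]) (use A_pos[OF I(1)] in simp)
  then have "Da (- \<beta> * R) = Da (A (l b) * P)" by simp
  then have "\<beta> * \<beta> = A (l a) * A (l b)" by (simp add: dsimps dP dc algebra_simps)
  then show False using CS[OF I e(2)] by (simp add: \<beta>_def)
qed

lemma zero_propagates:
  assumes du: "dual K W x \<Delta>" and F: "Fe \<subseteq> W \<times> W" "irrefl Fe" and lI: "l ` W \<subseteq> I"
    and z: "\<And>u v. (u, v) \<in> Fe \<Longrightarrow> H x u v * z u + H x v u * z v = 0"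
    and a: "z a = 0" and ab: "(a, b) \<in> Fe\<^sup>*"
  shows "z b = 0"
  using ab
proof (induction rule: rtrancl_induct)
  case base
  show ?case by (rule a)
next
  case (step w v)
  then have "w \<in> W" "v \<in> W" "w \<noteq> v" using F by (auto simp: irrefl_def)
  moreover from this have "l w \<in> I" "l v \<in> I" using lI by auto
  ultimately have "H x v w \<noteq> 0" using H_nz[OF du] by auto
  then show ?case using z[OF step(2)] step.IH by simp
qed

text \<open>Tame means that all cross edges are bridges; the last condition says that the edge lies
  on a cycle.\<close>

definition nontame :: "('v \<times> 'v) set \<Rightarrow> bool" where
  "nontame Fe \<longleftrightarrow> (\<exists>a b. (a, b) \<in> Fe \<and> l a \<noteq> l b \<and> (a, b) \<in> (delete_edge Fe a b)\<^sup>*)"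

definition graph_on :: "('v \<times> 'v) set \<Rightarrow> 'v set \<Rightarrow> bool" where
  "graph_on Fe W \<longleftrightarrow> finite W \<and> Fe \<subseteq> W \<times> W \<and> irrefl Fe \<and> sym Fe \<and> l ` W \<subseteq> I"

definition conn_on :: "('v \<times> 'v) set \<Rightarrow> 'v set \<Rightarrow> bool" where
  "conn_on Fe W \<longleftrightarrow> (\<forall>u\<in>W. \<forall>v\<in>W. (u, v) \<in> Fe\<^sup>*)"

lemma rigid:
  assumes du: "dual K W x \<Delta>" and g: "graph_on Fe W" and c: "conn_on Fe W" and n: "nontame Fe"
    and z: "\<And>u v. (u, v) \<in> Fe \<Longrightarrow> H x u v * z u + H x v u * z v = 0"
    and v: "v \<in> W"
  shows "z v = 0"
proof -
  have F: "Fe \<subseteq> W \<times> W" "irrefl Fe" "sym Fe" and lI: "l ` W \<subseteq> I" using g by (auto simp: graph_on_def)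
  obtain a b where ab: "(a, b) \<in> Fe" "l a \<noteq> l b" "(a, b) \<in> (delete_edge Fe a b)\<^sup>*" using n by (auto simp: nontame_def)
  have "z a = 0" by (rule rigid_vertex[OF du F lI ab z])
  moreover have "(a, v) \<in> Fe\<^sup>*" using c ab(1) F v by (auto simp: conn_on_def)
  ultimately show ?thesis using zero_propagates[OF du F(1,2) lI z] by blast
qed

text \<open>If a combination \<open>D\<close> of the \<open>\<Delta> a\<close> kills every
  \<open>y w\<close>, the differentiated edge equations make \<open>D (x v)\<close> an infinitesimal
  motion of \<open>x\<close>. By rigidity it is zero, and the numbers \<open>D (x v)\<close> are the
  coefficients of the combination. So a solution is as generic as \<open>x\<close>.\<close>

lemma dual_solution:
  assumes du: "dual K W x \<Delta>" and g: "graph_on Fe W" and c: "conn_on Fe W" and n: "nontame Fe"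
    and y: "\<And>u v. (u, v) \<in> Fe \<Longrightarrow> Q y u v = Q x u v"
  obtains \<Delta>' where "dual K W y \<Delta>'"
proof (rule dual_transfer[of W W K \<Delta> y])
  show "finite W" "finite W" using g by (auto simp: graph_on_def)
  show "derivation K (\<Delta> a)" if "a \<in> W" for a using dualD(1)[OF du that] .
  fix d assume d: "\<And>w. w \<in> W \<Longrightarrow> (\<Sum>a\<in>W. d a * \<Delta> a (y w)) = 0"
  define D where "D r = (\<Sum>a\<in>W. d a * \<Delta> a r)" for r
  have D: "derivation K D" unfolding D_def by (rule derivation_lin_comb) (rule dualD(1)[OF du])
  have "D (x v) = 0" if "v \<in> W" for v
  proof (rule rigid[OF du g c n _ that, of "\<lambda>v. D (x v)"])
    fix u v assume uv: "(u, v) \<in> Fe"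
    then have "u \<in> W" "v \<in> W" "l u \<in> I" "l v \<in> I" using g by (auto simp: graph_on_def)
    then show "H x u v * D (x u) + H x v u * D (x v) = 0"
      using derivation_Q_eq[OF D _ _ y[OF uv]] d by (simp add: D_def)
  qed
  moreover have "D (x v) = d v" if "v \<in> W" for v
  proof -
    have "D (x v) = (\<Sum>a\<in>W. if v = a then d a else 0)"
      unfolding D_def by (intro sum.cong refl) (simp add: dualD(2)[OF du _ that])
    also have "\<dots> = d v" using that g by (simp add: graph_on_def)
    finally show ?thesis .
  qed
  ultimately show "\<forall>a\<in>W. d a = 0" by simp
qed (use that in auto)

end

section \<open>Graphs with cross edges\<close>

lemma sym_delete_edge: "sym F \<Longrightarrow> sym (delete_edge F a b)"
  by (auto simp: delete_edge_def sym_def)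

lemma sym_induced: "sym F \<Longrightarrow> sym (induced F W)"
  by (auto simp: induced_def sym_def)

lemma rtrancl_swap: "sym F \<Longrightarrow> (a, b) \<in> F\<^sup>* \<Longrightarrow> (b, a) \<in> F\<^sup>*"
  by (meson sym_rtrancl symD)

lemma delete_edge_commute: "delete_edge F a b = delete_edge F b a"
  by (auto simp: delete_edge_def)

lemma path_label_change:
  assumes "(s, t) \<in> R\<^sup>*" "f s \<noteq> f t"
  shows "\<exists>c d. (s, c) \<in> R\<^sup>* \<and> (c, d) \<in> R \<and> f c \<noteq> f d"
  using assms
proof (induction rule: rtrancl_induct)
  case (step y z)
  then show ?case by (cases "f s = f y") auto
qed simp

definition walk :: "('v \<times> 'v) set \<Rightarrow> 'v list \<Rightarrow> bool" where
  "walk R xs \<longleftrightarrow> (\<forall>i. Suc i < length xs \<longrightarrow> (xs ! i, xs ! Suc i) \<in> R)"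

lemma simple_walk:
  assumes "(c, d) \<in> R\<^sup>*"
  shows "\<exists>xs. xs \<noteq> [] \<and> distinct xs \<and> hd xs = c \<and> last xs = d \<and> walk R xs"
  using assms
proof (induction rule: rtrancl_induct)
  case base
  show ?case by (intro exI[of _ "[c]"]) (auto simp: walk_def)
next
  case (step y z)
  then obtain xs where xs: "xs \<noteq> []" "distinct xs" "hd xs = c" "last xs = y" "walk R xs" by blast
  show ?case
  proof (cases "z \<in> set xs")
    case True
    then obtain i where i: "i < length xs" "xs ! i = z" by (metis in_set_conv_nth)
    then have "last (take (Suc i) xs) = z" by (simp add: take_Suc_conv_app_nth)
    then show ?thesis
      using xs i by (intro exI[of _ "take (Suc i) xs"]) (auto simp: walk_def)
  next
    case False
    have "(xs ! i, (xs @ [z]) ! Suc i) \<in> R" if "Suc i < Suc (length xs)" for i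
    proof (cases "Suc i < length xs")
      case True
      then show ?thesis using xs(5) by (simp add: walk_def nth_append)
    next
      case False
      then have "i = length xs - 1" using that by simp
      then have "xs ! i = y" using xs(1,4) by (simp add: last_conv_nth)
      then show ?thesis using that False step(2) by (simp add: nth_append)
    qed
    then have "walk R (xs @ [z])" by (simp add: walk_def nth_append)
    then show ?thesis using xs False by (intro exI[of _ "xs @ [z]"]) auto
  qed
qed

lemma walk_segment:
  assumes "walk R xs" "i \<le> j" "j < length xs"
  shows "(xs ! i, xs ! j) \<in> (induced R {xs ! k |k. i \<le> k \<and> k \<le> j})\<^sup>*"
  using assms(2,3)
proof (induction j rule: dec_induct)
  case base
  show ?case by simp
next
  case (step n)
  let ?W = "\<lambda>n. {xs ! k |k. i \<le> k \<and> k \<le> n}"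
  have "(xs ! i, xs ! n) \<in> (induced R (?W n))\<^sup>*" using step by simp
  moreover have "induced R (?W n) \<subseteq> induced R (?W (Suc n))" by (fastforce simp: induced_def)
  ultimately have "(xs ! i, xs ! n) \<in> (induced R (?W (Suc n)))\<^sup>*" using rtrancl_mono by blast
  moreover have "(xs ! n, xs ! Suc n) \<in> induced R (?W (Suc n))"
    using assms(1) step by (auto simp: induced_def walk_def)
  ultimately show ?case by simp
qed

context line_data
begin

text \<open>That there are two outside neighbours is expressed by saying that no vertex
  \<open>s\<close> is the only one; already an arbitrary \<open>s\<close> yields one
  neighbour.\<close>

definition no_lobe :: "('v \<times> 'v) set \<Rightarrow> 'v set \<Rightarrow> bool" where
  "no_lobe Fe W \<longleftrightarrow> (\<forall>T s. T \<subseteq> W \<and> T \<noteq> {} \<and> (\<forall>t\<in>T. \<forall>t'\<in>T. l t = l t') \<longrightarrow>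
     (\<exists>t\<in>T. \<exists>t'. (t, t') \<in> Fe \<and> t' \<notin> T \<and> t' \<noteq> s))"

definition stably_nontame :: "('v \<times> 'v) set \<Rightarrow> bool" where
  "stably_nontame Fe \<longleftrightarrow> (\<forall>a b. (a, b) \<in> Fe \<and> l a \<noteq> l b \<and> (a, b) \<in> (delete_edge Fe a b)\<^sup>* \<longrightarrow> nontame (delete_edge Fe a b))"

lemma no_lobeD:
  assumes "no_lobe Fe W" "T \<subseteq> W" "T \<noteq> {}" "\<And>t t'. t \<in> T \<Longrightarrow> t' \<in> T \<Longrightarrow> l t = l t'"
  obtains t t' where "t \<in> T" "(t, t') \<in> Fe" "t' \<notin> T" "t' \<noteq> s"
  using assms unfolding no_lobe_def by metis

lemma nontame_mono: "nontame Fe \<Longrightarrow> Fe \<subseteq> Fe' \<Longrightarrow> nontame Fe'"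
  unfolding nontame_def delete_edge_def using rtrancl_mono[of "Fe - _" "Fe' - _"] by (meson Diff_mono order_refl subsetD)

lemma graph_onD:
  assumes "graph_on Fe W"
  shows "finite W" "Fe \<subseteq> W \<times> W" "irrefl Fe" "sym Fe" "l ` W \<subseteq> I"
    "(u, v) \<in> Fe \<Longrightarrow> u \<in> W \<and> v \<in> W \<and> u \<noteq> v \<and> l u \<in> I \<and> l v \<in> I \<and> (v, u) \<in> Fe"
  using assms unfolding graph_on_def by (auto simp: irrefl_def image_subset_iff dest: symD)

lemma graph_on_induced: "graph_on Fe W \<Longrightarrow> U \<subseteq> W \<Longrightarrow> graph_on (induced Fe U) U"
  unfolding graph_on_def induced_def by (auto simp: irrefl_def sym_def image_subset_iff intro: finite_subset)

text \<open>Otherwise connectedness would put \<open>W\<close> on a single line, and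
  \<open>W\<close> itself would be a lobe without outside neighbours.\<close>

lemma cross_edge_exists:
  assumes g: "graph_on Fe W" and c: "conn_on Fe W" and 1: "no_lobe Fe W" and W: "W \<noteq> {}"
  obtains a b where "(a, b) \<in> Fe" "l a \<noteq> l b"
proof -
  have "\<exists>t\<in>W. \<exists>t'\<in>W. l t \<noteq> l t'"
  proof (rule ccontr)
    assume n: "\<not> ?thesis"
    have same: "l t = l t'" if "t \<in> W" "t' \<in> W" for t t' using n that by blast
    obtain t t' where "(t, t') \<in> Fe" "t' \<notin> W" by (rule no_lobeD[OF 1 order_refl W same, of undefined])
    then show False using graph_onD(6)[OF g] by blast
  qed
  then obtain t t' where "t \<in> W" "t' \<in> W" "l t \<noteq> l t'" by blast
  moreover from this have "(t, t') \<in> Fe\<^sup>*" using c by (simp add: conn_on_def)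
  ultimately show thesis using path_label_change[of t t' Fe l] that by blast
qed

text \<open>If every cross edge were a bridge, a side of a bridge with fewest vertices would lie in a single
  line.\<close>

lemma nontame_of_no_lobe:
  assumes g: "graph_on Fe W" and c: "conn_on Fe W" and 1: "no_lobe Fe W" and W: "W \<noteq> {}"
  shows "nontame Fe"
proof (rule ccontr)
  assume n: "\<not> nontame Fe"
  then have bridge: "(a, b) \<notin> (delete_edge Fe a b)\<^sup>*" if "(a, b) \<in> Fe" "l a \<noteq> l b" for a b
    using that by (auto simp: nontame_def)
  define side where "side a b = (delete_edge Fe a b)\<^sup>* `` {b}" for a b
  have sym: "sym Fe" using graph_onD(4)[OF g] .
  obtain a0 b0 where e0: "(a0, b0) \<in> Fe \<and> l a0 \<noteq> l b0" using cross_edge_exists[OF g c 1 W] by metis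
  define p where "p = arg_min (\<lambda>p. card (side (fst p) (snd p))) (\<lambda>p. (fst p, snd p) \<in> Fe \<and> l (fst p) \<noteq> l (snd p))"
  define u v where "u = fst p" and "v = snd p"
  have "(fst p, snd p) \<in> Fe \<and> l (fst p) \<noteq> l (snd p)"
    unfolding p_def by (rule arg_min_natI[of _ "(a0, b0)"]) (use e0 in simp)
  then have uv: "(u, v) \<in> Fe" "l u \<noteq> l v" by (auto simp: u_def v_def)
  have least: "card (side u v) \<le> card (side a b)" if "(a, b) \<in> Fe" "l a \<noteq> l b" for a b
    unfolding u_def v_def p_def
    using arg_min_nat_le[of "\<lambda>p. (fst p, snd p) \<in> Fe \<and> l (fst p) \<noteq> l (snd p)" "(a, b)"
        "\<lambda>p. card (side (fst p) (snd p))"] that by simp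
  define T where "T = side u v"
  have inW: "side a b \<subseteq> W" if "(a, b) \<in> Fe" for a b
  proof
    fix w assume "w \<in> side a b"
    then have "(b, w) \<in> (delete_edge Fe a b)\<^sup>*" by (simp add: side_def)
    then show "w \<in> W"
    proof (cases rule: rtranclE)
      case base
      then show ?thesis using graph_onD(6)[OF g that] by simp
    next
      case (step w')
      then show ?thesis using graph_onD(6)[OF g] by (auto simp: delete_edge_def)
    qed
  qed
  have vT: "v \<in> T" by (simp add: T_def side_def)
  have uT: "u \<notin> T"
    using bridge[OF uv] rtrancl_swap[OF sym_delete_edge[OF sym]] by (auto simp: T_def side_def)
  have closed: "w' \<in> T" if "w \<in> T" "(w, w') \<in> delete_edge Fe u v" for w w'
    using that by (auto simp: T_def side_def)
  have TW: "T \<subseteq> W" using inW[OF uv(1)] by (simp add: T_def)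
  have "\<exists>t\<in>T. \<exists>t'\<in>T. l t \<noteq> l t'"
  proof (rule ccontr)
    assume nn: "\<not> ?thesis"
    have ne: "T \<noteq> {}" using vT by blast
    have same: "l t = l t'" if "t \<in> T" "t' \<in> T" for t t' using nn that by blast
    obtain t t' where t: "t \<in> T" "(t, t') \<in> Fe" "t' \<notin> T" "t' \<noteq> u"
      by (rule no_lobeD[OF 1 TW ne same, of u])
    then have "(t, t') \<in> delete_edge Fe u v" using uT by (auto simp: delete_edge_def)
    then show False using closed t by blast
  qed
  then obtain t t' where t: "t \<in> T" "t' \<in> T" "l t \<noteq> l t'" by blast
  then have "(t, v) \<in> (delete_edge Fe u v)\<^sup>*" "(v, t') \<in> (delete_edge Fe u v)\<^sup>*"
    using rtrancl_swap[OF sym_delete_edge[OF sym]] by (auto simp: T_def side_def)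
  then have "(t, t') \<in> (delete_edge Fe u v)\<^sup>*" by (rule rtrancl_trans)
  from path_label_change[OF this t(3)]
  obtain c d where cd: "(t, c) \<in> (delete_edge Fe u v)\<^sup>*" "(c, d) \<in> delete_edge Fe u v" "l c \<noteq> l d" by blast
  have cT: "c \<in> T" using t(1) cd(1) by (auto simp: T_def side_def)
  have dT: "d \<in> T" using closed cT cd(2) by blast
  have cdF: "(c, d) \<in> Fe" "(d, c) \<in> Fe" using cd(2) sym by (auto simp: delete_edge_def dest: symD)
  \<comment> \<open>A side of a cross edge that starts in \<open>T\<close> and misses
    \<open>v\<close> cannot leave \<open>T\<close>, so it is smaller than \<open>T\<close>. Hence
    \<open>v\<close> lies on both sides of the cross edge \<open>cd\<close> inside \<open>T\<close>,
    which connects \<open>c\<close> to \<open>d\<close> without that edge.\<close>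
  have smaller: False if e: "(e, f) \<in> Fe" "l e \<noteq> l f" "f \<in> T" "v \<notin> side e f" for e f
  proof -
    have "side e f \<subseteq> T"
    proof
      fix w assume "w \<in> side e f"
      then have "(f, w) \<in> (delete_edge Fe e f)\<^sup>*" by (simp add: side_def)
      then show "w \<in> T"
      proof (induction rule: rtrancl_induct)
        case base
        show ?case by (rule e(3))
      next
        case (step w w')
        have "w \<in> side e f" "w' \<in> side e f" using step(1,2) by (auto simp: side_def)
        then have "w \<noteq> v" "w' \<noteq> v" using e(4) by auto
        then have "(w, w') \<in> delete_edge Fe u v" using step(2) by (auto simp: delete_edge_def)
        then show ?case using closed step.IH by blast
      qed
    qed
    then have "side e f \<subset> T" using vT e(4) by blast
    then have "card (side e f) < card T"
      using TW graph_onD(1)[OF g] by (meson finite_subset psubset_card_mono)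
    then show False using least[OF e(1,2)] by (simp add: T_def)
  qed
  have "v \<in> side c d" using smaller[OF cdF(1) cd(3) dT] by blast
  moreover have "v \<in> side d c" using smaller[OF cdF(2) _ cT] cd(3) by metis
  ultimately have "(c, d) \<in> (delete_edge Fe c d)\<^sup>*"
    using rtrancl_swap[OF sym_delete_edge[OF sym, of c d], of d v] delete_edge_commute[of Fe c d]
    by (auto simp: side_def intro: rtrancl_trans)
  then show False using bridge[OF cdF(1) cd(3)] by blast
qed

text \<open>Deleting a cross edge \<open>ab\<close> on a cycle leaves a cross edge \<open>cd\<close>
  and a simple path \<open>xs\<close> from \<open>c\<close> to \<open>d\<close> avoiding both edges.
  The cycle made of \<open>xs\<close> and \<open>cd\<close> is a suitable set unless it passes
  through all of \<open>W\<close>; then \<open>ab\<close> is a chord and forms a shorter cycle with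
  a segment of \<open>xs\<close>.\<close>

lemma proper_nontame_subset:
  assumes g: "graph_on Fe W" and n: "nontame Fe" and 3: "stably_nontame Fe"
  shows "\<exists>U. U \<subset> W \<and> conn_on (induced Fe U) U \<and> nontame (induced Fe U)"
proof -
  obtain a b where ab: "(a, b) \<in> Fe" "l a \<noteq> l b" "(a, b) \<in> (delete_edge Fe a b)\<^sup>*" using n by (auto simp: nontame_def)
  then have "nontame (delete_edge Fe a b)" using 3 by (auto simp: stably_nontame_def)
  then obtain c d where cd: "(c, d) \<in> delete_edge Fe a b" "l c \<noteq> l d" "(c, d) \<in> (delete_edge (delete_edge Fe a b) c d)\<^sup>*"
    by (auto simp: nontame_def)
  define R where "R = delete_edge (delete_edge Fe a b) c d"
  have RF: "R \<subseteq> Fe" by (auto simp: R_def delete_edge_def)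
  have sym: "sym Fe" using graph_onD(4)[OF g] .
  obtain xs where xs: "xs \<noteq> []" "distinct xs" "hd xs = c" "last xs = d" "walk R xs"
    using simple_walk[OF cd(3)] by (auto simp: R_def)
  define S where "S i j = {xs ! k |k. i \<le> k \<and> k \<le> j}" for i j
  have S_W: "S i j \<subseteq> W" if "i < j" "j < length xs" for i j
  proof -
    have "xs ! k \<in> W" if "k < length xs" for k
    proof (cases "Suc k < length xs")
      case True
      then have "(xs ! k, xs ! Suc k) \<in> Fe" using xs(5) RF by (auto simp: walk_def)
      then show ?thesis using graph_onD(6)[OF g] by blast
    next
      case False
      then have "k = length xs - 1" using that by simp
      then have "xs ! k = d" using xs by (simp add: last_conv_nth)
      then show ?thesis using cd(1) graph_onD(6)[OF g, of c d] by (auto simp: delete_edge_def)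
    qed
    then show ?thesis using that by (auto simp: S_def)
  qed
  have seg: "conn_on (induced Fe (S i j)) (S i j) \<and> nontame (induced Fe (S i j))"
    if ij: "i < j" "j < length xs" and e: "(xs ! i, xs ! j) \<in> Fe" "l (xs ! i) \<noteq> l (xs ! j)"
      "(xs ! i, xs ! j) \<notin> R" "(xs ! j, xs ! i) \<notin> R" for i j
  proof
    have RR: "(xs ! m, xs ! k) \<in> (induced R (S i j))\<^sup>*" if mk: "i \<le> m" "m \<le> k" "k \<le> j" for m k
    proof -
      have "(xs ! m, xs ! k) \<in> (induced R {xs ! n |n. m \<le> n \<and> n \<le> k})\<^sup>*"
        by (rule walk_segment[OF xs(5)]) (use mk ij in auto)
      moreover have "induced R {xs ! n |n. m \<le> n \<and> n \<le> k} \<subseteq> induced R (S i j)"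
        using mk by (fastforce simp: induced_def S_def)
      ultimately show ?thesis using rtrancl_mono by blast
    qed
    have sub: "(induced R (S i j))\<^sup>* \<subseteq> (induced Fe (S i j))\<^sup>*"
      by (rule rtrancl_mono) (use RF in \<open>auto simp: induced_def\<close>)
    show "conn_on (induced Fe (S i j)) (S i j)"
      unfolding conn_on_def
    proof (intro ballI)
      fix u v assume "u \<in> S i j" "v \<in> S i j"
      then obtain m k where mk: "u = xs ! m" "v = xs ! k" "i \<le> m" "m \<le> j" "i \<le> k" "k \<le> j"
        by (auto simp: S_def)
      show "(u, v) \<in> (induced Fe (S i j))\<^sup>*"
      proof (cases "m \<le> k")
        case True
        then show ?thesis using RR[of m k] mk sub by blast
      next
        case False
        then have "(v, u) \<in> (induced Fe (S i j))\<^sup>*" using RR[of k m] mk sub by auto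
        then show ?thesis by (rule rtrancl_swap[OF sym_induced[OF sym]])
      qed
    qed
    have "induced R (S i j) \<subseteq> delete_edge (induced Fe (S i j)) (xs ! i) (xs ! j)"
      using RF e(3,4) by (auto simp: induced_def delete_edge_def)
    then have "(xs ! i, xs ! j) \<in> (delete_edge (induced Fe (S i j)) (xs ! i) (xs ! j))\<^sup>*"
      using RR[of i j] ij rtrancl_mono by (meson less_imp_le order_refl subsetD)
    moreover have "xs ! i \<in> S i j" "xs ! j \<in> S i j" using ij by (auto simp: S_def)
    then have "(xs ! i, xs ! j) \<in> induced Fe (S i j)" using e by (simp add: induced_def)
    ultimately show "nontame (induced Fe (S i j))" using e(2) unfolding nontame_def by blast
  qed
  define n where "n = length xs - 1"
  have cn: "xs ! 0 = c" "xs ! n = d" using xs by (auto simp: n_def hd_conv_nth last_conv_nth)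
  have "c \<noteq> d" using cd(2) by auto
  then have "n \<noteq> 0" using cn by metis
  then have n0: "0 < n" "n < length xs" by (auto simp: n_def)
  have full: "conn_on (induced Fe (S 0 n)) (S 0 n) \<and> nontame (induced Fe (S 0 n))"
    by (rule seg[OF n0]) (use cd in \<open>auto simp: cn R_def delete_edge_def\<close>)
  show ?thesis
  proof (cases "S 0 n = W")
    case False
    then show ?thesis using S_W[OF n0] full by blast
  next
    case True
    \<comment> \<open>The segment between the ends of the chord is proper: otherwise its ends would
      be \<open>c\<close> and \<open>d\<close>, but \<open>cd\<close> is an edge other than
      \<open>ab\<close>.\<close>
    have find: ?thesis if ij: "i < j" "j < length xs" "xs ! i = e" "xs ! j = f"
      and ef: "(e, f) = (a, b) \<or> (e, f) = (b, a)" for i j e f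
    proof -
      have "conn_on (induced Fe (S i j)) (S i j) \<and> nontame (induced Fe (S i j))"
        by (rule seg[OF ij(1,2)]) (use ef ij ab graph_onD(6)[OF g ab(1)] in \<open>auto simp: R_def delete_edge_def\<close>)
      moreover have "S i j \<noteq> W"
      proof
        assume SW: "S i j = W"
        have "xs ! 0 \<in> S i j" "xs ! n \<in> S i j" using SW True n0 by (auto simp: S_def)
        then obtain k k' where k: "xs ! 0 = xs ! k" "i \<le> k" "k \<le> j" "xs ! n = xs ! k'" "i \<le> k'" "k' \<le> j"
          by (auto simp: S_def)
        have "0 < length xs" "k < length xs" "k' < length xs" using k ij n0 by auto
        then have "k = 0" "k' = n"
          using k(1,4) xs(2) n0(2) nth_eq_iff_index_eq[of xs 0 k] nth_eq_iff_index_eq[of xs n k'] by auto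
        then have "i = 0" "j = n" using k ij by (auto simp: n_def)
        then have "(e, f) = (c, d)" using ij cn by simp
        then show False using cd(1) ef by (auto simp: delete_edge_def)
      qed
      ultimately show ?thesis using S_W[OF ij(1,2)] by blast
    qed
    have "a \<in> S 0 n" "b \<in> S 0 n" using True graph_onD(6)[OF g ab(1)] by auto
    then obtain i j where ij: "a = xs ! i" "b = xs ! j" "i \<le> n" "j \<le> n" by (auto simp: S_def)
    then have "i \<noteq> j" using ab(2) by auto
    then consider "i < j" | "j < i" by linarith
    then show ?thesis
    proof cases
      case 1
      then show ?thesis using find[of i j a b] ij n0 by simp
    next
      case 2
      then show ?thesis using find[of j i b a] ij n0 by simp
    qed
  qed
qed

text \<open>Adding a neighbouring vertex to a largest proper subset that is connected and nontame
  keeps both properties, so the result must be all of \<open>W\<close>.\<close>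

lemma removable_vertex:
  assumes g: "graph_on Fe W" and c: "conn_on Fe W" and n: "nontame Fe" and 3: "stably_nontame Fe"
  obtains z where "z \<in> W" "conn_on (induced Fe (W - {z})) (W - {z})" "nontame (induced Fe (W - {z}))"
proof -
  let ?P = "\<lambda>U. U \<subset> W \<and> conn_on (induced Fe U) U \<and> nontame (induced Fe U)"
  obtain U0 where U0: "?P U0" using proper_nontame_subset[OF g n 3] by blast
  have bd: "\<forall>U. ?P U \<longrightarrow> card U < Suc (card W)"
    using graph_onD(1)[OF g] by (auto intro!: le_imp_less_Suc card_mono)
  obtain U where U: "?P U" and mx: "\<And>U'. ?P U' \<Longrightarrow> card U' \<le> card U"
    using ex_has_greatest_nat[of ?P U0 card "Suc (card W)"] U0 bd by blast
  have fin: "finite U" using U graph_onD(1)[OF g] by (meson finite_subset psubset_imp_subset)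
  obtain a b where "(a, b) \<in> induced Fe U" using U by (auto simp: nontame_def)
  then have aU: "a \<in> U" by (auto simp: induced_def)
  obtain w where w: "w \<in> W" "w \<notin> U" using U by blast
  have "(a, w) \<in> Fe\<^sup>*" using c aU w U by (auto simp: conn_on_def)
  from path_label_change[OF this, of "\<lambda>v. v \<in> U"] aU w(2)
  obtain u z where uz0: "(u, z) \<in> Fe" "(u \<in> U) \<noteq> (z \<in> U)" by auto
  obtain u z where uz: "(u, z) \<in> Fe" "u \<in> U" "z \<notin> U"
    using uz0 graph_onD(6)[OF g uz0(1)] by metis
  have zW: "z \<in> W" using graph_onD(6)[OF g uz(1)] by blast
  define U' where "U' = insert z U"
  have sub: "induced Fe U \<subseteq> induced Fe U'" by (auto simp: induced_def U'_def)
  have symU: "sym (induced Fe U')" by (rule sym_induced[OF graph_onD(4)[OF g]])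
  have uz': "(u, z) \<in> induced Fe U'" using uz by (auto simp: induced_def U'_def)
  have to_u: "(v, u) \<in> (induced Fe U')\<^sup>*" if "v \<in> U'" for v
  proof (cases "v = z")
    case True
    then show ?thesis using uz' symU by (auto dest: symD)
  next
    case False
    then have "(v, u) \<in> (induced Fe U)\<^sup>*" using that U uz by (auto simp: conn_on_def U'_def)
    then show ?thesis using rtrancl_mono[OF sub] by blast
  qed
  have "conn_on (induced Fe U') U'"
    unfolding conn_on_def using to_u rtrancl_swap[OF symU] by (meson rtrancl_trans)
  moreover have "nontame (induced Fe U')" using U nontame_mono[OF _ sub] by blast
  ultimately have "\<not> U' \<subset> W" using mx[of U'] fin uz by (auto simp: U'_def)
  then have "U' = W" using U zW by (auto simp: U'_def)
  then have "U = W - {z}" using uz by (auto simp: U'_def)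
  then show thesis using that[of z] U zW by blast
qed

end

section \<open>Solutions for a generic configuration\<close>

context line_data
begin

lemma same_line_Q:
  assumes "l u = l v" "l u \<in> I"
  shows "Q y u v = A (l u) * (y u - y v)\<^sup>2" "H y u v = 2 * A (l u) * (y u - y v)"
  using B_same[OF assms(2)] c_same[OF assms(2)] F_same[OF assms(2)]
  by (simp_all add: Q_def q_def H_def h_def assms(1)[symmetric] power2_eq_square algebra_simps)

text \<open>The two equations are linear in the parameters measured from the closest points, and by
  \<open>CS\<close> their determinant \<open>a * b - \<beta> * \<beta>\<close> is nonzero.\<close>

lemma cross_solve:
  assumes I: "l u \<in> I" "l v \<in> I" and ne: "l u \<noteq> l v"
    and e: "H y u v = \<epsilon> * H x u v" "H y v u = \<epsilon> * H x v u"
  shows "y u - c (l u) (l v) = \<epsilon> * (x u - c (l u) (l v))"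
proof -
  define a b \<beta> where "a = A (l u)" and "b = A (l v)" and "\<beta> = B (l u) (l v)"
  define s where "s = (y u - c (l u) (l v)) - \<epsilon> * (x u - c (l u) (l v))"
  define t where "t = (y v - c (l v) (l u)) - \<epsilon> * (x v - c (l v) (l u))"
  have 1: "a * s = \<beta> * t"
    using e(1) by (simp add: H_def h_def a_def \<beta>_def s_def t_def algebra_simps)
  have 2: "b * t = \<beta> * s"
    using e(2) by (simp add: H_def h_def b_def \<beta>_def s_def t_def B_sym[OF I(2,1)] algebra_simps)
  have "(a * b - \<beta> * \<beta>) * s = b * (a * s) - \<beta> * (\<beta> * s)" by (simp add: algebra_simps)
  also have "\<dots> = b * (\<beta> * t) - \<beta> * (b * t)" by (simp only: 1 2)
  also have "\<dots> = 0" by simp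
  finally have "s = 0" using CS[OF I ne] by (simp add: a_def b_def \<beta>_def)
  then show ?thesis by (simp add: s_def)
qed

text \<open>Let \<alpha> and \<beta> be the derivatives of \<open>y t\<close> and
  \<open>y t'\<close> in their own variables. Commutation makes \<beta> constant in
  \<open>x t\<close>; differentiating \<open>H y t' t * \<beta> = H x t' t\<close> and
  \<open>H y t t' * \<alpha> = H x t t'\<close> in \<open>x t\<close> then yields
  \<open>\<alpha> * \<beta> = 1\<close> and \<open>\<alpha> * \<alpha> = 1\<close>.\<close>

lemma mixed_edge:
  assumes g: "graph_on Fe W" and du: "dual K W x \<Delta>" and tt: "t \<in> W" "t' \<in> W" "t \<noteq> t'"
    and Qe: "Q y t t' = Q x t t'"
    and off: "\<Delta> t (y t') = 0" "\<Delta> t' (y t) = 0"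
    and comm: "\<Delta> t (\<Delta> t' (y t')) = \<Delta> t' (\<Delta> t (y t'))" "\<Delta> t (\<Delta> t' (y t)) = \<Delta> t' (\<Delta> t (y t))"
  obtains \<epsilon> where "\<epsilon> = 1 \<or> \<epsilon> = -1" "\<Delta> t (y t) = \<epsilon>" "\<Delta> t' (y t') = \<epsilon>"
    "H y t t' = \<epsilon> * H x t t'" "H y t' t = \<epsilon> * H x t' t"
proof -
  define D E where "D = \<Delta> t" and "E = \<Delta> t'"
  have D: "derivation K D" and E: "derivation K E" using dualD(1)[OF du] tt by (auto simp: D_def E_def)
  have I: "l t \<in> I" "l t' \<in> I" using graph_onD(5)[OF g] tt by auto
  have x: "D (x t) = 1" "D (x t') = 0" "E (x t) = 0" "E (x t') = 1"
    using dualD(2)[OF du] tt by (auto simp: D_def E_def)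
  define \<alpha> \<beta> where "\<alpha> = D (y t)" and "\<beta> = E (y t')"
  have o: "D (y t') = 0" "E (y t) = 0" using off by (auto simp: D_def E_def)
  have D\<beta>: "D \<beta> = 0" and E\<alpha>: "E \<alpha> = 0"
    using comm off derivationD(4)[OF D] derivationD(4)[OF E] by (auto simp: \<alpha>_def \<beta>_def D_def E_def)
  have 1: "H y t t' * \<alpha> = H x t t'" using derivation_Q_eq[OF D I Qe] by (simp add: x o \<alpha>_def)
  have 2: "H y t' t * \<beta> = H x t' t" using derivation_Q_eq[OF E I Qe] by (simp add: x o \<beta>_def)
  have "D (H y t' t * \<beta>) = D (H x t' t)" using 2 by simp
  moreover have "D (H y t' t) = - 2 * B (l t') (l t) * \<alpha>" by (simp add: derivation_H[OF D I(2,1)] x o \<alpha>_def)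
  ultimately have "B (l t') (l t) * (\<alpha> * \<beta>) = B (l t') (l t)"
    by (simp add: derivationD(2)[OF D] derivation_H[OF D I(2,1), of x] x D\<beta>)
  then have ab: "\<alpha> * \<beta> = 1" using B_nz[OF I(2,1)] by simp
  have "D (\<alpha> * \<beta>) = 0" using ab derivationD(5)[OF D] by simp
  then have "D \<alpha> * \<beta> = 0" by (simp add: derivationD(2)[OF D] D\<beta>)
  then have D\<alpha>: "D \<alpha> = 0" using ab by auto
  have "D (H y t t' * \<alpha>) = D (H x t t')" using 1 by simp
  moreover have "D (H y t t') = 2 * A (l t) * \<alpha>" by (simp add: derivation_H[OF D I] x o \<alpha>_def)
  ultimately have "A (l t) * (\<alpha> * \<alpha>) = A (l t)"
    by (simp add: derivationD(2)[OF D] derivation_H[OF D I, of x] x D\<alpha>)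
  then have aa: "\<alpha> * \<alpha> = 1" using A_pos[OF I(1)] by simp
  have "\<alpha> * (\<alpha> * \<beta>) = \<alpha>" using ab by simp
  then have ba: "\<beta> = \<alpha>" using aa by (simp add: mult.assoc[symmetric])
  have "H y t t' * (\<alpha> * \<alpha>) = \<alpha> * H x t t'" unfolding 1[symmetric] by (simp only: mult_ac)
  then have 3: "H y t t' = \<alpha> * H x t t'" unfolding aa by simp
  have "H y t' t * (\<alpha> * \<alpha>) = \<alpha> * H x t' t" unfolding 2[symmetric] ba by (simp only: mult_ac)
  then have 4: "H y t' t = \<alpha> * H x t' t" unfolding aa by simp
  have "\<alpha> = 1 \<or> \<alpha> = -1" using aa by (simp add: square_eq_1_iff)
  then show thesis
    by (rule that[of \<alpha>, OF _ _ _ 3 4]) (use ba in \<open>simp_all add: \<alpha>_def \<beta>_def D_def E_def\<close>)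
qed

text \<open>A vertex at which every edge is fixed by the complementary graph: its coordinate can only be
  translated or reflected.\<close>

lemma free_vertex:
  assumes g: "graph_on Fe W" and du: "dual K W x \<Delta>"
    and e: "(z, u) \<in> Fe" "(z, u') \<in> Fe" "u \<noteq> u'"
    and Qe: "\<And>a b. (a, b) \<in> Fe \<Longrightarrow> Q y a b = Q x a b"
    and fr: "\<And>v. v \<in> W \<Longrightarrow> v \<noteq> z \<Longrightarrow> \<Delta> z (y v) = 0"
  obtains \<epsilon> where "\<epsilon> = 1 \<or> \<epsilon> = -1" "\<And>v. (z, v) \<in> Fe \<Longrightarrow> H y z v = \<epsilon> * H x z v"
proof -
  have zW: "z \<in> W" and uW: "u \<in> W" "u' \<in> W" "z \<noteq> u" "z \<noteq> u'" and I: "l z \<in> I" "l u \<in> I" "l u' \<in> I"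
    using graph_onD(6)[OF g e(1)] graph_onD(6)[OF g e(2)] by auto
  define D \<alpha> where "D = \<Delta> z" and "\<alpha> = D (y z)"
  have D: "derivation K D" using dualD(1)[OF du zW] by (simp add: D_def)
  have x: "D (x z) = 1" "v \<in> W \<Longrightarrow> v \<noteq> z \<Longrightarrow> D (x v) = 0" for v
    using dualD(2)[OF du zW] zW by (auto simp: D_def)
  have y0: "v \<in> W \<Longrightarrow> v \<noteq> z \<Longrightarrow> D (y v) = 0" for v using fr by (simp add: D_def)
  have 1: "H y z v * \<alpha> = H x z v" if "(z, v) \<in> Fe" for v
  proof -
    have v: "v \<in> W" "v \<noteq> z" "l v \<in> I" using graph_onD(6)[OF g that] by auto
    show ?thesis using derivation_Q_eq[OF D I(1) v(3) Qe[OF that]] by (simp add: x v y0 \<alpha>_def)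
  qed
  have "H x z u \<noteq> H x z u'"
  proof
    assume "H x z u = H x z u'"
    then have "\<Delta> u (H x z u) = \<Delta> u (H x z u')" by simp
    then show False
      using derivation_H[OF dualD(1)[OF du uW(1)] I(1,2)] derivation_H[OF dualD(1)[OF du uW(1)] I(1,3)]
        dualD(2)[OF du uW(1)] uW zW e(3) B_nz[OF I(1,2)] by simp
  qed
  then have nz: "H y z u - H y z u' \<noteq> 0" using 1[OF e(1)] 1[OF e(2)] by auto
  have Hd: "D (H y z v) = 2 * A (l z) * \<alpha>" "D (H x z v) = 2 * A (l z)" if "v \<in> {u, u'}" for v
    using that uW I by (auto simp: derivation_H[OF D] x y0 \<alpha>_def)
  have "(H y z u - H y z u') * \<alpha> = H x z u - H x z u'"
    using 1[OF e(1)] 1[OF e(2)] by (simp add: left_diff_distrib)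
  \<comment> \<open>Both values of \<open>H y z\<close> have the same derivative in
    \<open>x z\<close>, so in their difference only the derivative of \<alpha> survives; this is the
    purpose of a second neighbour.\<close>
  then have "D ((H y z u - H y z u') * \<alpha>) = D (H x z u - H x z u')" by simp
  then have "(H y z u - H y z u') * D \<alpha> = 0" by (simp add: derivationD(2,7)[OF D] Hd)
  then have D\<alpha>: "D \<alpha> = 0" using nz by simp
  have "D (H y z u * \<alpha>) = D (H x z u)" using 1[OF e(1)] by simp
  then have "A (l z) * (\<alpha> * \<alpha>) = A (l z)" by (simp add: derivationD(2)[OF D] Hd D\<alpha>)
  then have aa: "\<alpha> * \<alpha> = 1" using A_pos[OF I(1)] by simp
  then have "\<alpha> = 1 \<or> \<alpha> = -1" by (simp add: square_eq_1_iff)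
  moreover have "H y z v = \<alpha> * H x z v" if "(z, v) \<in> Fe" for v
  proof -
    have "H y z v * (\<alpha> * \<alpha>) = \<alpha> * H x z v" unfolding 1[OF that, symmetric] by (simp only: mult_ac)
    then show ?thesis unfolding aa by simp
  qed
  ultimately show thesis using that by blast
qed

text \<open>Completing the square in \<open>Q\<close> leaves \<open>(H w z u)\<^sup>2\<close>, a
  positive multiple of \<open>(w u - c (l u) (l z))\<^sup>2\<close> and a constant. As
  \<open>Q\<close> and the first square agree for \<open>x\<close> and \<open>y\<close>, so does the
  second.\<close>

lemma cross_pinned:
  assumes I: "l z \<in> I" "l u \<in> I" and ne: "l z \<noteq> l u" and Qe: "Q y z u = Q x z u"
    and H: "H y z u = \<epsilon> * H x z u" and eps: "\<epsilon> = 1 \<or> \<epsilon> = -1"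
  shows "y u = x u \<or> y u = 2 * c (l u) (l z) - x u"
proof -
  define a b \<beta> where "a = A (l z)" and "b = A (l u)" and "\<beta> = B (l z) (l u)"
  have id: "4 * a * Q w z u = (H w z u)\<^sup>2 + 4 * (a * b - \<beta> * \<beta>) * (w u - c (l u) (l z))\<^sup>2 + 4 * a * F (l z) (l u)" for w
    by (simp add: Q_def q_def H_def h_def a_def b_def \<beta>_def power2_eq_square algebra_simps)
  have sq: "(H y z u)\<^sup>2 = (H x z u)\<^sup>2" using eps by (auto simp: H power2_eq_square)
  have "(a * b - \<beta> * \<beta>) * (y u - c (l u) (l z))\<^sup>2 = (a * b - \<beta> * \<beta>) * (x u - c (l u) (l z))\<^sup>2"
    using id[of y, unfolded Qe sq] id[of x] by linarith
  then have "(y u - c (l u) (l z))\<^sup>2 = (x u - c (l u) (l z))\<^sup>2"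
    using CS[OF I ne] by (simp add: a_def b_def \<beta>_def)
  then show ?thesis by (auto simp: power2_eq_iff)
qed

text \<open>If one coordinate of \<open>y\<close> depends only on the corresponding coordinate of \<open>x\<close>, then so do all
  others: a minimal component of some \<open>W - {w}\<close> that moves with \<open>x w\<close> would satisfy the conclusion of
  \<open>mixed_edge\<close> on each of its edges, one of which joins two lines.\<close>

lemma diagonal:
  assumes g: "graph_on Fe W" and cn: "conn_on Fe W" and 1: "no_lobe Fe W"
    and du: "dual K W x \<Delta>" and du': "dual K W y \<Delta>'" and nt: "nontame Fe"
    and Qe: "\<And>a b. (a, b) \<in> Fe \<Longrightarrow> Q y a b = Q x a b"
    and v0: "v0 \<in> W" "\<And>w. w \<in> W \<Longrightarrow> w \<noteq> v0 \<Longrightarrow> \<Delta> w (y v0) = 0"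
    and comm: "\<And>a b v. a \<in> W \<Longrightarrow> b \<in> W \<Longrightarrow> v \<in> W \<Longrightarrow> \<Delta> a (\<Delta> b (y v)) = \<Delta> b (\<Delta> a (y v))"
    and wt: "w \<in> W" "t \<in> W" "w \<noteq> t"
  shows "\<Delta> w (y t) = 0"
proof (rule ccontr)
  assume "\<Delta> w (y t) \<noteq> 0"
  define comp where "comp w t = (induced Fe (W - {w}))\<^sup>* `` {t}" for w t
  define bad where "bad p \<longleftrightarrow> fst p \<in> W \<and> snd p \<in> W \<and> fst p \<noteq> snd p \<and> \<Delta> (fst p) (y (snd p)) \<noteq> 0" for p
  have "bad (w, t)" using wt \<open>\<Delta> w (y t) \<noteq> 0\<close> by (simp add: bad_def)
  define p where "p = arg_min (\<lambda>p. card (comp (fst p) (snd p))) bad"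
  have "bad p" unfolding p_def using \<open>bad (w, t)\<close> by (rule arg_min_natI)
  define a s where "a = fst p" and "s = snd p"
  have as: "a \<in> W" "s \<in> W" "a \<noteq> s" "\<Delta> a (y s) \<noteq> 0" using \<open>bad p\<close> by (auto simp: bad_def a_def s_def)
  have least: "card (comp a s) \<le> card (comp u v)" if "bad (u, v)" for u v
    unfolding a_def s_def p_def
    using arg_min_nat_le[of bad "(u, v)" "\<lambda>p. card (comp (fst p) (snd p))"] that by simp
  define T where "T = comp a s"
  have sym: "sym (induced Fe U)" for U by (rule sym_induced[OF graph_onD(4)[OF g]])
  have comp_sub: "comp u v \<subseteq> W - {u}" if "v \<in> W - {u}" for u v
  proof
    fix r assume "r \<in> comp u v"
    then have "(v, r) \<in> (induced Fe (W - {u}))\<^sup>*" by (simp add: comp_def)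
    then show "r \<in> W - {u}" using that by (cases rule: rtranclE) (auto simp: induced_def)
  qed
  \<comment> \<open>On edges avoiding \<open>u\<close> the derivative of the lengths of
    \<open>x\<close> is zero, so \<open>\<Delta> u (y v)\<close> is an infinitesimal motion of
    \<open>y\<close> on \<open>W - {u}\<close>, and its zeros spread over components.\<close>
  have prp: "\<Delta> u (y r) = 0" if u: "u \<in> W" and r: "\<Delta> u (y v) = 0" "(v, r) \<in> (induced Fe (W - {u}))\<^sup>*" for u v r
  proof (rule zero_propagates[OF du' _ _ graph_onD(5)[OF g], of "induced Fe (W - {u})" "\<lambda>v. \<Delta> u (y v)" v r])
    show "induced Fe (W - {u}) \<subseteq> W \<times> W" "irrefl (induced Fe (W - {u}))"
      using graph_onD(3)[OF g] by (auto simp: induced_def irrefl_def)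
    fix a b assume ab: "(a, b) \<in> induced Fe (W - {u})"
    then have "(a, b) \<in> Fe" "a \<in> W" "a \<noteq> u" "b \<in> W" "b \<noteq> u" by (auto simp: induced_def)
    then show "H y a b * \<Delta> u (y a) + H y b a * \<Delta> u (y b) = 0"
      using derivation_Q_eq[OF dualD(1)[OF du u] _ _ Qe, of a b] graph_onD(6)[OF g, of a b] dualD(2)[OF du u] by simp
  qed (use r in auto)
  have TW: "T \<subseteq> W - {a}" unfolding T_def using as by (intro comp_sub) auto
  have sT: "s \<in> T" by (simp add: T_def comp_def)
  have closed: "r' \<in> T" if "r \<in> T" "(r, r') \<in> Fe" "r' \<noteq> a" for r r'
  proof -
    have "(r, r') \<in> induced Fe (W - {a})" using that TW graph_onD(6)[OF g that(2)] by (auto simp: induced_def)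
    then show ?thesis using that by (auto simp: T_def comp_def)
  qed
  have Tnz: "\<Delta> a (y r) \<noteq> 0" if "r \<in> T" for r
  proof
    assume "\<Delta> a (y r) = 0"
    moreover have "(r, s) \<in> (induced Fe (W - {a}))\<^sup>*"
      using that rtrancl_swap[OF sym] by (auto simp: T_def comp_def)
    ultimately show False using prp[OF as(1)] as(4) by blast
  qed
  have v0T: "v0 \<notin> T" using Tnz[of v0] v0(2)[OF as(1)] TW by auto
  \<comment> \<open>\<open>T\<close> is a component of \<open>W - {a}\<close>, so everything outside
    it remains connected to \<open>a\<close> when \<open>T\<close> is removed.\<close>
  have rest: "r \<in> T \<or> (a, r) \<in> (induced Fe (W - T))\<^sup>*" if "r \<in> W" for r
  proof -
    have "(a, r) \<in> Fe\<^sup>*" using cn as that by (auto simp: conn_on_def)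
    then show ?thesis
    proof (induction rule: rtrancl_induct)
      case base
      show ?case by simp
    next
      case (step r r')
      show ?case
      proof (cases "r' \<in> T \<or> r' = a")
        case True
        then show ?thesis by auto
      next
        case False
        then have "r \<notin> T" using closed step(2) by blast
        then have "(r, r') \<in> induced Fe (W - T)" "(a, r) \<in> (induced Fe (W - T))\<^sup>*"
          using step False graph_onD(6)[OF g step(2)] by (auto simp: induced_def)
        then show ?thesis by (meson rtrancl.rtrancl_into_rtrancl)
      qed
    qed
  qed
  \<comment> \<open>A nonzero value gives a bad pair. Its component cannot reach outside
    \<open>T\<close>: that part is connected, avoids \<open>u\<close> and contains
    \<open>v0\<close>, where \<open>\<Delta> u (y v0) = 0\<close>. So it lies in
    \<open>T - {u}\<close>, against minimality.\<close>
  have off: "\<Delta> u (y r) = 0" if u: "u \<in> T" and r: "r \<in> W" "r \<noteq> u" for u r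
  proof (rule ccontr)
    assume nz: "\<Delta> u (y r) \<noteq> 0"
    have uW: "u \<in> W" using u TW by auto
    have "bad (u, r)" using u r nz TW by (auto simp: bad_def)
    have "comp u r \<subseteq> T - {u}"
    proof
      fix m assume m: "m \<in> comp u r"
      have mW: "m \<in> W - {u}" using comp_sub[of r u] r m by auto
      have "m \<in> T"
      proof (rule ccontr)
        assume "m \<notin> T"
        have sub: "(induced Fe (W - T))\<^sup>* \<subseteq> (induced Fe (W - {u}))\<^sup>*"
          by (rule rtrancl_mono) (use u in \<open>auto simp: induced_def\<close>)
        have "(a, m) \<in> (induced Fe (W - T))\<^sup>*" using rest[of m] mW \<open>m \<notin> T\<close> by blast
        moreover have "(a, v0) \<in> (induced Fe (W - T))\<^sup>*" using rest[of v0] v0 v0T by blast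
        ultimately have "(v0, m) \<in> (induced Fe (W - {u}))\<^sup>*"
          using rtrancl_swap[OF sym, of a v0] sub by (meson rtrancl_trans subsetD)
        moreover have "(m, r) \<in> (induced Fe (W - {u}))\<^sup>*"
          using m rtrancl_swap[OF sym] by (auto simp: comp_def)
        ultimately have "(v0, r) \<in> (induced Fe (W - {u}))\<^sup>*" by (rule rtrancl_trans)
        moreover have "\<Delta> u (y v0) = 0" using v0(2)[OF uW] u v0T by auto
        ultimately show False using prp[OF uW] nz by blast
      qed
      then show "m \<in> T - {u}" using mW by blast
    qed
    then have "comp u r \<subset> T" using u by blast
    then have "card (comp u r) < card T"
      using TW graph_onD(1)[OF g] by (meson finite_Diff finite_subset psubset_card_mono)
    then show False using least[OF \<open>bad (u, r)\<close>] by (simp add: T_def)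
  qed
  have "\<exists>r\<in>T. \<exists>r'\<in>T. l r \<noteq> l r'"
  proof (rule ccontr)
    assume n: "\<not> ?thesis"
    have same: "l r = l r'" if "r \<in> T" "r' \<in> T" for r r' using n that by blast
    have sub: "T \<subseteq> W" "T \<noteq> {}" using TW sT by auto
    obtain r r' where "r \<in> T" "(r, r') \<in> Fe" "r' \<notin> T" "r' \<noteq> a" by (rule no_lobeD[OF 1 sub same, of a])
    then show False using closed by blast
  qed
  then obtain r r' where r: "r \<in> T" "r' \<in> T" "l r \<noteq> l r'" by blast
  then have "(r, r') \<in> (induced Fe (W - {a}))\<^sup>*"
    using rtrancl_swap[OF sym, of s r] by (auto simp: T_def comp_def intro: rtrancl_trans)
  from path_label_change[OF this r(3)]
  obtain m m' where m: "(r, m) \<in> (induced Fe (W - {a}))\<^sup>*" "(m, m') \<in> induced Fe (W - {a})" "l m \<noteq> l m'" by blast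
  have mT: "m \<in> T" using r(1) m(1) by (auto simp: T_def comp_def)
  have mF: "(m, m') \<in> Fe" "m' \<noteq> a" using m(2) by (auto simp: induced_def)
  have m'T: "m' \<in> T" using closed[OF mT mF] .
  have mm: "m \<in> W" "m' \<in> W" "m \<noteq> m'" "l m \<in> I" "l m' \<in> I" using graph_onD(6)[OF g mF(1)] by auto
  obtain \<epsilon> where eps: "\<epsilon> = 1 \<or> \<epsilon> = -1" "H y m m' = \<epsilon> * H x m m'" "H y m' m = \<epsilon> * H x m' m"
    by (rule mixed_edge[OF g du mm(1-3) Qe[OF mF(1)] off[OF mT mm(2) mm(3)[symmetric]] off[OF m'T mm(1,3)]
          comm[OF mm(1,2,2)] comm[OF mm(1,2,1)]])
  \<comment> \<open>Here \<open>y m\<close> is expressed by \<open>x m\<close> and constants, and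
    \<open>m\<close> differs from \<open>a\<close>, so it cannot move with
    \<open>x a\<close>.\<close>
  have "y m = c (l m) (l m') + \<epsilon> * (x m - c (l m) (l m'))"
    using cross_solve[OF mm(4,5) m(3) eps(2,3)] by simp
  then have "\<Delta> a (y m) = \<Delta> a (c (l m) (l m') + \<epsilon> * (x m - c (l m) (l m')))" by simp
  moreover have "\<Delta> a \<epsilon> = 0" using eps(1) derivationD(5,6)[OF dualD(1)[OF du as(1)]] by auto
  moreover have "m \<noteq> a" using mT TW by auto
  ultimately have "\<Delta> a (y m) = 0"
    using derivation_const[OF dualD(1)[OF du as(1)] mm(4,5)] dualD(2)[OF du as(1) mm(1)]
    by (simp add: derivationD[OF dualD(1)[OF du as(1)]])
  then show False using Tnz[OF mT] by blast
qed

definition congruent_on :: "('v \<Rightarrow> real) \<Rightarrow> ('v \<Rightarrow> real) \<Rightarrow> 'v set \<Rightarrow> bool" where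
  "congruent_on x y W \<longleftrightarrow> (\<forall>v\<in>W. y v = x v) \<or>
    (\<exists>i\<in>I. \<exists>j\<in>I. i \<noteq> j \<and> (\<forall>v\<in>W. l v = i \<and> y v = 2 * c i j - x v \<or> l v = j \<and> y v = 2 * c j i - x v))"

text \<open>The common factor \<epsilon> spreads from the cross edge \<open>ab\<close> along paths.
  For \<open>\<epsilon> = -1\<close> a path stays on two lines: a step to a third one would have the
  same closest point on the current line, against \<open>c_distinct\<close>.\<close>

lemma congruent_if_diagonal:
  assumes g: "graph_on Fe W" and cn: "conn_on Fe W" and ab: "(a, b) \<in> Fe" "l a \<noteq> l b"
    and eps: "\<epsilon> = 1 \<or> \<epsilon> = -1"
    and e: "\<And>u v. (u, v) \<in> Fe \<Longrightarrow> H y u v = \<epsilon> * H x u v"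
  shows "congruent_on x y W"
proof -
  have aI: "a \<in> W" "b \<in> W" "l a \<in> I" "l b \<in> I" "(b, a) \<in> Fe" using graph_onD(6)[OF g ab(1)] by auto
  have solve: "y u - c (l u) (l v) = \<epsilon> * (x u - c (l u) (l v))" if "(u, v) \<in> Fe" "l u \<noteq> l v" for u v
    using cross_solve[of u v y \<epsilon> x] graph_onD(6)[OF g that(1)] that e by blast
  have reach: "(a, v) \<in> Fe\<^sup>*" if "v \<in> W" for v using cn aI that by (auto simp: conn_on_def)
  from eps show ?thesis
  proof
    assume "\<epsilon> = 1"
    have "y v = x v" if "v \<in> W" for v
      using reach[OF that]
    proof (induction rule: rtrancl_induct)
      case base
      show ?case using solve[OF ab] \<open>\<epsilon> = 1\<close> by simp
    next
      case (step u v)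
      then have "B (l u) (l v) \<noteq> 0" using graph_onD(6)[OF g step(2)] B_nz by auto
      then show ?case using e[OF step(2)] step.IH \<open>\<epsilon> = 1\<close> by (simp add: H_def h_def)
    qed
    then show ?thesis by (simp add: congruent_on_def)
  next
    assume m1: "\<epsilon> = -1"
    define i j where "i = l a" and "j = l b"
    have "l v = i \<and> y v = 2 * c i j - x v \<or> l v = j \<and> y v = 2 * c j i - x v" if "v \<in> W" for v
      using reach[OF that]
    proof (induction rule: rtrancl_induct)
      case base
      show ?case using solve[OF ab] m1 by (simp add: i_def j_def)
    next
      case (step u v)
      have ne: "i \<noteq> j" using ab(2) by (simp add: i_def j_def)
      have "\<exists>m n. {m, n} = {i, j} \<and> m \<noteq> n \<and> l u = m \<and> y u = 2 * c m n - x u"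
        using step.IH
      proof
        assume "l u = i \<and> y u = 2 * c i j - x u"
        then show ?thesis using ne by (intro exI[of _ i] exI[of _ j]) auto
      next
        assume "l u = j \<and> y u = 2 * c j i - x u"
        then show ?thesis using ne by (intro exI[of _ j] exI[of _ i]) auto
      qed
      then obtain m n where mn: "{m, n} = {i, j}" "m \<noteq> n" "l u = m" "y u = 2 * c m n - x u" by blast
      have uv: "l u \<in> I" "l v \<in> I" "(v, u) \<in> Fe" using graph_onD(6)[OF g step(2)] by auto
      have nI: "n \<in> I" using mn(1) aI by (auto simp: i_def j_def doubleton_eq_iff)
      have "l v = m \<and> y v = 2 * c m n - x v \<or> l v = n \<and> y v = 2 * c n m - x v"
      proof (cases "l v = m")
        case True
        then have "A m * (y u - y v) = A m * (- (x u - x v))"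
          using e[OF step(2)] m1 uv mn by (simp add: same_line_Q algebra_simps)
        then have "y u - y v = - (x u - x v)" using A_pos uv mn by (metis less_irrefl mult_left_cancel)
        then show ?thesis using True mn by auto
      next
        case False
        have 1: "y u - c m (l v) = - (x u - c m (l v))" using solve[OF step(2)] False mn m1 by auto
        have 2: "y v - c (l v) m = - (x v - c (l v) m)" using solve[OF uv(3)] False mn m1 by auto
        have "c m (l v) = c m n" using 1 mn by linarith
        then have "l v = n" using c_distinct[of m "l v" n] uv mn nI False by metis
        then show ?thesis using 2 by auto
      qed
      then show ?case using mn(1) by (auto simp: doubleton_eq_iff)
    qed
    then show ?thesis using aI ab(2) unfolding congruent_on_def i_def j_def by blast
  qed
qed


section \<open>Contraction of a vertex without cross edges\<close>

definition clique :: "('v \<times> 'v) set \<Rightarrow> 'v \<Rightarrow> ('v \<times> 'v) set" where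
  "clique Fe z = {(u, u'). u \<noteq> u' \<and> (z, u) \<in> Fe \<and> (z, u') \<in> Fe}"

definition contract :: "('v \<times> 'v) set \<Rightarrow> 'v set \<Rightarrow> 'v \<Rightarrow> ('v \<times> 'v) set" where
  "contract Fe W z = induced Fe (W - {z}) \<union> clique Fe z"

lemma contract_graph:
  assumes g: "graph_on Fe W"
  shows "graph_on (contract Fe W z) (W - {z})"
proof -
  have "clique Fe z \<subseteq> (W - {z}) \<times> (W - {z})" "irrefl (clique Fe z)" "sym (clique Fe z)"
    using graph_onD(6)[OF g] by (auto simp: clique_def irrefl_def sym_def)
  moreover have "graph_on (induced Fe (W - {z})) (W - {z})" by (rule graph_on_induced[OF g]) auto
  ultimately show ?thesis
    by (auto simp: graph_on_def contract_def irrefl_def sym_def)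
qed

text \<open>If \<open>T\<close> contains a neighbour of \<open>z\<close>, the condition is applied
  to \<open>insert z T\<close>, which still lies on one line; an edge leaving at \<open>z\<close> is
  replaced by a clique edge.\<close>

lemma contract_no_lobe:
  assumes g: "graph_on Fe W" and z: "z \<in> W" and 1: "no_lobe Fe W"
    and inl: "\<And>u. (z, u) \<in> Fe \<Longrightarrow> l u = l z"
  shows "no_lobe (contract Fe W z) (W - {z})"
  unfolding no_lobe_def
proof (intro allI impI, elim conjE)
  fix T s assume T: "T \<subseteq> W - {z}" "T \<noteq> {}" "\<forall>t\<in>T. \<forall>t'\<in>T. l t = l t'"
  show "\<exists>t\<in>T. \<exists>t'. (t, t') \<in> contract Fe W z \<and> t' \<notin> T \<and> t' \<noteq> s"
  proof (cases "\<exists>u\<in>T. (z, u) \<in> Fe")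
    case True
    then obtain u where u: "u \<in> T" "(z, u) \<in> Fe" by blast
    have sub: "insert z T \<subseteq> W" "insert z T \<noteq> {}" using T z by auto
    have "l t = l z" if "t \<in> T" for t using inl[OF u(2)] T(3) u(1) that by metis
    then have same: "l t = l t'" if "t \<in> insert z T" "t' \<in> insert z T" for t t' using that by auto
    obtain t t' where t: "t \<in> insert z T" "(t, t') \<in> Fe" "t' \<notin> insert z T" "t' \<noteq> s"
      by (rule no_lobeD[OF 1 sub same, of s])
    have "(if t = z then u else t, t') \<in> contract Fe W z"
      using t u T(1) graph_onD(6)[OF g t(2)] by (auto simp: contract_def clique_def induced_def)
    then show ?thesis using t u by (intro bexI[of _ "if t = z then u else t"] exI[of _ t']) auto
  next
    case False
    have sub: "T \<subseteq> W" using T by auto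
    have same: "l t = l t'" if "t \<in> T" "t' \<in> T" for t t' using T(3) that by blast
    obtain t t' where t: "t \<in> T" "(t, t') \<in> Fe" "t' \<notin> T" "t' \<noteq> s"
      by (rule no_lobeD[OF 1 sub T(2) same, of s])
    have "t' \<noteq> z" using False t graph_onD(6)[OF g t(2)] by auto
    then have "(t, t') \<in> contract Fe W z"
      using t T(1) graph_onD(6)[OF g t(2)] by (auto simp: contract_def induced_def)
    then show ?thesis using t by blast
  qed
qed

text \<open>Cross edges are the same before and after, since \<open>z\<close> has none and clique
  edges stay on one line. Paths translate both ways: a clique edge is a detour through
  \<open>z\<close>, and a passage through \<open>z\<close> is a clique edge.\<close>

lemma contract_stably_nontame:
  assumes g: "graph_on Fe W" and z: "z \<in> W" and 3: "stably_nontame Fe"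
    and inl: "\<And>u. (z, u) \<in> Fe \<Longrightarrow> l u = l z"
  shows "stably_nontame (contract Fe W z)"
  unfolding stably_nontame_def
proof (intro allI impI, elim conjE)
  let ?F = "contract Fe W z"
  have cl: "l u = l u'" if "(u, u') \<in> clique Fe z" for u u' using inl that by (auto simp: clique_def)
  fix a b assume ab: "(a, b) \<in> ?F" "l a \<noteq> l b" "(a, b) \<in> (delete_edge ?F a b)\<^sup>*"
  have abF: "(a, b) \<in> Fe" "a \<noteq> z" "b \<noteq> z" using ab cl by (auto simp: contract_def induced_def)
  have "delete_edge ?F a b \<subseteq> (delete_edge Fe a b)\<^sup>*"
  proof
    fix p assume p: "p \<in> delete_edge ?F a b"
    obtain u u' where uu: "p = (u, u')" by force
    show "p \<in> (delete_edge Fe a b)\<^sup>*"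
    proof (cases "p \<in> clique Fe z")
      case True
      then have "(z, u) \<in> Fe" "(z, u') \<in> Fe" by (auto simp: clique_def uu)
      then have "(u, z) \<in> delete_edge Fe a b" "(z, u') \<in> delete_edge Fe a b"
        using graph_onD(6)[OF g] abF by (auto simp: delete_edge_def)
      then show ?thesis unfolding uu by (meson converse_rtrancl_into_rtrancl r_into_rtrancl)
    next
      case False
      then have "p \<in> delete_edge Fe a b" using p by (auto simp: delete_edge_def contract_def induced_def)
      then show ?thesis by blast
    qed
  qed
  then have "(a, b) \<in> (delete_edge Fe a b)\<^sup>*" using ab(3) by (meson rtrancl_subset_rtrancl subsetD)
  then have "nontame (delete_edge Fe a b)" using 3 abF(1) ab(2) by (auto simp: stably_nontame_def)
  then obtain c d where cd: "(c, d) \<in> delete_edge Fe a b" "l c \<noteq> l d" "(c, d) \<in> (delete_edge (delete_edge Fe a b) c d)\<^sup>*"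
    by (auto simp: nontame_def)
  have cdF: "(c, d) \<in> Fe" "c \<noteq> z" "d \<noteq> z"
    using cd inl graph_onD(6)[OF g, of c d] by (auto simp: delete_edge_def)
  define R where "R = delete_edge (delete_edge Fe a b) c d"
  define R' where "R' = delete_edge (delete_edge ?F a b) c d"
  have cdR: "(c, d) \<in> delete_edge ?F a b"
    using cd(1) cdF graph_onD(6)[OF g cdF(1)] by (auto simp: delete_edge_def contract_def induced_def)
  have clR: "clique Fe z \<subseteq> R'"
    using cl ab(2) cd(2) by (auto simp: R'_def delete_edge_def contract_def)
  \<comment> \<open>While the path stands at \<open>z\<close>, its copy in the contracted graph
    waits at the neighbour from which \<open>z\<close> was entered.\<close>
  have "(w \<noteq> z \<longrightarrow> (c, w) \<in> R'\<^sup>*) \<and> (w = z \<longrightarrow> (\<exists>u. (z, u) \<in> Fe \<and> (c, u) \<in> R'\<^sup>*))" if "(c, w) \<in> R\<^sup>*" for w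
    using that
  proof (induction rule: rtrancl_induct)
    case base
    show ?case using cdF by simp
  next
    case (step w w')
    have ww: "(w, w') \<in> Fe" "(w', w) \<in> Fe" "w \<noteq> w'" "w \<in> W" "w' \<in> W"
      using step(2) graph_onD(6)[OF g, of w w'] by (auto simp: R_def delete_edge_def)
    show ?case
    proof (cases "w = z")
      case True
      then obtain u where u: "(z, u) \<in> Fe" "(c, u) \<in> R'\<^sup>*" using step.IH by blast
      have "u = w' \<or> (u, w') \<in> R'" using clR u ww True by (auto simp: clique_def)
      then show ?thesis using u True ww by (metis rtrancl.rtrancl_into_rtrancl)
    next
      case False
      show ?thesis
      proof (cases "w' = z")
        case True
        then show ?thesis using step.IH False ww by blast
      next
        case nz: False
        have "(w, w') \<in> R'"
          using step(2) False nz ww by (auto simp: R_def R'_def delete_edge_def contract_def induced_def)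
        then show ?thesis using step.IH False nz by (metis rtrancl.rtrancl_into_rtrancl)
      qed
    qed
  qed
  then have "(c, d) \<in> R'\<^sup>*" using cd(3) cdF by (simp add: R_def)
  then show "nontame (delete_edge ?F a b)" using cdR cd(2) unfolding nontame_def R'_def by blast
qed

text \<open>Induction at a vertex \<open>z\<close> whose removal leaves a rigid graph, so that the
  other coordinates of \<open>y\<close> do not vary with \<open>x z\<close>. If \<open>z\<close> has
  a cross edge, \<open>cross_pinned\<close> at its other end provides the start for
  \<open>diagonal\<close>, and \<open>mixed_edge\<close> gives one sign for all edges. Otherwise the
  neighbours of \<open>z\<close> keep their mutual distances, so \<open>y\<close> also solves the
  contracted graph.\<close>

theorem solution_congruent:
  assumes "graph_on Fe W" "conn_on Fe W" "no_lobe Fe W" "stably_nontame Fe" "W \<noteq> {}" "dual K W x \<Delta>"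
    and "\<And>u v. (u, v) \<in> Fe \<Longrightarrow> Q y u v = Q x u v"
  shows "congruent_on x y W"
  using assms
proof (induction "card W" arbitrary: Fe W rule: less_induct)
  case less
  note g = less.prems(1) and cn = less.prems(2) and 1 = less.prems(3) and 3 = less.prems(4)
    and W = less.prems(5) and du = less.prems(6) and Qe = less.prems(7)
  have nt: "nontame Fe" by (rule nontame_of_no_lobe[OF g cn 1 W])
  obtain z where z: "z \<in> W" "conn_on (induced Fe (W - {z})) (W - {z})" "nontame (induced Fe (W - {z}))"
    using removable_vertex[OF g cn nt 3] by blast
  obtain \<Delta>' where du': "dual K W y \<Delta>'" by (rule dual_solution[OF du g cn nt Qe])
  have gz: "graph_on (induced Fe (W - {z})) (W - {z})" by (rule graph_on_induced[OF g]) auto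
  have fr: "\<Delta> z (y v) = 0" if "v \<in> W" "v \<noteq> z" for v
  proof (rule rigid[OF dual_subset[OF du'] gz z(2,3)])
    show "W - {z} \<subseteq> W" "v \<in> W - {z}" using that by auto
    fix a b assume ab: "(a, b) \<in> induced Fe (W - {z})"
    then have "(a, b) \<in> Fe" "a \<in> W" "a \<noteq> z" "b \<in> W" "b \<noteq> z" by (auto simp: induced_def)
    then show "H y a b * \<Delta> z (y a) + H y b a * \<Delta> z (y b) = 0"
      using derivation_Q_eq[OF dualD(1)[OF du z(1)] _ _ Qe, of a b] graph_onD(6)[OF g, of a b] dualD(2)[OF du z(1)]
      by simp
  qed
  have comm: "\<Delta> a (\<Delta> b (y v)) = \<Delta> b (\<Delta> a (y v))" if ab: "a \<in> W" "b \<in> W" and v: "v \<in> W" for a b v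
  proof -
    define D where "D r = \<Delta> a (\<Delta> b r) - \<Delta> b (\<Delta> a r)" for r
    have D: "derivation K D" unfolding D_def by (rule derivation_commutator[OF dualD(1)[OF du ab(1)] dualD(1)[OF du ab(2)]])
    have "D (x w) = 0" if "w \<in> W" for w
      using dualD(2)[OF du _ that] ab derivationD(4,5)[OF dualD(1)[OF du ab(1)]] derivationD(4,5)[OF dualD(1)[OF du ab(2)]]
      by (simp add: D_def)
    then have "D (y v) = 0"
      using rigid[OF du' g cn nt _ v, of "\<lambda>v. D (y v)"] derivation_Q_eq[OF D _ _ Qe] graph_onD(6)[OF g] by simp
    then show ?thesis by (simp add: D_def)
  qed
  \<comment> \<open>By \<open>no_lobe\<close> for the set \<open>{z}\<close>, the vertex
    \<open>z\<close> has two neighbours.\<close>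
  have zs: "{z} \<subseteq> W" "{z} \<noteq> {}" using z by auto
  have same: "l t = l t'" if "t \<in> {z}" "t' \<in> {z}" for t t' using that by simp
  obtain u where u: "(z, u) \<in> Fe" using no_lobeD[OF 1 zs same, of z] by blast
  obtain u' where u': "(z, u') \<in> Fe" "u \<noteq> u'" using no_lobeD[OF 1 zs same, of u] by blast
  obtain \<epsilon> where eps: "\<epsilon> = 1 \<or> \<epsilon> = -1" and He: "\<And>v. (z, v) \<in> Fe \<Longrightarrow> H y z v = \<epsilon> * H x z v"
  proof (rule free_vertex[OF g du u u' Qe fr])
    fix \<epsilon> assume "\<epsilon> = 1 \<or> \<epsilon> = -1" "\<And>v. (z, v) \<in> Fe \<Longrightarrow> H y z v = \<epsilon> * H x z v"
    then show thesis by (rule that)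
  qed
  show ?case
  proof (cases "\<exists>v. (z, v) \<in> Fe \<and> l v \<noteq> l z")
    case True
    then obtain v0 where v0: "(z, v0) \<in> Fe" "l z \<noteq> l v0" by metis
    have v0W: "v0 \<in> W" and I0: "l z \<in> I" "l v0 \<in> I" using graph_onD(6)[OF g v0(1)] by auto
    have pin: "y v0 = x v0 \<or> y v0 = 2 * c (l v0) (l z) - x v0"
      by (rule cross_pinned[OF I0 v0(2) Qe[OF v0(1)] He[OF v0(1)] eps])
    have row: "\<Delta> w (y v0) = 0" if w: "w \<in> W" "w \<noteq> v0" for w
    proof -
      note D = dualD(1)[OF du w(1)]
      have "\<Delta> w (x v0) = 0" using dualD(2)[OF du w(1) v0W] w by simp
      then show ?thesis using pin derivation_const[OF D I0(2,1)] by (auto simp: derivationD[OF D])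
    qed
    have off: "\<Delta> w (y t) = 0" if "w \<in> W" "t \<in> W" "w \<noteq> t" for w t
      by (rule diagonal[OF g cn 1 du du' nt Qe v0W row comm that])
    have edge: "\<Delta> t' (y t') = \<Delta> t (y t) \<and> (\<Delta> t (y t) = 1 \<or> \<Delta> t (y t) = -1) \<and> H y t t' = \<Delta> t (y t) * H x t t'"
      if e: "(t, t') \<in> Fe" for t t'
    proof -
      have t: "t \<in> W" "t' \<in> W" "t \<noteq> t'" using graph_onD(6)[OF g e] by auto
      show ?thesis
        by (rule mixed_edge[OF g du t Qe[OF e] off[OF t] off[OF t(2,1) t(3)[symmetric]]
              comm[OF t(1,2,2)] comm[OF t(1,2,1)]]) auto
    qed
    have const: "\<Delta> v (y v) = \<Delta> z (y z)" if "v \<in> W" for v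
    proof -
      have "(z, v) \<in> Fe\<^sup>*" using cn z that by (auto simp: conn_on_def)
      then show ?thesis by (induction rule: rtrancl_induct) (use edge in auto)
    qed
    have "H y t t' = \<Delta> z (y z) * H x t t'" if "(t, t') \<in> Fe" for t t'
      using edge[OF that] const graph_onD(6)[OF g that] by simp
    moreover have "\<Delta> z (y z) = 1 \<or> \<Delta> z (y z) = -1" using edge[OF u] by simp
    ultimately show ?thesis using congruent_if_diagonal[OF g cn v0] by blast
  next
    case False
    then have inl: "l v = l z" if "(z, v) \<in> Fe" for v using that by blast
    let ?F = "contract Fe W z"
    have tr: "y z - y v = \<epsilon> * (x z - x v)" if "(z, v) \<in> Fe" for v
    proof -
      have "2 * A (l z) * (y z - y v) = 2 * A (l z) * (\<epsilon> * (x z - x v))"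
        using He[OF that] same_line_Q(2)[of z v] inl[OF that] graph_onD(6)[OF g that] by (simp add: mult_ac)
      then show ?thesis using A_pos[of "l z"] graph_onD(6)[OF g that] by simp
    qed
    have tr2: "y v - y v' = \<epsilon> * (x v - x v')" if "(z, v) \<in> Fe" "(z, v') \<in> Fe" for v v'
      using tr[OF that(1)] tr[OF that(2)] by (simp add: algebra_simps)
    have IH: "congruent_on x y (W - {z})"
    proof (rule less.hyps[of "W - {z}" ?F])
      show "card (W - {z}) < card W" using z graph_onD(1)[OF g] by (metis card_Diff1_less)
      show "graph_on ?F (W - {z})" by (rule contract_graph[OF g])
      show "conn_on ?F (W - {z})"
        using z(2) rtrancl_mono[of "induced Fe (W - {z})" ?F] unfolding conn_on_def contract_def by blast
      show "no_lobe ?F (W - {z})" by (rule contract_no_lobe[OF g z(1) 1 inl])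
      show "stably_nontame ?F" by (rule contract_stably_nontame[OF g z(1) 3 inl])
      show "W - {z} \<noteq> {}" using graph_onD(6)[OF g u] by auto
      show "dual K (W - {z}) x \<Delta>" by (rule dual_subset[OF du]) auto
      fix v v' assume "(v, v') \<in> ?F"
      then consider "(v, v') \<in> Fe" | "(z, v) \<in> Fe" "(z, v') \<in> Fe"
        by (auto simp: contract_def induced_def clique_def)
      then show "Q y v v' = Q x v v'"
      proof cases
        case 1
        then show ?thesis by (rule Qe)
      next
        case 2
        have "l v = l v'" "l v \<in> I" using inl 2 graph_onD(6)[OF g 2(1)] by auto
        moreover have "(y v - y v')\<^sup>2 = (x v - x v')\<^sup>2" unfolding tr2[OF 2] using eps by (auto simp: power2_eq_square algebra_simps)
        ultimately show ?thesis by (simp add: same_line_Q)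
      qed
    qed
    have uW: "u \<in> W - {z}" "u' \<in> W - {z}" using graph_onD(6)[OF g u] graph_onD(6)[OF g u'(1)] by auto
    \<comment> \<open>Two distinct neighbour coordinates determine \<epsilon> from the congruence
      found on \<open>W - {z}\<close>, which then extends to \<open>z\<close>.\<close>
    have "x u \<noteq> x u'"
    proof
      assume "x u = x u'"
      then have "\<Delta> u (x u) = \<Delta> u (x u')" by simp
      then show False using dualD(2)[OF du, of u] uW u'(2) by auto
    qed
    note tru = tr[OF u] and truu = tr2[OF u u'(1)]
    from IH consider (id) "\<forall>v\<in>W - {z}. y v = x v"
      | (ref) i j where "i \<in> I" "j \<in> I" "i \<noteq> j"
        "\<forall>v\<in>W - {z}. l v = i \<and> y v = 2 * c i j - x v \<or> l v = j \<and> y v = 2 * c j i - x v"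
      unfolding congruent_on_def by blast
    then show ?thesis
    proof cases
      case id
      then have "x u - x u' = \<epsilon> * (x u - x u')" using truu uW by simp
      then have "\<epsilon> = 1" using \<open>x u \<noteq> x u'\<close> by simp
      then have "y z = x z" using tru id uW by simp
      then show ?thesis using id unfolding congruent_on_def by blast
    next
      case ref
      have luu: "l u = l z" "l u' = l z" using inl u u' by auto
      have iff: "(l u = i) = (l u' = i)" using luu by simp
      have "y u - y u' = - (x u - x u')"
        using ref(3) bspec[OF ref(4) uW(1)] bspec[OF ref(4) uW(2)] luu by auto
      then have "- (x u - x u') = \<epsilon> * (x u - x u')" using truu by simp
      then have "(\<epsilon> + 1) * (x u - x u') = 0" by (simp add: algebra_simps)
      then have "\<epsilon> = -1" using \<open>x u \<noteq> x u'\<close> by simp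
      then have "l z = i \<and> y z = 2 * c i j - x z \<or> l z = j \<and> y z = 2 * c j i - x z"
        using tru bspec[OF ref(4) uW(1)] luu by auto
      then have "\<forall>v\<in>W. l v = i \<and> y v = 2 * c i j - x v \<or> l v = j \<and> y v = 2 * c j i - x v"
        using ref(4) by blast
      then show ?thesis using ref(1-3) unfolding congruent_on_def by blast
    qed
  qed
qed

end

section \<open>Loops of solutions\<close>

lemma joinpaths_coord: "(f +++ g) s w = ((\<lambda>s. f s w) +++ (\<lambda>s. g s w)) s"
  by (simp add: joinpaths_def)

lemma path_coord_join:
  assumes "path (\<lambda>s. f s w)" "path (\<lambda>s. g s w)" "f 1 w = g 0 w"
  shows "path (\<lambda>s. (f +++ g) s w :: real)"
  unfolding joinpaths_coord using assms by (intro path_join_imp) (auto simp: pathfinish_def pathstart_def)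

lemma eventually_at_right_0: "(\<And>s::real. 0 < s \<Longrightarrow> s < d \<Longrightarrow> P s) \<Longrightarrow> 0 < d \<Longrightarrow> \<forall>\<^sub>F s in at_right 0. P s"
  by (auto simp: eventually_at_right_field)

lemma filterlim_scale_at_right: "0 < k \<Longrightarrow> filterlim (\<lambda>s. k * s) (at_right 0) (at_right (0::real))"
  unfolding filterlim_at
  by (auto intro!: tendsto_eq_intros eventually_at_right_0[of 1])

context line_data
begin

text \<open>\<open>g\<close> leaves \<open>x\<close> with velocity proportional to \<open>z\<close>, and the sign of its \<open>r\<close>-component is \<open>\<sigma>\<close>.\<close>

definition leaves :: "('v \<Rightarrow> real) \<Rightarrow> 'v set \<Rightarrow> 'v \<Rightarrow> ('v \<Rightarrow> real) \<Rightarrow> real \<Rightarrow> (real \<Rightarrow> 'v \<Rightarrow> real) \<Rightarrow> bool" where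
  "leaves x U r z \<sigma> g \<longleftrightarrow>
     (\<forall>w\<in>U. ((\<lambda>s. g s w) \<longlongrightarrow> x w) (at_right 0) \<and>
            ((\<lambda>s. (g s w - x w) / (g s r - x r)) \<longlongrightarrow> z w) (at_right 0)) \<and>
     (\<forall>\<^sub>F s in at_right 0. 0 < \<sigma> * (g s r - x r))"

lemma leaves_cong:
  assumes "leaves x U r z \<sigma> f" "\<forall>\<^sub>F s in at_right 0. f s = g s"
  shows "leaves x U r z \<sigma> g"
proof -
  have "\<forall>\<^sub>F s in at_right 0. 0 < \<sigma> * (g s r - x r)"
    using assms unfolding leaves_def by (auto elim: eventually_elim2)
  moreover have "((\<lambda>s. g s w) \<longlongrightarrow> x w) (at_right 0)"
    "((\<lambda>s. (g s w - x w) / (g s r - x r)) \<longlongrightarrow> z w) (at_right 0)" if w: "w \<in> U" for w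
  proof -
    have f: "((\<lambda>s. f s w) \<longlongrightarrow> x w) (at_right 0)" "((\<lambda>s. (f s w - x w) / (f s r - x r)) \<longlongrightarrow> z w) (at_right 0)"
      using assms(1) w by (simp_all add: leaves_def)
    have "\<forall>\<^sub>F s in at_right 0. f s w = g s w" using assms(2) by eventually_elim simp
    then show "((\<lambda>s. g s w) \<longlongrightarrow> x w) (at_right 0)" by (rule Lim_transform_eventually[OF f(1)])
    have "\<forall>\<^sub>F s in at_right 0. (f s w - x w) / (f s r - x r) = (g s w - x w) / (g s r - x r)"
      using assms(2) by eventually_elim simp
    then show "((\<lambda>s. (g s w - x w) / (g s r - x r)) \<longlongrightarrow> z w) (at_right 0)"
      by (rule Lim_transform_eventually[OF f(2)])
  qed
  ultimately show ?thesis by (simp add: leaves_def)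
qed

lemma leaves_scale:
  assumes "leaves x U r z \<sigma> g" "0 < k"
  shows "leaves x U r z \<sigma> (\<lambda>s. g (k * s))"
proof -
  note f = filterlim_scale_at_right[OF assms(2)]
  show ?thesis
    unfolding leaves_def
  proof (intro conjI ballI)
    show "\<forall>\<^sub>F s in at_right 0. 0 < \<sigma> * (g (k * s) r - x r)"
      by (rule eventually_compose_filterlim[OF _ f]) (use assms(1) in \<open>simp add: leaves_def\<close>)
    fix w assume "w \<in> U"
    then have lims: "((\<lambda>s. g s w) \<longlongrightarrow> x w) (at_right 0)"
      "((\<lambda>s. (g s w - x w) / (g s r - x r)) \<longlongrightarrow> z w) (at_right 0)"
      using assms(1) by (simp_all add: leaves_def)
    show "((\<lambda>s. g (k * s) w) \<longlongrightarrow> x w) (at_right 0)" by (rule filterlim_compose[OF lims(1) f])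
    show "((\<lambda>s. (g (k * s) w - x w) / (g (k * s) r - x r)) \<longlongrightarrow> z w) (at_right 0)"
      by (rule filterlim_compose[OF lims(2) f])
  qed
qed

lemma leaves_join:
  assumes "leaves x U r z \<sigma> f"
  shows "leaves x U r z \<sigma> (f +++ g)"
  by (rule leaves_cong[OF leaves_scale[OF assms, of 2]])
    (auto simp: joinpaths_def intro!: eventually_at_right_0[of "1/2"])

lemma leaves_reverse_join:
  assumes "leaves x U r z \<sigma> (reversepath g)"
  shows "leaves x U r z \<sigma> (reversepath (f +++ g))"
  by (rule leaves_cong[OF leaves_scale[OF assms, of 2]])
    (auto simp: joinpaths_def reversepath_def intro!: eventually_at_right_0[of "1/2"])

text \<open>A chain rule for difference quotients: as \<open>Q\<close> is quadratic, its increment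
  is an exact expression in the increments of the two coordinates. Dividing by the increment at
  \<open>r\<close> instead of by \<open>s\<close> keeps this independent of the
  parametrisation.\<close>

lemma leaves_Q:
  assumes lv: "leaves x U r z \<sigma> g" and ab: "a \<in> U" "b \<in> U" "l a \<in> I" "l b \<in> I"
  shows "((\<lambda>s. (Q (g s) a b - Q x a b) / (g s r - x r)) \<longlongrightarrow> H x a b * z a + H x b a * z b) (at_right 0)"
proof -
  define \<alpha> where "\<alpha> s = (g s a - x a) / (g s r - x r)" for s
  define \<beta> where "\<beta> s = (g s b - x b) / (g s r - x r)" for s
  have lim: "(\<alpha> \<longlongrightarrow> z a) (at_right 0)" "(\<beta> \<longlongrightarrow> z b) (at_right 0)"
    "((\<lambda>s. g s a) \<longlongrightarrow> x a) (at_right 0)" "((\<lambda>s. g s b) \<longlongrightarrow> x b) (at_right 0)"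
    using lv ab unfolding leaves_def \<alpha>_def \<beta>_def by auto
  have id: "Q y a b - Q x a b = (y a - x a) * (H x a b + A (l a) * (y a - x a) - 2 * B (l a) (l b) * (y b - x b))
      + (y b - x b) * (H x b a + A (l b) * (y b - x b))" for y
    by (simp add: Q_def q_def H_def h_def B_sym[OF ab(4,3)] power2_eq_square algebra_simps)
  have "(\<lambda>s. (Q (g s) a b - Q x a b) / (g s r - x r)) =
     (\<lambda>s. \<alpha> s * (H x a b + A (l a) * (g s a - x a) - 2 * B (l a) (l b) * (g s b - x b))
      + \<beta> s * (H x b a + A (l b) * (g s b - x b)))"
    unfolding id \<alpha>_def \<beta>_def by (simp add: add_divide_distrib)
  moreover have "((\<lambda>s. \<alpha> s * (H x a b + A (l a) * (g s a - x a) - 2 * B (l a) (l b) * (g s b - x b))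
      + \<beta> s * (H x b a + A (l b) * (g s b - x b))) \<longlongrightarrow>
      z a * (H x a b + A (l a) * (x a - x a) - 2 * B (l a) (l b) * (x b - x b)) + z b * (H x b a + A (l b) * (x b - x b)))
      (at_right 0)"
    by (intro tendsto_intros lim)
  ultimately show ?thesis by (simp add: mult.commute)
qed

text \<open>Both ends have the same direction \<open>z\<close>, with opposite signs at
  \<open>r\<close>: the loop passes through \<open>x\<close> without turning back there. Edges
  within one line are translated, so the pieces they form move rigidly.\<close>

definition is_loop :: "('v \<times> 'v) set \<Rightarrow> ('v \<Rightarrow> real) \<Rightarrow> 'v set \<Rightarrow> 'v \<Rightarrow> ('v \<Rightarrow> real) \<Rightarrow> (real \<Rightarrow> 'v \<Rightarrow> real) \<Rightarrow> bool" where
  "is_loop E x U r z g \<longleftrightarrow>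
     r \<in> U \<and> (\<forall>w\<in>U. path (\<lambda>s. g s w) \<and> g 0 w = x w \<and> g 1 w = x w) \<and>
     (\<forall>s\<in>{0..1}. \<forall>(u, v)\<in>induced E U. Q (g s) u v = Q x u v \<and> (l u = l v \<longrightarrow> g s u - g s v = x u - x v)) \<and>
     (\<forall>s\<in>{0<..<1}. \<exists>w\<in>U. g s w \<noteq> x w) \<and>
     leaves x U r z 1 g \<and> leaves x U r z (-1) (reversepath g)"

text \<open>\<open>U \<union> P\<close> is obtained from \<open>U\<close> by attaching vertices of a single line along one cross edge.\<close>

definition attach :: "('v \<times> 'v) set \<Rightarrow> 'v set \<Rightarrow> 'v set \<Rightarrow> 'v \<Rightarrow> 'v \<Rightarrow> bool" where
  "attach E U P u v \<longleftrightarrow> u \<in> U \<and> v \<in> P \<and> U \<inter> P = {} \<and> l u \<in> I \<and> l v \<in> I \<and> l u \<noteq> l v \<and> l ` P \<subseteq> I \<and>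
     (\<forall>(s, t)\<in>induced E (U \<union> P). (s, t) \<in> induced E U \<or> s \<in> P \<and> t \<in> P \<and> l s = l t \<or> (s, t) = (u, v) \<or> (s, t) = (v, u))"

text \<open>Given the coordinate \<open>t\<close> of \<open>u\<close>, the possible coordinates of \<open>v\<close> are the two values \<open>sheet\<close>;
  \<open>disc\<close> is a quarter of the discriminant of the quadratic equation for them.\<close>

definition disc :: "('v \<Rightarrow> real) \<Rightarrow> 'v \<Rightarrow> 'v \<Rightarrow> real \<Rightarrow> real" where
  "disc x u v t = A (l v) * (Q x u v - F (l u) (l v)) -
     (A (l u) * A (l v) - B (l u) (l v) * B (l u) (l v)) * (t - c (l u) (l v))\<^sup>2"

definition sheet :: "('v \<Rightarrow> real) \<Rightarrow> 'v \<Rightarrow> 'v \<Rightarrow> real \<Rightarrow> real \<Rightarrow> real" where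
  "sheet x u v \<sigma> t = c (l v) (l u) + (B (l u) (l v) * (t - c (l u) (l v)) + \<sigma> * sqrt (disc x u v t)) / A (l v)"

text \<open>\<open>P\<close> is treated as one rigid piece on its line, so all of it follows
  \<open>v\<close>.\<close>

definition lift :: "('v \<Rightarrow> real) \<Rightarrow> 'v set \<Rightarrow> 'v \<Rightarrow> 'v \<Rightarrow> real \<Rightarrow> ('v \<Rightarrow> real) \<Rightarrow> 'v \<Rightarrow> real" where
  "lift x P u v \<sigma> y w = (if w \<in> P then x w + (sheet x u v \<sigma> (y u) - x v) else y w)"

text \<open>\<open>H y v u / 2\<close> is the signed square root that \<open>sheet\<close> adds, so
  its sign tells on which sheet \<open>y\<close> lies.\<close>

lemma disc_Q:
  assumes "l u \<in> I" "l v \<in> I" "Q y u v = Q x u v"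
  shows "disc x u v (y u) = (H y v u / 2)\<^sup>2"
  unfolding disc_def assms(3)[symmetric]
  by (simp add: Q_def q_def H_def h_def B_sym[OF assms(2,1)] power2_eq_square field_simps)

lemma sheet_Q:
  assumes I: "l u \<in> I" "l v \<in> I" and d: "0 \<le> disc x u v (y u)" and s: "\<sigma> = 1 \<or> \<sigma> = -1"
    and v: "y v = sheet x u v \<sigma> (y u)"
  shows "Q y u v = Q x u v"
proof -
  define a b \<beta> s t R m where "a = A (l u)" and "b = A (l v)" and "\<beta> = B (l u) (l v)"
    and "s = y u - c (l u) (l v)" and "t = y v - c (l v) (l u)" and "R = sqrt (disc x u v (y u))"
    and "m = Q x u v - F (l u) (l v)"
  have b: "b > 0" using A_pos[OF I(2)] by (simp add: b_def)
  have "t = (\<beta> * s + \<sigma> * R) / b" by (simp add: t_def v sheet_def b_def \<beta>_def s_def R_def)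
  then have 1: "b * t - \<beta> * s = \<sigma> * R" using b by simp
  have "R * R = b * m - (a * b - \<beta> * \<beta>) * (s * s)"
    using d by (simp add: R_def disc_def a_def b_def \<beta>_def s_def m_def power2_eq_square)
  moreover have "(b * t - \<beta> * s) * (b * t - \<beta> * s) = R * R" unfolding 1 using s by auto
  ultimately have "b * (a * s * s - 2 * \<beta> * s * t + b * t * t) = b * m" by (simp add: algebra_simps)
  then have "a * s * s - 2 * \<beta> * s * t + b * t * t = m" using b by simp
  then show ?thesis
    by (simp add: Q_def q_def a_def b_def \<beta>_def s_def t_def m_def power2_eq_square algebra_simps)
qed

text \<open>Where \<open>H x v u\<close> is nonzero the two sheets are apart, and its sign selects
  the one through \<open>x\<close>.\<close>

lemma sheet_x:
  assumes I: "l u \<in> I" "l v \<in> I" and nz: "H x v u \<noteq> 0"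
  shows "0 < disc x u v (x u)" "sheet x u v (sgn (H x v u)) (x u) = x v"
    "sheet x u v (- sgn (H x v u)) (x u) \<noteq> x v"
proof -
  have d: "disc x u v (x u) = (H x v u / 2)\<^sup>2" by (rule disc_Q[OF I refl])
  then show "0 < disc x u v (x u)" using nz by simp
  have r: "sqrt (disc x u v (x u)) = \<bar>H x v u\<bar> / 2" unfolding d by simp
  have b: "A (l v) > 0" by (rule A_pos[OF I(2)])
  have s: "sgn (H x v u) * \<bar>H x v u\<bar> = H x v u" by (simp add: sgn_mult_abs)
  have xv: "x v = c (l v) (l u) + (B (l u) (l v) * (x u - c (l u) (l v)) + H x v u / 2) / A (l v)"
    using b by (simp add: H_def h_def B_sym[OF I(2,1)] field_simps)
  show "sheet x u v (sgn (H x v u)) (x u) = x v"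
    unfolding sheet_def r using s by (subst xv) simp
  show "sheet x u v (- sgn (H x v u)) (x u) \<noteq> x v"
  proof
    assume "sheet x u v (- sgn (H x v u)) (x u) = x v"
    then have "- (sgn (H x v u) * \<bar>H x v u\<bar>) / 2 = H x v u / 2"
      unfolding sheet_def r using b by (subst (asm) xv) (simp add: field_simps)
    then show False using s nz by simp
  qed
qed

lemma sheet_continuous:
  assumes "l v \<in> I"
  shows "continuous_on S (sheet x u v \<sigma>)"
  unfolding sheet_def disc_def using A_pos[OF assms] by (intro continuous_intros) auto

lemma sheet_differentiable:
  assumes d: "0 < disc x u v t" and v: "l v \<in> I"
  shows "\<exists>D. (sheet x u v \<sigma> has_real_derivative D) (at t)"
proof -
  have "\<exists>D. ((\<lambda>t. sqrt (disc x u v t)) has_real_derivative D) (at t)"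
    using d unfolding disc_def by (intro exI) (auto intro!: derivative_eq_intros)
  then obtain D where "((\<lambda>t. sqrt (disc x u v t)) has_real_derivative D) (at t)" by blast
  moreover have "((\<lambda>t. k + (b * (t - e) + \<sigma> * S t) / a) has_real_derivative (b * (1 - 0) + \<sigma> * D) / a) (at t)"
    if "(S has_real_derivative D) (at t)" "a \<noteq> 0" for S k b e a
    by (rule DERIV_cong, (rule derivative_intros that)+) (use that in \<open>simp_all add: field_simps\<close>)
  moreover have "A (l v) \<noteq> 0" using A_pos[OF v] by simp
  ultimately show ?thesis unfolding sheet_def by blast
qed

lemma lift_path:
  assumes at: "attach E U P u v" and p: "\<And>w. w \<in> U \<Longrightarrow> path (\<lambda>s. f s w)" and w: "w \<in> U \<union> P"
  shows "path (\<lambda>s. lift x P u v \<sigma> (f s) w)"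
proof (cases "w \<in> P")
  case True
  have "continuous_on {0..1} (\<lambda>s. sheet x u v \<sigma> (f s u))"
    using p[of u] at
    by (intro continuous_on_compose2[OF sheet_continuous[of v UNIV x u \<sigma>]]) (auto simp: attach_def path_def)
  then show ?thesis using True by (auto simp: lift_def path_def intro!: continuous_intros)
next
  case False
  then show ?thesis using p w by (auto simp: lift_def)
qed

lemma lift_Q:
  assumes at: "attach E U P u v" and d: "0 \<le> disc x u v (y u)" and s: "\<sigma> = 1 \<or> \<sigma> = -1"
    and y: "\<forall>(s, t)\<in>induced E U. Q y s t = Q x s t \<and> (l s = l t \<longrightarrow> y s - y t = x s - x t)"
  shows "\<forall>(s, t)\<in>induced E (U \<union> P). Q (lift x P u v \<sigma> y) s t = Q x s t \<and>
    (l s = l t \<longrightarrow> lift x P u v \<sigma> y s - lift x P u v \<sigma> y t = x s - x t)"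
proof (intro ballI, clarify)
  fix p q assume pq: "(p, q) \<in> induced E (U \<union> P)"
  let ?Y = "lift x P u v \<sigma> y"
  have a: "u \<in> U" "v \<in> P" "U \<inter> P = {}" "l u \<in> I" "l v \<in> I" "l u \<noteq> l v" "l ` P \<subseteq> I" using at by (auto simp: attach_def)
  have YU: "?Y w = y w" if "w \<in> U" for w using that a by (auto simp: lift_def)
  have Quv: "Q ?Y u v = Q x u v"
    by (rule sheet_Q[OF a(4,5) _ s]) (use a d YU in \<open>auto simp: lift_def\<close>)
  have "\<forall>(s, t)\<in>induced E (U \<union> P). (s, t) \<in> induced E U \<or> s \<in> P \<and> t \<in> P \<and> l s = l t \<or> (s, t) = (u, v) \<or> (s, t) = (v, u)"
    using at unfolding attach_def by (elim conjE)
  from bspec[OF this pq]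
  consider "(p, q) \<in> induced E U" | "p \<in> P" "q \<in> P" "l p = l q" | "(p, q) = (u, v)" | "(p, q) = (v, u)"
    unfolding prod.case by (elim disjE conjE)
  then show "Q ?Y p q = Q x p q \<and> (l p = l q \<longrightarrow> ?Y p - ?Y q = x p - x q)"
  proof cases
    case 1
    then have "p \<in> U" "q \<in> U" by (auto simp: induced_def)
    then show ?thesis using y 1 YU by (auto simp: Q_def)
  next
    case 2
    then have "?Y p - ?Y q = x p - x q" by (simp add: lift_def)
    moreover have "l p \<in> I" using 2 a by auto
    ultimately show ?thesis using 2 by (simp add: same_line_Q)
  next
    case 3
    then show ?thesis using Quv a by auto
  next
    case 4
    then show ?thesis using Quv a Q_sym[OF a(4,5)] by auto
  qed
qed

text \<open>The sheet through \<open>x\<close> is differentiable at \<open>x u\<close>, where the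
  discriminant is positive. The direction \<open>z'\<close> is fixed before the curve is given, so
  that the same one serves both ends of a loop.\<close>

lemma lift_leaves:
  assumes at: "attach E U P u v" and r: "r \<in> U" and nz: "H x v u \<noteq> 0"
  obtains z' where "\<And>\<tau> g. leaves x U r z \<tau> g \<Longrightarrow>
    leaves x (U \<union> P) r z' \<tau> (\<lambda>s. lift x P u v (sgn (H x v u)) (g s))"
proof -
  have a: "u \<in> U" "v \<in> P" "U \<inter> P = {}" "l u \<in> I" "l v \<in> I" using at by (auto simp: attach_def)
  let ?\<sigma> = "sgn (H x v u)"
  note sx = sheet_x[OF a(4,5) nz]
  obtain D where "(sheet x u v ?\<sigma> has_real_derivative D) (at (x u))" using sheet_differentiable[OF sx(1) a(5)] by blast
  \<comment> \<open>Caratheodory's slope function avoids a division by \<open>g s u - x u\<close>,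
    which may be zero.\<close>
  then obtain \<phi> where \<phi>: "\<And>t. sheet x u v ?\<sigma> t - sheet x u v ?\<sigma> (x u) = \<phi> t * (t - x u)" "isCont \<phi> (x u)" "\<phi> (x u) = D"
    using CARAT_DERIV[of "sheet x u v ?\<sigma>" D "x u"] by blast
  show thesis
  proof (rule that[of "\<lambda>w. if w \<in> P then D * z u else z w"])
    fix \<tau> g assume lv: "leaves x U r z \<tau> g"
    let ?G = "\<lambda>s. lift x P u v ?\<sigma> (g s)"
    have gu: "((\<lambda>s. g s u) \<longlongrightarrow> x u) (at_right 0)" "((\<lambda>s. (g s u - x u) / (g s r - x r)) \<longlongrightarrow> z u) (at_right 0)"
      using lv a(1) by (auto simp: leaves_def)
    have phi: "((\<lambda>s. \<phi> (g s u)) \<longlongrightarrow> D) (at_right 0)" using isCont_tendsto_compose[OF \<phi>(2) gu(1)] \<phi>(3) by simp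
    have Gr: "?G s r = g s r" for s using r a by (auto simp: lift_def)
    have GP: "?G s w = x w + \<phi> (g s u) * (g s u - x u)" if "w \<in> P" for s w
      using that \<phi>(1)[of "g s u"] sx(2) by (simp add: lift_def)
    have GU: "?G s w = g s w" if "w \<notin> P" for s w using that by (simp add: lift_def)
    show "leaves x (U \<union> P) r (\<lambda>w. if w \<in> P then D * z u else z w) \<tau> ?G"
      unfolding leaves_def Gr
    proof (intro conjI ballI)
      show "\<forall>\<^sub>F s in at_right 0. 0 < \<tau> * (g s r - x r)" using lv by (simp add: leaves_def)
      fix w assume w: "w \<in> U \<union> P"
      show "((\<lambda>s. ?G s w) \<longlongrightarrow> x w) (at_right 0)"
      proof (cases "w \<in> P")
        case True
        have "((\<lambda>s. x w + \<phi> (g s u) * (g s u - x u)) \<longlongrightarrow> x w + D * (x u - x u)) (at_right 0)"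
          by (intro tendsto_intros phi gu)
        then show ?thesis using True by (simp add: GP)
      next
        case False
        then show ?thesis using w lv by (simp add: GU leaves_def)
      qed
      show "((\<lambda>s. (?G s w - x w) / (g s r - x r)) \<longlongrightarrow> (if w \<in> P then D * z u else z w)) (at_right 0)"
      proof (cases "w \<in> P")
        case True
        have "((\<lambda>s. \<phi> (g s u) * ((g s u - x u) / (g s r - x r))) \<longlongrightarrow> D * z u) (at_right 0)"
          by (intro tendsto_intros phi gu)
        then show ?thesis using True by (simp add: GP)
      next
        case False
        then show ?thesis using w lv by (simp add: GU leaves_def)
      qed
    qed
  qed
qed

end

section \<open>Lifting loops over an attached piece\<close>

lemma first_zero:
  fixes f :: "real \<Rightarrow> real"
  assumes f: "continuous_on {0..1} f" and f0: "0 < f 0" and f1: "0 < f 1" and s0: "s0 \<in> {0..1}" "f s0 < 0"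
  obtains b where "0 < b" "b < 1" "f b = 0" "\<And>s. 0 \<le> s \<Longrightarrow> s \<le> b \<Longrightarrow> 0 \<le> f s"
proof -
  define S where "S = {0..1} \<inter> f -` {..0}"
  have "closed S" unfolding S_def by (rule continuous_closed_preimage[OF f]) auto
  moreover have "bounded S" unfolding S_def by (rule bounded_subset[of "{0..1}"]) auto
  ultimately have "compact S" by (simp add: compact_eq_bounded_closed)
  moreover have "S \<noteq> {}" using s0 by (auto simp: S_def intro!: exI[of _ s0])
  ultimately obtain b where b: "b \<in> S" "\<And>s. s \<in> S \<Longrightarrow> b \<le> s" using compact_attains_inf[of S] by blast
  have fb: "f b \<le> 0" "0 \<le> b" "b \<le> 1" using b(1) by (auto simp: S_def)
  have "continuous_on {0..b} f" by (rule continuous_on_subset[OF f]) (use fb in auto)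
  then obtain m where m: "0 \<le> m" "m \<le> b" "f m = 0" using IVT2'[of f b 0 0] fb f0 by auto
  then have "m \<in> S" using fb by (auto simp: S_def)
  then have "m = b" using b(2) m by force
  then have z: "f b = 0" using m by simp
  have pos: "0 \<le> f s" if "0 \<le> s" "s \<le> b" for s
  proof (rule ccontr)
    assume "\<not> 0 \<le> f s"
    then have "s \<in> S" using that fb by (auto simp: S_def)
    then have "s = b" using b(2)[of s] that by simp
    then show False using z \<open>\<not> 0 \<le> f s\<close> by simp
  qed
  show thesis
  proof (rule that[OF _ _ z pos])
    show "0 < b" "b < 1" using z f0 f1 fb by (auto simp: less_le)
  qed
qed

context line_data
begin

lemma is_loopD:
  assumes "is_loop E x U r z g"
  shows "r \<in> U" "w \<in> U \<Longrightarrow> path (\<lambda>s. g s w)" "w \<in> U \<Longrightarrow> g 0 w = x w" "w \<in> U \<Longrightarrow> g 1 w = x w"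
    "0 \<le> s \<Longrightarrow> s \<le> 1 \<Longrightarrow> \<forall>(u, v)\<in>induced E U. Q (g s) u v = Q x u v \<and> (l u = l v \<longrightarrow> g s u - g s v = x u - x v)"
    "0 < s \<Longrightarrow> s < 1 \<Longrightarrow> \<exists>w\<in>U. g s w \<noteq> x w"
    "leaves x U r z 1 g" "leaves x U r z (-1) (reversepath g)"
  using assms unfolding is_loop_def by (simp_all add: greaterThanLessThan_iff)

lemma attachD:
  assumes "attach E U P u v"
  shows "u \<in> U" "v \<in> P" "U \<inter> P = {}" "l u \<in> I" "l v \<in> I" "l u \<noteq> l v"
  using assms by (simp_all add: attach_def)

lemma lift_on:
  assumes "attach E U P u v" "w \<in> U"
  shows "lift x P u v \<sigma> y w = y w"
  using attachD(3)[OF assms(1)] assms(2) by (auto simp: lift_def)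

lemma lift_x:
  assumes at: "attach E U P u v" and nz: "H x v u \<noteq> 0" and y: "\<And>w. w \<in> U \<Longrightarrow> y w = x w" and w: "w \<in> U \<union> P"
  shows "lift x P u v (sgn (H x v u)) y w = x w"
  using sheet_x(2)[OF attachD(4,5)[OF at] nz] y[of w] y[OF attachD(1)[OF at]] w by (auto simp: lift_def)

lemma loop_lift:
  assumes lp: "is_loop E x U r z g" and at: "attach E U P u v" and nz: "H x v u \<noteq> 0"
    and d: "\<And>s. 0 \<le> s \<Longrightarrow> s \<le> 1 \<Longrightarrow> 0 \<le> disc x u v (g s u)"
  shows "\<exists>z'. is_loop E x (U \<union> P) r z' (\<lambda>s. lift x P u v (sgn (H x v u)) (g s))"
proof -
  let ?\<sigma> = "sgn (H x v u)"
  have sg: "?\<sigma> = 1 \<or> ?\<sigma> = -1" using nz by (auto simp: sgn_if)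
  note L = is_loopD[OF lp]
  from lift_leaves[OF at L(1) nz, of z]
  obtain z' where z': "\<And>\<tau> g. leaves x U r z \<tau> g \<Longrightarrow> leaves x (U \<union> P) r z' \<tau> (\<lambda>s. lift x P u v ?\<sigma> (g s))"
    by blast
  have rev: "reversepath (\<lambda>s. lift x P u v ?\<sigma> (g s)) = (\<lambda>s. lift x P u v ?\<sigma> (reversepath g s))"
    by (simp add: reversepath_def)
  have "is_loop E x (U \<union> P) r z' (\<lambda>s. lift x P u v ?\<sigma> (g s))"
    unfolding is_loop_def rev
  proof (intro conjI ballI)
    show "r \<in> U \<union> P" using L(1) by simp
    show "leaves x (U \<union> P) r z' 1 (\<lambda>s. lift x P u v ?\<sigma> (g s))" by (rule z'[OF L(7)])
    show "leaves x (U \<union> P) r z' (-1) (\<lambda>s. lift x P u v ?\<sigma> (reversepath g s))" by (rule z'[OF L(8)])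
  next
    fix w assume w: "w \<in> U \<union> P"
    show "path (\<lambda>s. lift x P u v ?\<sigma> (g s) w)" by (rule lift_path[OF at L(2) w])
    show "lift x P u v ?\<sigma> (g 0) w = x w" by (rule lift_x[OF at nz L(3) w])
    show "lift x P u v ?\<sigma> (g 1) w = x w" by (rule lift_x[OF at nz L(4) w])
  next
    fix s p assume s: "s \<in> {0..1::real}" and p: "p \<in> induced E (U \<union> P)"
    have s': "0 \<le> s" "s \<le> 1" using s by auto
    from bspec[OF lift_Q[OF at d[OF s'] sg L(5)[OF s']] p]
    show "case p of (u', v') \<Rightarrow> Q (lift x P u v ?\<sigma> (g s)) u' v' = Q x u' v' \<and>
      (l u' = l v' \<longrightarrow> lift x P u v ?\<sigma> (g s) u' - lift x P u v ?\<sigma> (g s) v' = x u' - x v')" .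
  next
    fix s assume s: "s \<in> {0<..<1::real}"
    then obtain w where "w \<in> U" "g s w \<noteq> x w" using L(6)[of s] by auto
    then show "\<exists>w\<in>U \<union> P. lift x P u v ?\<sigma> (g s) w \<noteq> x w" using lift_on[OF at] by (intro bexI[of _ w]) auto
  qed
  then show ?thesis by blast
qed

text \<open>Two arcs leaving \<open>x\<close> in opposite directions, each up to a point where the two sheets over it meet,
  give a loop through \<open>x\<close>: go out on one sheet, come back on the other, and likewise for the other arc.\<close>

lemma back_and_forth:
  assumes at: "attach E U P u v" and nz: "H x v u \<noteq> 0" and r: "r \<in> U"
    and path: "\<And>i w. i < 2 \<Longrightarrow> w \<in> U \<Longrightarrow> path (\<lambda>s. c' i s w)"
    and start: "\<And>i w. i < 2 \<Longrightarrow> w \<in> U \<Longrightarrow> c' i 0 w = x w"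
    and Qc: "\<And>i s. i < 2 \<Longrightarrow> 0 \<le> s \<Longrightarrow> s \<le> 1 \<Longrightarrow>
      \<forall>(u, v)\<in>induced E U. Q (c' i s) u v = Q x u v \<and> (l u = l v \<longrightarrow> c' i s u - c' i s v = x u - x v)"
    and d: "\<And>i s. i < 2 \<Longrightarrow> 0 \<le> s \<Longrightarrow> s \<le> 1 \<Longrightarrow> 0 \<le> disc x u v (c' i s u)"
    and d1: "\<And>i. i < 2 \<Longrightarrow> disc x u v (c' i 1 u) = 0"
    and av: "\<And>i s. i < 2 \<Longrightarrow> 0 < s \<Longrightarrow> s \<le> 1 \<Longrightarrow> \<exists>w\<in>U. c' i s w \<noteq> x w"
    and lv: "leaves x U r z 1 (c' 0)" "leaves x U r z (-1) (c' (1::nat))"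
  obtains z' g' where "is_loop E x (U \<union> P) r z' g'"
    "\<And>x'. (\<exists>w\<in>U. x w \<noteq> x' w) \<Longrightarrow> (\<And>i s. i < 2 \<Longrightarrow> 0 < s \<Longrightarrow> s \<le> 1 \<Longrightarrow> \<exists>w\<in>U. c' i s w \<noteq> x' w) \<Longrightarrow>
      (\<And>s. 0 < s \<Longrightarrow> s < 1 \<Longrightarrow> \<exists>w\<in>U \<union> P. g' s w \<noteq> x' w)"
proof -
  define \<sigma> where "\<sigma> = sgn (H x v u)"
  have sg: "\<sigma> = 1 \<or> \<sigma> = -1" "- \<sigma> = 1 \<or> - \<sigma> = -1" using nz by (auto simp: \<sigma>_def sgn_if)
  define a where "a i \<tau> s = lift x P u v \<tau> (c' i s)" for i \<tau> s
  define b where "b i \<tau> = reversepath (a i \<tau>)" for i \<tau>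
  \<comment> \<open>Arc 0 is run out on the sheet of \<open>x\<close> and back on the other one, arc
    1 out on the other sheet and back on that of \<open>x\<close>. In the middle the loop lies over
    \<open>x\<close> but on the wrong sheet, hence not at \<open>x\<close>.\<close>
  define f1 where "f1 = a 0 \<sigma> +++ b 0 (- \<sigma>)"
  define f2 where "f2 = a 1 (- \<sigma>) +++ b 1 \<sigma>"
  define g' where "g' = f1 +++ f2"
  have pa: "path (\<lambda>s. a i \<tau> s w)" if "i < 2" "w \<in> U \<union> P" for i \<tau> w
    unfolding a_def by (rule lift_path[OF at path[OF that(1)] that(2)])
  have pb: "path (\<lambda>s. b i \<tau> s w)" if "i < 2" "w \<in> U \<union> P" for i \<tau> w
  proof -
    have "(\<lambda>s. b i \<tau> s w) = reversepath (\<lambda>s. a i \<tau> s w)" by (simp add: b_def reversepath_def)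
    then show ?thesis using pa[OF that] by simp
  qed
  have a0: "a i \<sigma> 0 w = x w" if "i < 2" "w \<in> U \<union> P" for i w
    unfolding a_def \<sigma>_def by (rule lift_x[OF at nz start[OF that(1)] that(2)])
  have a0': "a 0 (- \<sigma>) 0 w = a 1 (- \<sigma>) 0 w" if "w \<in> U \<union> P" for w
    using that start[of 0 w] start[of 1 w] start[OF _ attachD(1)[OF at], of 0]
      start[OF _ attachD(1)[OF at], of 1] by (auto simp: a_def lift_def)
  have a1: "a i \<tau> 1 w = a i \<tau>' 1 w" if "i < 2" for i \<tau> \<tau>' w
    using d1[OF that] by (simp add: a_def lift_def sheet_def)
  have b01: "b i \<tau> 0 = a i \<tau> 1" "b i \<tau> 1 = a i \<tau> 0" for i \<tau> by (simp_all add: b_def reversepath_def)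
  have ends: "f1 0 = a 0 \<sigma> 0" "f1 1 = b 0 (- \<sigma>) 1" "f2 0 = a 1 (- \<sigma>) 0" "f2 1 = b 1 \<sigma> 1" "g' 0 = f1 0" "g' 1 = f2 1"
    by (simp_all add: f1_def f2_def g'_def joinpaths_def)
  have pf1: "path (\<lambda>s. f1 s w)" if "w \<in> U \<union> P" for w
    unfolding f1_def using that a1[of 0 \<sigma> w "- \<sigma>"] by (intro path_coord_join pa pb) (auto simp: b01)
  have pf2: "path (\<lambda>s. f2 s w)" if "w \<in> U \<union> P" for w
    unfolding f2_def using that a1[of 1 \<sigma> w "- \<sigma>"] by (intro path_coord_join pa pb) (auto simp: b01)
  have pg: "path (\<lambda>s. g' s w)" if "w \<in> U \<union> P" for w
    unfolding g'_def
    by (rule path_coord_join[where f = f1 and g = f2 and w = w, OF pf1[OF that] pf2[OF that]])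
      (simp add: ends b01 a0'[OF that])
  \<comment> \<open>Each quarter of the interval runs through one of the four arcs. By the last
    clause an interior time is either away from the start of its arc or on the other sheet.\<close>
  have pieces: "\<exists>i \<tau> t. i < 2 \<and> (\<tau> = \<sigma> \<or> \<tau> = - \<sigma>) \<and> 0 \<le> t \<and> t \<le> 1 \<and> g' s = a i \<tau> t \<and>
      (0 < s \<and> s < 1 \<longrightarrow> 0 < t \<or> \<tau> = - \<sigma>)" if s: "0 \<le> s" "s \<le> 1" for s
  proof (cases "s \<le> 1/2")
    case 1: True
    show ?thesis
    proof (cases "s \<le> 1/4")
      case True
      then have "g' s = a 0 \<sigma> (4 * s)" using 1 by (simp add: g'_def f1_def joinpaths_def)
      then show ?thesis using True s by (intro exI[of _ 0] exI[of _ \<sigma>] exI[of _ "4 * s"]) auto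
    next
      case False
      then have "g' s = a 0 (- \<sigma>) (2 - 4 * s)" using 1 by (simp add: g'_def f1_def b_def joinpaths_def reversepath_def)
      then show ?thesis using False 1 by (intro exI[of _ 0] exI[of _ "- \<sigma>"] exI[of _ "2 - 4 * s"]) auto
    qed
  next
    case 1: False
    show ?thesis
    proof (cases "s \<le> 3/4")
      case True
      then have "g' s = a 1 (- \<sigma>) (4 * s - 2)" using 1 by (simp add: g'_def f2_def joinpaths_def)
      then show ?thesis using True 1 by (intro exI[of _ 1] exI[of _ "- \<sigma>"] exI[of _ "4 * s - 2"]) auto
    next
      case False
      then have "g' s = a 1 \<sigma> (4 - 4 * s)" using 1 by (simp add: g'_def f2_def b_def joinpaths_def reversepath_def)
      then show ?thesis using False s by (intro exI[of _ 1] exI[of _ \<sigma>] exI[of _ "4 - 4 * s"]) auto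
    qed
  qed
  from lift_leaves[OF at r nz, of z]
  obtain z' where z': "\<And>\<tau> g. leaves x U r z \<tau> g \<Longrightarrow> leaves x (U \<union> P) r z' \<tau> (\<lambda>s. lift x P u v \<sigma> (g s))"
    unfolding \<sigma>_def by blast
  have "is_loop E x (U \<union> P) r z' g'"
    unfolding is_loop_def
  proof (intro conjI ballI)
    show "r \<in> U \<union> P" using r by simp
    have "leaves x (U \<union> P) r z' 1 (a 0 \<sigma>)" unfolding a_def by (rule z'[OF lv(1)])
    then show "leaves x (U \<union> P) r z' 1 g'" unfolding g'_def f1_def by (intro leaves_join)
    have "leaves x (U \<union> P) r z' (-1) (reversepath (b 1 \<sigma>))"
      unfolding b_def reversepath_reversepath a_def by (rule z'[OF lv(2)])
    then show "leaves x (U \<union> P) r z' (-1) (reversepath g')" unfolding g'_def f2_def by (intro leaves_reverse_join)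
  next
    fix w assume w: "w \<in> U \<union> P"
    show "path (\<lambda>s. g' s w)" by (rule pg[OF w])
    show "g' 0 w = x w" "g' 1 w = x w" using a0[OF _ w] by (simp_all add: ends b01)
  next
    fix s p assume s: "s \<in> {0..1::real}" and p: "p \<in> induced E (U \<union> P)"
    have s': "0 \<le> s" "s \<le> 1" using s by auto
    obtain i \<tau> t where t: "i < 2" "\<tau> = \<sigma> \<or> \<tau> = - \<sigma>" "0 \<le> t" "t \<le> 1" "g' s = a i \<tau> t"
      using pieces[OF s'] by blast
    have "\<tau> = 1 \<or> \<tau> = -1" using t(2) sg by auto
    from bspec[OF lift_Q[OF at d[OF t(1,3,4)] this Qc[OF t(1,3,4)]] p]
    show "case p of (u', v') \<Rightarrow> Q (g' s) u' v' = Q x u' v' \<and> (l u' = l v' \<longrightarrow> g' s u' - g' s v' = x u' - x v')"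
      unfolding t(5) a_def .
  next
    fix s assume "s \<in> {0<..<1::real}"
    then have s: "0 \<le> s" "s \<le> 1" "0 < s" "s < 1" by auto
    obtain i \<tau> t where t: "i < 2" "0 \<le> t" "t \<le> 1" "g' s = a i \<tau> t" "0 < t \<or> \<tau> = - \<sigma>"
      using pieces[OF s(1,2)] s by blast
    show "\<exists>w\<in>U \<union> P. g' s w \<noteq> x w"
    proof (cases "0 < t")
      case True
      then obtain w where "w \<in> U" "c' i t w \<noteq> x w" using av[OF t(1) True t(3)] by blast
      then show ?thesis unfolding t(4) a_def using lift_on[OF at] by (intro bexI[of _ w]) auto
    next
      case False
      then have "t = 0" "\<tau> = - \<sigma>" using t by auto
      then have "g' s v \<noteq> x v"
        using sheet_x(3)[OF attachD(4,5)[OF at] nz] start[OF t(1) attachD(1)[OF at]] attachD(2)[OF at]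
        by (simp add: t(4) a_def lift_def \<sigma>_def)
      then show ?thesis using attachD(2)[OF at] by blast
    qed
  qed
  moreover have "\<exists>w\<in>U \<union> P. g' s w \<noteq> x' w"
    if x': "\<exists>w\<in>U. x w \<noteq> x' w" "\<And>i s. i < 2 \<Longrightarrow> 0 < s \<Longrightarrow> s \<le> 1 \<Longrightarrow> \<exists>w\<in>U. c' i s w \<noteq> x' w"
      and s: "0 < s" "s < 1" for x' s
  proof -
    obtain i \<tau> t where t: "i < 2" "0 \<le> t" "t \<le> 1" "g' s = a i \<tau> t" using pieces[of s] s by auto
    have "\<exists>w\<in>U. c' i t w \<noteq> x' w"
    proof (cases "t = 0")
      case True
      then show ?thesis using x'(1) start[OF t(1)] by auto
    next
      case False
      then show ?thesis using x'(2)[OF t(1) _ t(3)] t(2) by simp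
    qed
    then obtain w where "w \<in> U" "c' i t w \<noteq> x' w" by blast
    then show ?thesis unfolding t(4) a_def using lift_on[OF at] by (intro bexI[of _ w]) auto
  qed
  ultimately show thesis by (rule that)
qed

text \<open>If the discriminant stays nonnegative along \<open>g\<close>, the loop lifts to one
  sheet. Otherwise it is cut at the first and the last zero of the discriminant, where the sheets
  meet, and the two outer arcs are doubled. The second conclusion ensures that a configuration
  avoided at an early stage is avoided to the end.\<close>

lemma loop_step:
  assumes lp: "is_loop E x U r z g" and at: "attach E U P u v" and nz: "H x v u \<noteq> 0"
  obtains z' g' where "is_loop E x (U \<union> P) r z' g'"
    "\<And>x'. (\<exists>w\<in>U. x w \<noteq> x' w) \<Longrightarrow> (\<And>s. 0 < s \<Longrightarrow> s < 1 \<Longrightarrow> \<exists>w\<in>U. g s w \<noteq> x' w) \<Longrightarrow>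
      (\<And>s. 0 < s \<Longrightarrow> s < 1 \<Longrightarrow> \<exists>w\<in>U \<union> P. g' s w \<noteq> x' w)"
proof (cases "\<forall>s\<in>{0..1}. 0 \<le> disc x u v (g s u)")
  case True
  then obtain z' where 1: "is_loop E x (U \<union> P) r z' (\<lambda>s. lift x P u v (sgn (H x v u)) (g s))"
    using loop_lift[OF lp at nz] by auto
  show thesis
  proof (rule that[OF 1])
    fix x' s
    assume "\<And>s. 0 < s \<Longrightarrow> s < 1 \<Longrightarrow> \<exists>w\<in>U. g s w \<noteq> x' w" and s: "0 < s" "s < (1::real)"
    then obtain w where "w \<in> U" "g s w \<noteq> x' w" by blast
    then show "\<exists>w\<in>U \<union> P. lift x P u v (sgn (H x v u)) (g s) w \<noteq> x' w"
      using lift_on[OF at] by (intro bexI[of _ w]) auto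
  qed
next
  case False
  then obtain s0 where s0: "s0 \<in> {0..1}" "disc x u v (g s0 u) < 0" by (auto simp: not_le)
  note L = is_loopD[OF lp]
  note uU = attachD(1)[OF at]
  define f where "f s = disc x u v (g s u)" for s
  have cf: "continuous_on {0..1} f"
    unfolding f_def disc_def using L(2)[OF uU] by (intro continuous_intros) (simp add: path_def)
  have f01: "0 < f 0" "0 < f 1"
    using sheet_x(1)[OF attachD(4,5)[OF at] nz] L(3,4)[OF uU] by (simp_all add: f_def)
  obtain b where b: "0 < b" "b < 1" "f b = 0" "\<And>s. 0 \<le> s \<Longrightarrow> s \<le> b \<Longrightarrow> 0 \<le> f s"
    by (rule first_zero[OF cf f01 s0(1)]) (use s0 in \<open>auto simp: f_def\<close>)
  have cf': "continuous_on {0..1} (\<lambda>s. f (1 - s))"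
    by (rule continuous_on_compose2[OF cf]) (auto intro!: continuous_intros)
  obtain a where a: "0 < a" "a < 1" "f (1 - a) = 0" "\<And>s. 0 \<le> s \<Longrightarrow> s \<le> a \<Longrightarrow> 0 \<le> f (1 - s)"
    by (rule first_zero[OF cf' _ _ , of "1 - s0"]) (use s0 f01 in \<open>auto simp: f_def\<close>)
  \<comment> \<open>Arc 0 is the loop up to time \<open>b\<close>, arc 1 the loop run backwards from
    its end for time \<open>a\<close>.\<close>
  define \<phi> where "\<phi> i s = (if i = 0 then b * s else 1 - a * s)" for i :: nat and s
  have \<phi>01: "0 \<le> \<phi> i s \<and> \<phi> i s \<le> 1" if "0 \<le> s" "s \<le> 1" for i s
    using a b that mult_le_one[of b s] mult_le_one[of a s] by (auto simp: \<phi>_def)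
  have \<phi>in: "0 < \<phi> i s \<and> \<phi> i s < 1" if "0 < s" "s \<le> 1" for i s
  proof -
    have "b * s < 1" "a * s < 1" using a b that by (metis mult_less_le_imp_less mult.right_neutral less_imp_le)+
    then show ?thesis using a b that by (auto simp: \<phi>_def)
  qed
  have c\<phi>: "continuous_on {0..1} (\<phi> i)" for i
    unfolding \<phi>_def by (cases "i = 0") (auto intro!: continuous_intros)
  have lv: "leaves x U r z 1 (\<lambda>s. g (\<phi> 0 s))" "leaves x U r z (-1) (\<lambda>s. g (\<phi> 1 s))"
    using leaves_scale[OF L(7) b(1)] leaves_scale[OF L(8) a(1)] by (simp_all add: \<phi>_def reversepath_def)
  show thesis
  proof (rule back_and_forth[OF at nz L(1), of "\<lambda>i s. g (\<phi> i s)", OF _ _ _ _ _ _ lv])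
    fix i w assume "w \<in> U"
    show "path (\<lambda>s. g (\<phi> i s) w)"
      unfolding path_def
      by (rule continuous_on_compose2[OF L(2)[OF \<open>w \<in> U\<close>, unfolded path_def] c\<phi>]) (use \<phi>01 in auto)
    show "g (\<phi> i 0) w = x w" using L(3,4)[OF \<open>w \<in> U\<close>] by (simp add: \<phi>_def)
  next
    fix i s assume s: "0 \<le> s" "s \<le> (1::real)"
    show "\<forall>(u, v)\<in>induced E U. Q (g (\<phi> i s)) u v = Q x u v \<and> (l u = l v \<longrightarrow> g (\<phi> i s) u - g (\<phi> i s) v = x u - x v)"
      by (rule L(5)) (use \<phi>01[OF s] in auto)
    show "0 \<le> disc x u v (g (\<phi> i s) u)"
      using b(4)[of "b * s"] a(4)[of "a * s"] a(1) b(1) s by (simp add: f_def[symmetric] \<phi>_def mult_left_le)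
  next
    fix i show "disc x u v (g (\<phi> i 1) u) = 0" using a(3) b(3) by (simp add: f_def[symmetric] \<phi>_def)
  next
    fix i s assume "0 < s" "s \<le> (1::real)"
    then show "\<exists>w\<in>U. g (\<phi> i s) w \<noteq> x w" using L(6) \<phi>in by blast
  next
    fix z' g'
    assume 1: "is_loop E x (U \<union> P) r z' g'"
      and 2: "\<And>x' s. \<exists>w\<in>U. x w \<noteq> x' w \<Longrightarrow>
        (\<And>i s. i < 2 \<Longrightarrow> 0 < s \<Longrightarrow> s \<le> 1 \<Longrightarrow> \<exists>w\<in>U. g (\<phi> i s) w \<noteq> x' w) \<Longrightarrow> 0 < s \<Longrightarrow> s < 1 \<Longrightarrow> \<exists>w\<in>U \<union> P. g' s w \<noteq> x' w"
    show thesis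
    proof (rule that[OF 1])
      fix x' s
      assume x': "\<exists>w\<in>U. x w \<noteq> x' w" "\<And>s. 0 < s \<Longrightarrow> s < 1 \<Longrightarrow> \<exists>w\<in>U. g s w \<noteq> x' w" and s: "0 < s" "s < (1::real)"
      have "\<exists>w\<in>U. g (\<phi> i t) w \<noteq> x' w" if "0 < t" "t \<le> 1" for i t
        using x'(2)[of "\<phi> i t"] \<phi>in[OF that, of i] by blast
      then show "\<exists>w\<in>U \<union> P. g' s w \<noteq> x' w" using 2[OF x'(1) _ s] by blast
    qed
  qed
qed

text \<open>A set \<open>U\<close> without cross edges can be translated as a whole. The
  discriminant is \<open>m - dt * (t - e)\<^sup>2\<close>, nonnegative exactly when \<open>t\<close>
  is within \<open>R\<close> of \<open>e\<close>, so straight motions of \<open>r\<close> to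
  \<open>e + R\<close> and \<open>e - R\<close> are the two arcs.\<close>

lemma loop_base:
  assumes at: "attach E U P r v" and nz: "H x v r \<noteq> 0"
    and inl: "\<And>s t. (s, t) \<in> induced E U \<Longrightarrow> l s = l t \<and> l s \<in> I"
  obtains z g where "is_loop E x (U \<union> P) r z g"
proof -
  note a = attachD[OF at]
  define dt m e where "dt = A (l r) * A (l v) - B (l r) (l v) * B (l r) (l v)"
    and "m = A (l v) * (Q x r v - F (l r) (l v))" and "e = c (l r) (l v)"
  have dt: "0 < dt" using CS[OF a(4-6)] by (simp add: dt_def)
  have disc: "disc x r v t = m - dt * (t - e)\<^sup>2" for t by (simp add: disc_def dt_def m_def e_def)
  define R where "R = sqrt (m / dt)"
  have dpos: "0 < m - dt * (x r - e)\<^sup>2" using sheet_x(1)[OF a(4,5) nz] by (simp add: disc)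
  then have "(x r - e)\<^sup>2 < m / dt" using dt by (simp add: field_simps)
  then have xR: "\<bar>x r - e\<bar> < R" unfolding R_def using real_sqrt_less_mono by fastforce
  have RR: "dt * R\<^sup>2 = m"
  proof -
    have "0 \<le> m / dt" using \<open>(x r - e)\<^sup>2 < m / dt\<close> by (meson less_imp_le order_trans zero_le_power2)
    then show ?thesis using dt by (simp add: R_def)
  qed
  define T where "T i = (if i = 0 then e + R else e - R)" for i :: nat
  define c' where "c' i s w = x w + s * (T i - x r)" for i s w
  have Tx: "0 < T 0 - x r" "T 1 - x r < 0" using xR by (auto simp: T_def)
  have cr: "c' i s r - e = (1 - s) * (x r - e) + s * (T i - e)" for i s by (simp add: c'_def algebra_simps)
  have abs_c: "\<bar>c' i s r - e\<bar> \<le> R" if "0 \<le> s" "s \<le> 1" for i s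
  proof -
    have "\<bar>c' i s r - e\<bar> \<le> (1 - s) * \<bar>x r - e\<bar> + s * \<bar>T i - e\<bar>"
      unfolding cr using that by (metis abs_mult abs_of_nonneg abs_triangle_ineq diff_ge_0_iff_ge)
    also have "\<dots> \<le> (1 - s) * R + s * R"
      by (intro add_mono mult_left_mono) (use that xR in \<open>auto simp: T_def\<close>)
    finally show ?thesis by (simp add: algebra_simps)
  qed
  have lv: "leaves x U r (\<lambda>_. 1) \<tau> (c' i)" if "0 < \<tau> * (T i - x r)" for \<tau> i
    unfolding leaves_def
  proof (intro conjI ballI)
    have "0 < \<tau> * (c' i s r - x r)" if "0 < s" for s
    proof -
      have "0 < s * (\<tau> * (T i - x r))" using \<open>0 < \<tau> * (T i - x r)\<close> that by (rule mult_pos_pos[rotated])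
      then show ?thesis by (simp add: c'_def mult.left_commute)
    qed
    then show "\<forall>\<^sub>F s in at_right 0. 0 < \<tau> * (c' i s r - x r)" by (auto intro!: eventually_at_right_0[of 1])
    fix w
    have "((\<lambda>s. c' i s w) \<longlongrightarrow> x w + 0 * (T i - x r)) (at_right 0)"
      unfolding c'_def by (intro tendsto_intros)
    then show "((\<lambda>s. c' i s w) \<longlongrightarrow> x w) (at_right 0)" by simp
    have "\<forall>\<^sub>F s in at_right 0. 1 = (c' i s w - x w) / (c' i s r - x r)"
      by (rule eventually_at_right_0[of 1]) (use that in \<open>auto simp: c'_def\<close>)
    then show "((\<lambda>s. (c' i s w - x w) / (c' i s r - x r)) \<longlongrightarrow> 1) (at_right 0)"
      by (rule Lim_transform_eventually[OF tendsto_const])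
  qed
  have i2: "i = 0 \<or> i = 1" if "i < (2::nat)" for i using that by auto
  show thesis
  proof (rule back_and_forth[OF at nz a(1), of c', OF _ _ _ _ _ _ lv lv])
    show "0 < 1 * (T 0 - x r)" "0 < - 1 * (T 1 - x r)" using Tx by auto
  next
    fix i w show "path (\<lambda>s. c' i s w)" unfolding path_def c'_def by (intro continuous_intros)
    show "c' i 0 w = x w" by (simp add: c'_def)
  next
    fix i s assume s: "0 \<le> s" "s \<le> (1::real)"
    show "\<forall>(u, v)\<in>induced E U. Q (c' i s) u v = Q x u v \<and> (l u = l v \<longrightarrow> c' i s u - c' i s v = x u - x v)"
    proof (intro ballI, clarify)
      fix p q assume "(p, q) \<in> induced E U"
      then have pq: "l p = l q" "l p \<in> I" using inl by blast+
      have "c' i s p - c' i s q = x p - x q" by (simp add: c'_def)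
      then show "Q (c' i s) p q = Q x p q \<and> (l p = l q \<longrightarrow> c' i s p - c' i s q = x p - x q)"
        unfolding same_line_Q(1)[OF pq] by simp
    qed
    have "(c' i s r - e)\<^sup>2 \<le> R\<^sup>2" using abs_c[OF s] by (metis abs_ge_zero power2_abs power_mono)
    then show "0 \<le> disc x r v (c' i s r)" unfolding disc RR[symmetric] using dt by simp
  next
    fix i
    have "(c' i 1 r - e)\<^sup>2 = R\<^sup>2" by (simp add: c'_def T_def)
    then show "disc x r v (c' i 1 r) = 0" by (simp add: disc RR)
  next
    fix i s assume "i < (2::nat)" "0 < s" "s \<le> (1::real)"
    then have "c' i s r \<noteq> x r" using Tx i2[of i] by (auto simp: c'_def)
    then show "\<exists>w\<in>U. c' i s w \<noteq> x w" using a(1) by blast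
  next
    fix z' g' assume "is_loop E x (U \<union> P) r z' g'"
    then show thesis by (rule that)
  qed
qed

end

lemma path_leaves_set:
  assumes "(a, b) \<in> R\<^sup>*" "a \<in> S" "b \<notin> S"
  obtains u v where "(u, v) \<in> R" "u \<in> S" "v \<notin> S"
  using assms
proof (induction rule: rtrancl_induct)
  case (step y z)
  then show ?case by (cases "y \<in> S") auto
qed simp

context line_data
begin

section \<open>Loops in graphs whose cross edges are all bridges\<close>

definition inline :: "('v \<times> 'v) set \<Rightarrow> ('v \<times> 'v) set" where
  "inline E = {(s, t) \<in> E. l s = l t}"

definition inline_closed :: "('v \<times> 'v) set \<Rightarrow> 'v set \<Rightarrow> bool" where
  "inline_closed E U \<longleftrightarrow> (\<forall>(s, t)\<in>inline E. s \<in> U \<longleftrightarrow> t \<in> U)"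

definition inline_class :: "('v \<times> 'v) set \<Rightarrow> 'v \<Rightarrow> 'v set" where
  "inline_class E v = (inline E)\<^sup>* `` {v}"

lemma sym_inline: "sym E \<Longrightarrow> sym (inline E)"
  by (auto simp: inline_def sym_def)

lemma inline_class_line: "w \<in> inline_class E v \<Longrightarrow> l w = l v"
proof -
  assume "w \<in> inline_class E v"
  then have "(v, w) \<in> (inline E)\<^sup>*" by (simp add: inline_class_def)
  then show ?thesis by (induction rule: rtrancl_induct) (auto simp: inline_def)
qed

lemma inline_class_self: "v \<in> inline_class E v"
  by (simp add: inline_class_def)

lemma inline_class_closed:
  assumes "sym E"
  shows "inline_closed E (inline_class E v)"
proof -
  have "t \<in> inline_class E v" if "(s, t) \<in> inline E" "s \<in> inline_class E v" for s t
    using that by (auto simp: inline_class_def)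
  moreover have "(t, s) \<in> inline E" if "(s, t) \<in> inline E" for s t
    using sym_inline[OF assms] that by (auto dest: symD)
  ultimately show ?thesis unfolding inline_closed_def by blast
qed

lemma inline_class_subset: "E \<subseteq> W \<times> W \<Longrightarrow> v \<in> W \<Longrightarrow> inline_class E v \<subseteq> W"
proof
  fix w assume "E \<subseteq> W \<times> W" "v \<in> W" "w \<in> inline_class E v"
  then have "(v, w) \<in> (inline E)\<^sup>*" by (simp add: inline_class_def)
  then show "w \<in> W" using \<open>v \<in> W\<close> \<open>E \<subseteq> W \<times> W\<close> by (cases rule: rtranclE) (auto simp: inline_def)
qed

lemma inline_closed_Un: "inline_closed E U \<Longrightarrow> inline_closed E P \<Longrightarrow> inline_closed E (U \<union> P)"
  unfolding inline_closed_def by fast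

lemma inline_closed_disjoint:
  assumes "inline_closed E U" "v \<notin> U"
  shows "U \<inter> inline_class E v = {}"
proof -
  have "w \<notin> U" if "w \<in> inline_class E v" for w
  proof -
    have "(v, w) \<in> (inline E)\<^sup>*" using that by (simp add: inline_class_def)
    then show ?thesis using assms by (induction rule: rtrancl_induct) (auto simp: inline_closed_def)
  qed
  then show ?thesis by blast
qed

lemma inline_class_conn: "(inline E)\<^sup>* \<inter> {v} \<times> UNIV \<subseteq> (induced (inline E) (inline_class E v))\<^sup>*"
proof clarify
  fix w assume "(v, w) \<in> (inline E)\<^sup>*"
  then show "(v, w) \<in> (induced (inline E) (inline_class E v))\<^sup>*"
  proof (induction rule: rtrancl_induct)
    case (step y z)
    have "(v, z) \<in> (inline E)\<^sup>*" using step(1,2) by (rule rtrancl.rtrancl_into_rtrancl)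
    then have "(y, z) \<in> induced (inline E) (inline_class E v)" using step(1,2) by (auto simp: induced_def inline_class_def)
    with step.IH show ?case by (rule rtrancl.rtrancl_into_rtrancl)
  qed simp
qed

text \<open>In a graph all of whose cross edges are bridges, the vertices outside a connected union of inline
  classes can be attached class by class, each along a single cross edge.\<close>

lemma attach_inline_class:
  assumes g: "graph_on E W" and n: "\<not> nontame E"
    and U: "inline_closed E U" "conn_on (induced E U) U" "U \<subseteq> W" and uv: "(u, v) \<in> E" "u \<in> U" "v \<notin> U"
  shows "attach E U (inline_class E v) u v" "inline_closed E (U \<union> inline_class E v)"
    "conn_on (induced E (U \<union> inline_class E v)) (U \<union> inline_class E v)" "U \<union> inline_class E v \<subseteq> W"
proof -
  let ?P = "inline_class E v"
  have sym: "sym E" using graph_onD(4)[OF g] .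
  have uvW: "u \<in> W" "v \<in> W" "l u \<in> I" "l v \<in> I" "(v, u) \<in> E" using graph_onD(6)[OF g uv(1)] by auto
  have cross: "l s \<noteq> l t" if "(s, t) \<in> E" "s \<in> U" "t \<notin> U" for s t
    using that U(1) unfolding inline_closed_def inline_def by blast
  have PW: "?P \<subseteq> W" by (rule inline_class_subset[OF graph_onD(2)[OF g] uvW(2)])
  then show sub: "U \<union> ?P \<subseteq> W" using U(3) by blast
  show "inline_closed E (U \<union> ?P)" by (rule inline_closed_Un[OF U(1) inline_class_closed[OF sym]])
  have dis: "U \<inter> ?P = {}" by (rule inline_closed_disjoint[OF U(1) uv(3)])
  have vP: "(v, t) \<in> (induced (inline E) ?P)\<^sup>*" if "t \<in> ?P" for t
    using inline_class_conn[of E v] that by (auto simp: inline_class_def)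
  \<comment> \<open>A second edge between the connected sets \<open>U\<close> and
    \<open>inline_class E v\<close> would close a cycle through the cross edge
    \<open>uv\<close>.\<close>
  have only: "(s, t) = (u, v)" if st: "(s, t) \<in> E" "s \<in> U" "t \<in> ?P" for s t
  proof (rule ccontr)
    assume ne: "(s, t) \<noteq> (u, v)"
    let ?D = "delete_edge E u v"
    have "induced E U \<subseteq> ?D" using uv(3) by (auto simp: induced_def delete_edge_def)
    moreover have "(u, s) \<in> (induced E U)\<^sup>*" using U(2) uv(2) st(2) by (simp add: conn_on_def)
    ultimately have 1: "(u, s) \<in> ?D\<^sup>*" using rtrancl_mono by blast
    have "u \<notin> ?P" "s \<notin> ?P" using dis uv(2) st(2) by auto
    have 2: "(s, t) \<in> ?D" using st ne uv dis by (auto simp: delete_edge_def)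
    have "induced (inline E) ?P \<subseteq> ?D" using \<open>u \<notin> ?P\<close> by (auto simp: induced_def inline_def delete_edge_def)
    moreover have "(t, v) \<in> (induced (inline E) ?P)\<^sup>*"
      by (rule rtrancl_swap[OF sym_induced[OF sym_inline[OF sym]] vP[OF st(3)]])
    ultimately have 3: "(t, v) \<in> ?D\<^sup>*" using rtrancl_mono by blast
    have "(u, v) \<in> ?D\<^sup>*" using 1 2 3 by (meson rtrancl.rtrancl_into_rtrancl rtrancl_trans)
    then show False using n uv(1) cross[OF uv] by (auto simp: nontame_def)
  qed
  show "attach E U ?P u v"
    unfolding attach_def
  proof (intro conjI)
    show "l ` ?P \<subseteq> I" using PW graph_onD(5)[OF g] by auto
    show "\<forall>(s, t)\<in>induced E (U \<union> ?P). (s, t) \<in> induced E U \<or> s \<in> ?P \<and> t \<in> ?P \<and> l s = l t \<or> (s, t) = (u, v) \<or> (s, t) = (v, u)"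
    proof (intro ballI, clarify)
      fix s t assume st: "(s, t) \<in> induced E (U \<union> ?P)" and nU: "(s, t) \<notin> induced E U"
        and ne: "\<not> (s \<in> ?P \<and> t \<in> ?P \<and> l s = l t)" and nn: "\<not> (s = v \<and> t = u)"
      have stE: "(s, t) \<in> E" "(t, s) \<in> E" "s \<in> U \<union> ?P" "t \<in> U \<union> ?P"
        using st sym by (auto simp: induced_def dest: symD)
      have ll: "l s = l t" if "s \<in> ?P" "t \<in> ?P" using inline_class_line that by metis
      have "\<not> (s \<in> U \<and> t \<in> U)" using nU stE by (auto simp: induced_def)
      then have "s \<in> U \<and> t \<in> ?P \<or> t \<in> U \<and> s \<in> ?P" using stE ne ll by blast
      then show "s = u \<and> t = v" using only stE nn by blast
    qed
  qed (use uv uvW inline_class_self dis cross[OF uv] in auto)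
  let ?R = "induced E (U \<union> ?P)"
  have to_u: "(u, t) \<in> ?R\<^sup>*" if t: "t \<in> U \<union> ?P" for t
  proof (cases "t \<in> U")
    case True
    then have "(u, t) \<in> (induced E U)\<^sup>*" using U(2) uv(2) by (simp add: conn_on_def)
    moreover have "induced E U \<subseteq> ?R" by (auto simp: induced_def)
    ultimately show ?thesis using rtrancl_mono by blast
  next
    case False
    have "(v, t) \<in> (induced (inline E) ?P)\<^sup>*" using vP t False by blast
    moreover have "induced (inline E) ?P \<subseteq> ?R" by (auto simp: induced_def inline_def)
    ultimately have "(v, t) \<in> ?R\<^sup>*" using rtrancl_mono by blast
    moreover have "(u, v) \<in> ?R" using uv inline_class_self by (auto simp: induced_def)
    ultimately show ?thesis by (meson converse_rtrancl_into_rtrancl)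
  qed
  show "conn_on ?R (U \<union> ?P)"
    unfolding conn_on_def using to_u rtrancl_swap[OF sym_induced[OF sym]] by (meson rtrancl_trans)
qed

text \<open>Induction on the number of vertices not yet reached: connectedness supplies an edge
  leaving \<open>U\<close>, and \<open>loop_step\<close> attaches the inline class at its
  end.\<close>

lemma loop_extends:
  assumes g: "graph_on E W" and cn: "conn_on E W" and n: "\<not> nontame E" and du: "dual K W x \<Delta>"
    and lp: "is_loop E x U r z f" and U: "inline_closed E U" "conn_on (induced E U) U" "U \<subseteq> W"
  shows "\<exists>z' f'. is_loop E x W r z' f' \<and> (\<forall>x'. (\<exists>w\<in>U. x w \<noteq> x' w) \<longrightarrow> (\<forall>s\<in>{0<..<1}. \<exists>w\<in>U. f s w \<noteq> x' w) \<longrightarrow>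
      (\<forall>s\<in>{0<..<1}. \<exists>w\<in>W. f' s w \<noteq> x' w))"
  using lp U
proof (induction "card (W - U)" arbitrary: U z f rule: less_induct)
  case less
  show ?case
  proof (cases "U = W")
    case True
    then show ?thesis using less.prems(1) by blast
  next
    case False
    then obtain w where w: "w \<in> W" "w \<notin> U" using less.prems(4) by blast
    have r: "r \<in> U" by (rule is_loopD(1)[OF less.prems(1)])
    then have "(r, w) \<in> E\<^sup>*" using cn w less.prems(4) by (auto simp: conn_on_def)
    then obtain u v where uv: "(u, v) \<in> E" "u \<in> U" "v \<notin> U" by (rule path_leaves_set[OF _ r w(2)])
    note at = attach_inline_class[OF g n less.prems(2-4) uv]
    have uvW: "u \<in> W" "v \<in> W" "u \<noteq> v" "l u \<in> I" "l v \<in> I" using graph_onD(6)[OF g uv(1)] by auto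
    have nz: "H x v u \<noteq> 0" by (rule H_nz[OF du uvW(2,1) uvW(3)[symmetric] uvW(5,4)])
    let ?U = "U \<union> inline_class E v"
    obtain z1 f1 where f1: "is_loop E x ?U r z1 f1"
      "\<And>x' s. (\<exists>w\<in>U. x w \<noteq> x' w) \<Longrightarrow> (\<And>s. 0 < s \<Longrightarrow> s < 1 \<Longrightarrow> \<exists>w\<in>U. f s w \<noteq> x' w) \<Longrightarrow>
        0 < s \<Longrightarrow> s < 1 \<Longrightarrow> \<exists>w\<in>?U. f1 s w \<noteq> x' w"
    proof (rule loop_step[OF less.prems(1) at(1) nz])
      fix z' g'
      assume "is_loop E x ?U r z' g'"
        "\<And>x' s. (\<exists>w\<in>U. x w \<noteq> x' w) \<Longrightarrow> (\<And>s. 0 < s \<Longrightarrow> s < 1 \<Longrightarrow> \<exists>w\<in>U. f s w \<noteq> x' w) \<Longrightarrow>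
        0 < s \<Longrightarrow> s < 1 \<Longrightarrow> \<exists>w\<in>?U. g' s w \<noteq> x' w"
      then show thesis by (rule that)
    qed
    have "card (W - ?U) < card (W - U)"
      by (rule psubset_card_mono) (use graph_onD(1)[OF g] inline_class_self uv(3) uvW(2) in auto)
    from less.hyps[OF this f1(1) at(2-4)]
    obtain z' f' where 1: "is_loop E x W r z' f'"
      and 2: "\<And>x'. (\<exists>w\<in>?U. x w \<noteq> x' w) \<Longrightarrow> (\<forall>s\<in>{0<..<1}. \<exists>w\<in>?U. f1 s w \<noteq> x' w) \<Longrightarrow>
        (\<forall>s\<in>{0<..<1}. \<exists>w\<in>W. f' s w \<noteq> x' w)" by blast
    show ?thesis
    proof (intro exI conjI allI impI)
      show "is_loop E x W r z' f'" by (rule 1)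
      fix x' assume x': "\<exists>w\<in>U. x w \<noteq> x' w" "\<forall>s\<in>{0<..<1}. \<exists>w\<in>U. f s w \<noteq> x' w"
      show "\<forall>s\<in>{0<..<1}. \<exists>w\<in>W. f' s w \<noteq> x' w"
      proof (rule 2)
        show "\<exists>w\<in>?U. x w \<noteq> x' w" using x'(1) by blast
        show "\<forall>s\<in>{0<..<1}. \<exists>w\<in>?U. f1 s w \<noteq> x' w"
          using f1(2)[OF x'(1)] x'(2) by (simp add: greaterThanLessThan_iff)
      qed
    qed
  qed
qed

lemma initial_loop:
  assumes g: "graph_on E W" and n: "\<not> nontame E" and du: "dual K W x \<Delta>"
    and rv: "(r, v) \<in> E" "l r \<noteq> l v"
  shows "\<exists>z f. is_loop E x (inline_class E r \<union> inline_class E v) r z f"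
    "attach E (inline_class E r) (inline_class E v) r v" "inline_closed E (inline_class E r \<union> inline_class E v)"
    "conn_on (induced E (inline_class E r \<union> inline_class E v)) (inline_class E r \<union> inline_class E v)" "inline_class E r \<union> inline_class E v \<subseteq> W"
proof -
  have sym: "sym E" using graph_onD(4)[OF g] .
  have rvW: "r \<in> W" "v \<in> W" "r \<noteq> v" "l r \<in> I" "l v \<in> I" using graph_onD(6)[OF g rv(1)] by auto
  have vr: "v \<notin> inline_class E r" using inline_class_line rv(2) by metis
  have cr: "(r, t) \<in> (induced E (inline_class E r))\<^sup>*" if "t \<in> inline_class E r" for t
  proof -
    have "(r, t) \<in> (induced (inline E) (inline_class E r))\<^sup>*" using inline_class_conn[of E r] that by (auto simp: inline_class_def)
    moreover have "induced (inline E) (inline_class E r) \<subseteq> induced E (inline_class E r)" by (auto simp: induced_def inline_def)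
    ultimately show ?thesis using rtrancl_mono by blast
  qed
  have c: "conn_on (induced E (inline_class E r)) (inline_class E r)"
    unfolding conn_on_def using cr rtrancl_swap[OF sym_induced[OF sym]] by (meson rtrancl_trans)
  have sub: "inline_class E r \<subseteq> W" by (rule inline_class_subset[OF graph_onD(2)[OF g] rvW(1)])
  note at = attach_inline_class[OF g n inline_class_closed[OF sym] c sub rv(1) inline_class_self vr]
  show "attach E (inline_class E r) (inline_class E v) r v" "inline_closed E (inline_class E r \<union> inline_class E v)"
    "conn_on (induced E (inline_class E r \<union> inline_class E v)) (inline_class E r \<union> inline_class E v)" "inline_class E r \<union> inline_class E v \<subseteq> W" by (rule at)+
  have nz: "H x v r \<noteq> 0" by (rule H_nz[OF du rvW(2,1) rvW(3)[symmetric] rvW(5,4)])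
  have inl: "l s = l t \<and> l s \<in> I" if "(s, t) \<in> induced E (inline_class E r)" for s t
    using that inline_class_line[of s E r] inline_class_line[of t E r] rvW(4) by (auto simp: induced_def)
  obtain z f where "is_loop E x (inline_class E r \<union> inline_class E v) r z f" by (rule loop_base[OF at(1) nz inl])
  then show "\<exists>z f. is_loop E x (inline_class E r \<union> inline_class E v) r z f" by blast
qed

text \<open>The direction \<open>z\<close> of the loop is an infinitesimal motion of the graph
  without \<open>ab\<close>, and \<open>z r = 1\<close>. As the whole graph is rigid, the rate
  \<kappa> at which the length of \<open>ab\<close> changes along \<open>z\<close> is nonzero. The
  two ends of the loop depart from \<open>x\<close> in opposite directions, so this length has
  changed in opposite senses near them, and the intermediate value theorem applies.\<close>

lemma crossing_value:
  assumes g: "graph_on Fe W" and c: "conn_on Fe W" and n: "nontame Fe" and du: "dual K W x \<Delta>"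
    and ab: "(a, b) \<in> Fe" and lp: "is_loop (delete_edge Fe a b) x W r z f"
  obtains s where "0 < s" "s < 1" "Q (f s) a b = Q x a b"
proof -
  note L = is_loopD[OF lp]
  have abW: "a \<in> W" "b \<in> W" "a \<noteq> b" "l a \<in> I" "l b \<in> I" using graph_onD(6)[OF g ab] by auto
  note slope = leaves_Q[OF L(7)]
  have zr: "z r = 1"
  proof -
    have 1: "((\<lambda>s. (f s r - x r) / (f s r - x r)) \<longlongrightarrow> z r) (at_right 0)"
      and ev: "\<forall>\<^sub>F s in at_right 0. 0 < 1 * (f s r - x r)" using L(1,7) by (auto simp: leaves_def)
    have "((\<lambda>s. (f s r - x r) / (f s r - x r)) \<longlongrightarrow> 1) (at_right 0)"
      by (rule Lim_transform_eventually[OF tendsto_const], rule eventually_mono[OF ev]) auto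
    with 1 show ?thesis by (rule tendsto_unique[OF trivial_limit_at_right_real])
  qed
  have ev01: "\<forall>\<^sub>F s in at_right (0::real). 0 \<le> s \<and> s \<le> 1" by (rule eventually_at_right_0[of 1]) auto
  have zE: "H x u v * z u + H x v u * z v = 0" if uv: "(u, v) \<in> delete_edge Fe a b" for u v
  proof -
    have uvW: "u \<in> W" "v \<in> W" "l u \<in> I" "l v \<in> I" using graph_onD(6)[OF g, of u v] uv by (auto simp: delete_edge_def)
    have "(u, v) \<in> induced (delete_edge Fe a b) W" using uv uvW by (auto simp: induced_def)
    then have "Q (f s) u v = Q x u v" if "0 \<le> s" "s \<le> 1" for s using L(5)[OF that] by auto
    then have "((\<lambda>s. (Q (f s) u v - Q x u v) / (f s r - x r)) \<longlongrightarrow> 0) (at_right 0)"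
      by (intro Lim_transform_eventually[OF tendsto_const], intro eventually_mono[OF ev01]) auto
    then show ?thesis by (rule tendsto_unique[OF trivial_limit_at_right_real slope[OF uvW]])
  qed
  define \<kappa> where "\<kappa> = H x a b * z a + H x b a * z b"
  have "\<kappa> \<noteq> 0"
  proof
    assume k: "\<kappa> = 0"
    have "z r = 0"
    proof (rule rigid[OF du g c n _ L(1)])
      fix u v assume "(u, v) \<in> Fe"
      then consider "(u, v) \<in> delete_edge Fe a b" | "(u, v) = (a, b)" | "(u, v) = (b, a)" by (auto simp: delete_edge_def)
      then show "H x u v * z u + H x v u * z v = 0"
        using zE k by cases (auto simp: \<kappa>_def)
    qed
    then show False using zr by simp
  qed
  \<comment> \<open>With the factor \<kappa>, the sign of \<open>G\<close> near either end does not
    depend on the sign of \<kappa>.\<close>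
  define G where "G s = \<kappa> * (Q (f s) a b - Q x a b)" for s
  have pos: "\<exists>s. 0 < s \<and> s < 1/2 \<and> 0 < \<tau> * (\<kappa> * (Q (g s) a b - Q x a b))" if lv: "leaves x W r z \<tau> g" for \<tau> g
  proof -
    have "((\<lambda>s. \<kappa> * ((Q (g s) a b - Q x a b) / (g s r - x r))) \<longlongrightarrow> \<kappa> * \<kappa>) (at_right 0)"
      unfolding \<kappa>_def by (intro tendsto_intros leaves_Q[OF lv abW(1,2,4,5)])
    moreover have "0 < \<kappa> * \<kappa>" using \<open>\<kappa> \<noteq> 0\<close> by (metis not_real_square_gt_zero)
    ultimately have "\<forall>\<^sub>F s in at_right 0. 0 < \<kappa> * ((Q (g s) a b - Q x a b) / (g s r - x r))"
      by (rule order_tendstoD(1))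
    moreover have "\<forall>\<^sub>F s in at_right 0. 0 < \<tau> * (g s r - x r)" using lv by (simp add: leaves_def)
    moreover have "\<forall>\<^sub>F s in at_right (0::real). 0 < s \<and> s < 1/2" by (rule eventually_at_right_0[of "1/2"]) auto
    ultimately have "\<forall>\<^sub>F s in at_right 0. 0 < s \<and> s < 1/2 \<and> 0 < \<tau> * (\<kappa> * (Q (g s) a b - Q x a b))"
    proof eventually_elim
      case (elim s)
      then have "0 < (\<tau> * (g s r - x r)) * (\<kappa> * ((Q (g s) a b - Q x a b) / (g s r - x r)))" using mult_pos_pos by blast
      moreover have "g s r - x r \<noteq> 0" using elim by auto
      ultimately show ?case using elim by simp
    qed
    then show ?thesis using eventually_happens'[OF trivial_limit_at_right_real] by blast
  qed
  obtain s1 where s1: "0 < s1" "s1 < 1/2" "0 < G s1" using pos[OF L(7)] by (auto simp: G_def)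
  obtain s2 where s2: "0 < s2" "s2 < 1/2" "G (1 - s2) < 0" using pos[OF L(8)] by (auto simp: G_def reversepath_def)
  have "continuous_on {0..1} G"
    unfolding G_def Q_def q_def using L(2)[OF abW(1)] L(2)[OF abW(2)]
    by (intro continuous_intros) (simp_all add: path_def)
  then have "continuous_on {s1..1 - s2} G" by (rule continuous_on_subset) (use s1 s2 in auto)
  then obtain s where s: "s1 \<le> s" "s \<le> 1 - s2" "G s = 0"
    using IVT2'[of G "1 - s2" 0 s1] s1 s2 by auto
  then have "Q (f s) a b = Q x a b" using \<open>\<kappa> \<noteq> 0\<close> by (simp add: G_def)
  then show thesis using that[of s] s s1 s2 by auto
qed

text \<open>By \<open>crossing_value\<close> a loop of the graph without \<open>ab\<close> regains
  the length of \<open>ab\<close> at a point other than \<open>x\<close>. It remains to keep the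
  loop away from \<open>x'\<close>, the reflection in the common perpendicular of the lines of
  \<open>a\<close> and \<open>b\<close>, which is congruent to \<open>x\<close> if all vertices lie
  on these lines.\<close>

lemma tame_flexible:
  assumes g: "graph_on Fe W" and c: "conn_on Fe W" and du: "dual K W x \<Delta>"
    and ab: "(a, b) \<in> Fe" "l a \<noteq> l b" "(a, b) \<in> (delete_edge Fe a b)\<^sup>*" and n: "\<not> nontame (delete_edge Fe a b)"
  obtains y where "\<And>u v. (u, v) \<in> Fe \<Longrightarrow> Q y u v = Q x u v" "\<not> congruent_on x y W"
proof -
  note witness = that
  define E where "E = delete_edge Fe a b"
  have sym: "sym Fe" using graph_onD(4)[OF g] .
  have gE: "graph_on E W" using g sym_delete_edge[OF sym] by (auto simp: graph_on_def E_def delete_edge_def irrefl_def)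
  have symE: "sym E" using graph_onD(4)[OF gE] .
  have abW: "a \<in> W" "b \<in> W" "a \<noteq> b" "l a \<in> I" "l b \<in> I" using graph_onD(6)[OF g ab(1)] by auto
  have nt: "nontame Fe" using ab by (auto simp: nontame_def)
  have nE: "\<not> nontame E" using n by (simp add: E_def)
  have cE: "conn_on E W"
  proof -
    have "Fe \<subseteq> E\<^sup>*"
      using ab(3) rtrancl_swap[OF symE, of a b] by (auto simp: E_def delete_edge_def)
    then have "Fe\<^sup>* \<subseteq> E\<^sup>*" by (metis rtrancl_subset_rtrancl)
    then show ?thesis using c by (auto simp: conn_on_def)
  qed
  define x' where "x' v = (if l v = l a then 2 * c (l a) (l b) - x v else 2 * c (l b) (l a) - x v)" for v
  have refl: "y v = x' v \<and> (l v = l a \<or> l v = l b)"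
    if R: "congruent_on x y W" "\<exists>w\<in>W. y w \<noteq> x w" "v \<in> W" for y v
  proof -
    obtain i j where ij: "i \<noteq> j"
      "\<forall>v\<in>W. l v = i \<and> y v = 2 * c i j - x v \<or> l v = j \<and> y v = 2 * c j i - x v"
      using R(1,2) unfolding congruent_on_def by blast
    from bspec[OF ij(2) abW(1)] bspec[OF ij(2) abW(2)] ab(2)
    have "l a = i \<and> l b = j \<or> l a = j \<and> l b = i" by auto
    then show ?thesis using bspec[OF ij(2) R(3)] ij(1) by (auto simp: x'_def)
  qed
  have finish: thesis if lp: "is_loop E x W r z f"
    and av: "\<And>s. 0 < s \<Longrightarrow> s < 1 \<Longrightarrow> \<exists>v\<in>W. \<not> (f s v = x' v \<and> (l v = l a \<or> l v = l b))" for r z f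
  proof -
    obtain s where s: "0 < s" "s < 1" "Q (f s) a b = Q x a b"
      by (rule crossing_value[OF g c nt du ab(1) lp[unfolded E_def]])
    show thesis
    proof (rule witness[of "f s"])
      show "Q (f s) u v = Q x u v" if uv: "(u, v) \<in> Fe" for u v
      proof (cases "(u, v) \<in> E")
        case True
        then have "(u, v) \<in> induced E W" using graph_onD(6)[OF g uv] by (auto simp: induced_def)
        then show ?thesis using is_loopD(5)[OF lp, of s] s by auto
      next
        case False
        then have "(u, v) = (a, b) \<or> (u, v) = (b, a)" using uv by (auto simp: E_def delete_edge_def)
        then show ?thesis using s(3) Q_sym[OF abW(4,5)] by auto
      qed
      show "\<not> congruent_on x (f s) W"
        using refl[of "f s"] is_loopD(6)[OF lp s(1,2)] av[OF s(1,2)] by blast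
    qed
  qed
  obtain r0 v0 where r0: "(r0, v0) \<in> E" "l r0 \<noteq> l v0"
  proof -
    have "(a, b) \<in> E\<^sup>*" using ab(3) by (simp add: E_def)
    from path_label_change[OF this ab(2)] show thesis using that by blast
  qed
  show thesis
  proof (cases "(\<forall>v\<in>W. l v = l a \<or> l v = l b) \<and> inline E = {}")
    \<comment> \<open>With a vertex on a third line no reflection has to be avoided; and an inline
      edge of \<open>E\<close> is translated by the loop, while the reflection would reverse
      it.\<close>
    case False
    obtain z f where lp0: "is_loop E x (inline_class E r0 \<union> inline_class E v0) r0 z f" using initial_loop(1)[OF gE nE du r0] by blast
    from loop_extends[OF gE cE nE du lp0 initial_loop(3-5)[OF gE nE du r0]]
    obtain z' f' where lp: "is_loop E x W r0 z' f'" by blast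
    show thesis
    proof (rule finish[OF lp])
      fix s :: real assume s: "0 < s" "s < 1"
      show "\<exists>v\<in>W. \<not> (f' s v = x' v \<and> (l v = l a \<or> l v = l b))"
      proof (rule ccontr)
        assume "\<not> ?thesis"
        then have all: "\<And>v. v \<in> W \<Longrightarrow> f' s v = x' v \<and> (l v = l a \<or> l v = l b)" by blast
        then obtain u v where uv: "(u, v) \<in> E" "l u = l v" using False by (auto simp: inline_def)
        have uvW: "u \<in> W" "v \<in> W" "u \<noteq> v" using graph_onD(6)[OF gE uv(1)] by auto
        have "(u, v) \<in> induced E W" using uv uvW by (auto simp: induced_def)
        then have "f' s u - f' s v = x u - x v" using is_loopD(5)[OF lp, of s] s uv(2) by auto
        then have "x u = x v" using all uvW uv(2) by (auto simp: x'_def split: if_splits)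
        then have "\<Delta> u (x u) = \<Delta> u (x v)" by simp
        then show False using dualD(2)[OF du uvW(1)] uvW by simp
      qed
    qed
  next
    \<comment> \<open>All vertices are on two lines and every inline class is a single vertex. The
      loop is begun with edges from \<open>r\<close> to \<open>v1\<close> and to \<open>w1\<close>,
      the second being longer: over the loop of \<open>r\<close> and \<open>v1\<close> the
      discriminant for \<open>w1\<close> stays positive, so \<open>w1\<close> never changes sheet,
      whereas in \<open>x'\<close> it lies on the other sheet.\<close>
    case True
    have cl: "inline_class E v = {v}" for v using True by (simp add: inline_class_def)
    have cross: "l u \<noteq> l v" if "(u, v) \<in> E" for u v using True that by (auto simp: inline_def)
    \<comment> \<open>A path from \<open>a\<close> to \<open>b\<close> avoiding the edge
      \<open>ab\<close> has at least two edges, so some vertex has two neighbours.\<close>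
    obtain r v w where rvw: "(r, v) \<in> E" "(r, w) \<in> E" "v \<noteq> w"
    proof -
      have "(a, b) \<in> E\<^sup>*" using ab(3) by (simp add: E_def)
      then obtain u where u: "(a, u) \<in> E" "(u, b) \<in> E\<^sup>*" using abW(3) by (metis converse_rtranclE)
      have "u \<noteq> b" using u by (auto simp: E_def delete_edge_def)
      obtain p t where pt: "(p, t) \<in> E" "p \<in> {a, u}" "t \<notin> {a, u}"
        by (rule path_leaves_set[OF u(2), of "{a, u}"]) (use abW(3) \<open>u \<noteq> b\<close> in auto)
      show thesis
      proof (cases "p = a")
        case True
        then show thesis using that[of a u t] u pt by auto
      next
        case False
        moreover have "(u, a) \<in> E" using u(1) symE by (auto dest: symD)
        ultimately show thesis using that[of u a t] pt by auto
      qed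
    qed
    \<comment> \<open>If the lengths agreed, replacing \<open>x v\<close> by \<open>x w\<close>
      would preserve the length of the edge \<open>rv\<close>; differentiating that equation in
      \<open>x v\<close> gives \<open>H x v r = 0\<close>.\<close>
    have neq: "Q x r v \<noteq> Q x r w"
    proof
      assume e: "Q x r v = Q x r w"
      have W3: "r \<in> W" "v \<in> W" "w \<in> W" "r \<noteq> v" "r \<noteq> w" "l r \<in> I" "l v \<in> I" "l w \<in> I"
        using graph_onD(6)[OF gE rvw(1)] graph_onD(6)[OF gE rvw(2)] by auto
      have ll: "l v = l w" using True W3 cross[OF rvw(1)] cross[OF rvw(2)] by metis
      define y where "y = (\<lambda>t. if t = v then x w else x t)"
      have "Q y r v = Q x r v" using e ll W3(4) by (simp add: y_def Q_def)
      from derivation_Q_eq[OF dualD(1)[OF du W3(2)] W3(6,7) this]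
      have "H x v r = 0"
        using dualD(2)[OF du W3(2)] W3 rvw(3) by (simp add: y_def)
      then show False using H_nz[OF du W3(2,1) _ W3(7,6)] W3(4) by simp
    qed
    obtain v1 w1 where vw: "(r, v1) \<in> E" "(r, w1) \<in> E" "v1 \<noteq> w1" "Q x r v1 < Q x r w1"
    proof (cases "Q x r v < Q x r w")
      case True
      then show thesis using that[of v w] rvw by blast
    next
      case False
      then have "Q x r w < Q x r v" using neq by simp
      then show thesis using that[of w v] rvw by auto
    qed
    have W3: "r \<in> W" "v1 \<in> W" "w1 \<in> W" "r \<noteq> v1" "r \<noteq> w1" "l r \<in> I" "l v1 \<in> I" "l w1 \<in> I"
      using graph_onD(6)[OF gE vw(1)] graph_onD(6)[OF gE vw(2)] by auto
    have ll: "l v1 = l w1" using True W3 cross[OF vw(1)] cross[OF vw(2)] by metis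
    have label: "l r = l a \<and> l w1 = l b \<or> l r = l b \<and> l w1 = l a" using True W3 cross[OF vw(2)] by metis
    note il = initial_loop[OF gE nE du vw(1) cross[OF vw(1)], unfolded cl]
    obtain z f where lp0: "is_loop E x ({r} \<union> {v1}) r z f" using il(1) by blast
    have wn: "w1 \<notin> {r} \<union> {v1}" using vw W3 by auto
    have rU: "r \<in> {r} \<union> {v1}" by simp
    note at = attach_inline_class[OF gE nE il(3-5) vw(2) rU wn, unfolded cl]
    have nz: "H x w1 r \<noteq> 0" by (rule H_nz[OF du W3(3,1) W3(5)[symmetric] W3(8,6)])
    have dpos: "0 < disc x r w1 (f s r)" if s: "0 \<le> s" "s \<le> 1" for s
    proof -
      have "(r, v1) \<in> induced E ({r} \<union> {v1})" using vw by (auto simp: induced_def)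
      then have "Q (f s) r v1 = Q x r v1" using is_loopD(5)[OF lp0 s] by auto
      then have "0 \<le> disc x r v1 (f s r)" using disc_Q[OF W3(6,7)] by simp
      also have "\<dots> < disc x r w1 (f s r)"
        unfolding disc_def ll using vw(4) A_pos[OF W3(8)] by simp
      finally show ?thesis .
    qed
    define \<sigma> where "\<sigma> = sgn (H x w1 r)"
    obtain z1 where lp1: "is_loop E x ({r} \<union> {v1} \<union> {w1}) r z1 (\<lambda>s. lift x {w1} r w1 \<sigma> (f s))"
      using loop_lift[OF lp0 at(1) nz less_imp_le[OF dpos]] by (auto simp: \<sigma>_def)
    have av: "\<forall>s\<in>{0<..<1}. \<exists>w\<in>{r} \<union> {v1} \<union> {w1}. lift x {w1} r w1 \<sigma> (f s) w \<noteq> x' w"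
    proof (intro ballI, rule ccontr)
      fix s assume s: "s \<in> {0<..<1::real}" and "\<not> (\<exists>w\<in>{r} \<union> {v1} \<union> {w1}. lift x {w1} r w1 \<sigma> (f s) w \<noteq> x' w)"
      then have e: "lift x {w1} r w1 \<sigma> (f s) r = x' r" "lift x {w1} r w1 \<sigma> (f s) w1 = x' w1" by auto
      have fr: "f s r = 2 * c (l r) (l w1) - x r"
        using e(1) label ab(2) W3(5) by (auto simp: lift_def x'_def)
      have "sheet x r w1 \<sigma> (f s r) = 2 * c (l w1) (l r) - x w1"
        using e(2) label ab(2) by (auto simp: lift_def x'_def)
      then have "(B (l r) (l w1) * (f s r - c (l r) (l w1)) + \<sigma> * sqrt (disc x r w1 (f s r))) / A (l w1)
          = c (l w1) (l r) - x w1" by (simp add: sheet_def)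
      then have "B (l r) (l w1) * (f s r - c (l r) (l w1)) + \<sigma> * sqrt (disc x r w1 (f s r))
          = A (l w1) * (c (l w1) (l r) - x w1)" using A_pos[OF W3(8)] by (simp add: field_simps)
      then have e1: "\<sigma> * sqrt (disc x r w1 (f s r)) = - H x w1 r / 2"
        by (simp add: fr H_def h_def B_sym[OF W3(8,6)] algebra_simps)
      have e2: "0 < sqrt (disc x r w1 (f s r))" using dpos s by simp
      from nz show False
      proof (cases "0 < H x w1 r")
        case True
        then show False using e1 e2 by (simp add: \<sigma>_def del: real_sqrt_gt_0_iff)
      next
        case False
        then have "H x w1 r < 0" using nz by simp
        then show False using e1 e2 by (simp add: \<sigma>_def del: real_sqrt_gt_0_iff)
      qed
    qed
    have xx': "\<exists>w\<in>{r} \<union> {v1} \<union> {w1}. x w \<noteq> x' w"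
    proof -
      have "x r \<noteq> x' r"
      proof
        assume "x r = x' r"
        then have "x r = 2 * c (l r) (l w1) - x r" using label ab(2) by (auto simp: x'_def)
        then have "x r = c (l r) (l w1)" by simp
        then have "\<Delta> r (x r) = \<Delta> r (c (l r) (l w1))" by simp
        then show False using dualD(2)[OF du W3(1,1)] derivation_const[OF dualD(1)[OF du W3(1)] W3(6,8)] by simp
      qed
      then show ?thesis by blast
    qed
    from loop_extends[OF gE cE nE du lp1 at(2-4)] av xx'
    obtain z' f' where lp: "is_loop E x W r z' f'" and av': "\<forall>s\<in>{0<..<1}. \<exists>w\<in>W. f' s w \<noteq> x' w" by blast
    show thesis by (rule finish[OF lp]) (use av' in auto)
  qed
qed

end

section \<open>Rigid generic configurations\<close>

lemma real_isometry:
  fixes f :: "real \<Rightarrow> real"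
  assumes iso: "\<And>s t. (f s - f t)\<^sup>2 = (s - t)\<^sup>2"
  obtains \<epsilon> where "\<epsilon> = 1 \<or> \<epsilon> = -1" "\<And>s. f s = f 0 + \<epsilon> * s"
proof -
  define \<epsilon> where "\<epsilon> = f 1 - f 0"
  have ee: "\<epsilon> * \<epsilon> = 1" using iso[of 1 0] by (simp add: \<epsilon>_def power2_eq_square)
  have "f s = f 0 + \<epsilon> * s" for s
  proof -
    define g where "g = f s - f 0"
    have 1: "g * g = s * s" using iso[of s 0] by (simp add: g_def power2_eq_square)
    have "f s - f 1 = g - \<epsilon>" by (simp add: g_def \<epsilon>_def)
    then have "(g - \<epsilon>) * (g - \<epsilon>) = (s - 1) * (s - 1)" using iso[of s 1] by (simp add: power2_eq_square)
    then have "\<epsilon> * g = s" using 1 ee by (simp add: algebra_simps)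
    then have "(\<epsilon> * \<epsilon>) * g = \<epsilon> * s" by (simp only: mult.assoc)
    then have "g = \<epsilon> * s" unfolding ee by simp
    then show ?thesis by (simp add: g_def)
  qed
  moreover have "\<epsilon> = 1 \<or> \<epsilon> = -1" using ee by (simp add: square_eq_1_iff)
  ultimately show thesis using that by blast
qed

context line_data
begin

lemma form_zero:
  assumes ij: "i \<in> I" "j \<in> I" "i \<noteq> j" and z: "A i * s\<^sup>2 - 2 * B i j * s * t + A j * t\<^sup>2 \<le> 0"
  shows "s = 0 \<and> t = 0"
proof -
  have "A i * (A i * s\<^sup>2 - 2 * B i j * s * t + A j * t\<^sup>2) = (A i * s - B i j * t)\<^sup>2 + (A i * A j - B i j * B i j) * t\<^sup>2"
    by (simp add: power2_eq_square algebra_simps)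
  moreover have "A i * (A i * s\<^sup>2 - 2 * B i j * s * t + A j * t\<^sup>2) \<le> 0"
    using A_pos[OF ij(1)] z by (simp add: mult_le_0_iff)
  ultimately have le: "(A i * s - B i j * t)\<^sup>2 + (A i * A j - B i j * B i j) * t\<^sup>2 \<le> 0" by simp
  have dt: "0 < A i * A j - B i j * B i j" using CS[OF ij] by simp
  have t: "t = 0"
  proof (rule ccontr)
    assume "t \<noteq> 0"
    then have "0 < (A i * A j - B i j * B i j) * t\<^sup>2" using dt by simp
    then show False using le zero_le_power2[of "A i * s - B i j * t"] by linarith
  qed
  then have "A i * s = 0" using le by simp
  then show ?thesis using t A_pos[OF ij(1)] by simp
qed

lemma q_reflect: "q i j (2 * c i j - s) (2 * c j i - t) = q i j s t"
  by (simp add: q_def power2_eq_square algebra_simps)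

text \<open>Each map is an isometry of the real line. The closest points are the only pair at least
  distance, so they are fixed, and \<open>B i j \<noteq> 0\<close> forces the same sign on both
  lines.\<close>

lemma iso_pair:
  assumes ij: "i \<in> I" "j \<in> I" "i \<noteq> j"
    and qij: "\<And>s t. q i j (f s) (g t) = q i j s t"
    and qi: "\<And>s t. q i i (f s) (f t) = q i i s t" and qj: "\<And>s t. q j j (g s) (g t) = q j j s t"
  shows "(\<forall>s. f s = s) \<and> (\<forall>t. g t = t) \<or> (\<forall>s. f s = 2 * c i j - s) \<and> (\<forall>t. g t = 2 * c j i - t)"
proof -
  have iso: "(f' s - f' t)\<^sup>2 = (s - t)\<^sup>2" if "m \<in> I" "\<And>s t. q m m (f' s) (f' t) = q m m s t" for m f' s t
  proof -
    have "q m m s t = A m * (s - t)\<^sup>2" for s t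
      using B_same[OF that(1)] c_same[OF that(1)] F_same[OF that(1)]
      by (simp add: q_def power2_eq_square algebra_simps)
    then show ?thesis using that(2)[of s t] A_pos[OF that(1)] by simp
  qed
  obtain \<epsilon> where e: "\<epsilon> = 1 \<or> \<epsilon> = -1" "\<And>s. f s = f 0 + \<epsilon> * s"
  proof (rule real_isometry[of f, OF iso[OF ij(1) qi]])
    fix \<epsilon> assume "\<epsilon> = 1 \<or> \<epsilon> = -1" "\<And>s. f s = f 0 + \<epsilon> * s"
    then show thesis by (rule that)
  qed
  obtain \<delta> where d: "\<delta> = 1 \<or> \<delta> = -1" "\<And>s. g s = g 0 + \<delta> * s"
  proof (rule real_isometry[of g, OF iso[OF ij(2) qj]])
    fix \<delta> assume "\<delta> = 1 \<or> \<delta> = -1" "\<And>s. g s = g 0 + \<delta> * s"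
    then show thesis by (rule that)
  qed
  define \<alpha> where "\<alpha> = f (c i j) - c i j"
  define \<beta> where "\<beta> = g (c j i) - c j i"
  have f: "f (c i j + s) - c i j = \<epsilon> * s + \<alpha>" for s using e(2)[of "c i j + s"] e(2)[of "c i j"] by (simp add: \<alpha>_def algebra_simps)
  have g: "g (c j i + s) - c j i = \<delta> * s + \<beta>" for s using d(2)[of "c j i + s"] d(2)[of "c j i"] by (simp add: \<beta>_def algebra_simps)
  have eq: "A i * (\<epsilon> * s + \<alpha>)\<^sup>2 - 2 * B i j * (\<epsilon> * s + \<alpha>) * (\<delta> * t + \<beta>) + A j * (\<delta> * t + \<beta>)\<^sup>2 =
      A i * s\<^sup>2 - 2 * B i j * s * t + A j * t\<^sup>2" for s t
    using qij[of "c i j + s" "c j i + t"] by (simp add: q_def f g)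
  have ab: "\<alpha> = 0 \<and> \<beta> = 0" by (rule form_zero[OF ij]) (use eq[of 0 0] in simp)
  have ee: "\<epsilon> * \<epsilon> = 1" "\<delta> * \<delta> = 1" using e(1) d(1) by auto
  have "B i j * (\<epsilon> * \<delta>) = B i j" using eq[of 1 1] ab ee by (simp add: power2_eq_square)
  then have "\<epsilon> * \<delta> = 1" using B_nz[OF ij(1,2)] by simp
  then have ed: "\<epsilon> = \<delta>" using e(1) d(1) by auto
  have f': "f s = c i j + \<epsilon> * (s - c i j)" for s using f[of "s - c i j"] ab by simp
  have g': "g s = c j i + \<epsilon> * (s - c j i)" for s using g[of "s - c j i"] ab ed by simp
  show ?thesis using e(1) f' g' by auto
qed

lemma congruent_on_cases:
  assumes "congruent_on x y W"
  obtains (id) "\<And>v. v \<in> W \<Longrightarrow> y v = x v"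
    | (reflect) i j where "i \<in> I" "j \<in> I" "i \<noteq> j"
      "\<And>v. v \<in> W \<Longrightarrow> l v = i \<and> y v = 2 * c i j - x v \<or> l v = j \<and> y v = 2 * c j i - x v"
  using assms unfolding congruent_on_def by (elim disjE bexE conjE) (rule id, simp, rule reflect, assumption+, simp)

lemma congruent_on_id: "(\<And>v. v \<in> W \<Longrightarrow> y v = x v) \<Longrightarrow> congruent_on x y W"
  by (simp add: congruent_on_def)

lemma congruent_on_reflect:
  assumes "i \<in> I" "j \<in> I" "i \<noteq> j"
    "\<And>v. v \<in> W \<Longrightarrow> l v = i \<and> y v = 2 * c i j - x v \<or> l v = j \<and> y v = 2 * c j i - x v"
  shows "congruent_on x y W"
  unfolding congruent_on_def
  by (rule disjI2, rule bexI[OF _ assms(1)], rule bexI[OF _ assms(2)]) (use assms(3,4) in blast)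

lemma congruent_on_subset_cong:
  assumes "congruent_on x y V" "W \<subseteq> V" "\<And>v. v \<in> W \<Longrightarrow> y v = y' v"
  shows "congruent_on x y' W"
  using assms(1)
proof (cases rule: congruent_on_cases)
  case id
  have "y' v = x v" if "v \<in> W" for v
  proof -
    have "v \<in> V" using assms(2) that by blast
    from id[OF this] show ?thesis unfolding assms(3)[OF that] .
  qed
  then show ?thesis by (rule congruent_on_id)
next
  case (reflect i j)
  show ?thesis
  proof (rule congruent_on_reflect[OF reflect(1-3)])
    fix v assume v: "v \<in> W"
    then have "v \<in> V" using assms(2) by blast
    from reflect(4)[OF this] show "l v = i \<and> y' v = 2 * c i j - x v \<or> l v = j \<and> y' v = 2 * c j i - x v"
      unfolding assms(3)[OF v] .
  qed
qed

lemma not_const: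
  assumes du: "dual K V x \<Delta>" and v: "v \<in> V" and ij: "i \<in> I" "j \<in> I"
  shows "x v \<noteq> 2 * c i j - x v"
proof
  assume "x v = 2 * c i j - x v"
  then have "x v = c i j" by simp
  then have "\<Delta> v (x v) = \<Delta> v (c i j)" by simp
  then show False using dualD(2)[OF du v v] derivation_const[OF dualD(1)[OF du v] ij] by simp
qed

text \<open>A reflection moves every vertex, because a generic \<open>x v\<close> is not the
  parameter of a closest point.\<close>

lemma not_partially_fixed:
  assumes du: "dual K V x \<Delta>" and co: "congruent_on x y V"
    and v: "v \<in> V" "y v = x v" and w: "w \<in> V" "y w \<noteq> x w"
  shows False
  using co
proof (cases rule: congruent_on_cases)
  case id
  then show ?thesis using w by simp
next
  case (reflect i j)
  then show ?thesis
    using reflect(4)[OF v(1)] v(2) not_const[OF du v(1) reflect(1,2)] not_const[OF du v(1) reflect(2,1)] by auto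
qed

text \<open>Reflecting \<open>W\<close> alone in the common perpendicular of the lines
  \<open>i\<close> and \<open>j\<close> would preserve all edge lengths, and it is no congruence
  since the vertices outside \<open>W\<close> stay fixed.\<close>

lemma rigid_closed_set:
  assumes g: "graph_on E V" and du: "dual K V x \<Delta>"
    and rig: "\<And>y. (\<And>u v. (u, v) \<in> E \<Longrightarrow> Q y u v = Q x u v) \<Longrightarrow> congruent_on x y V"
    and W: "W \<subseteq> V" "W \<noteq> {}" "W \<noteq> V" "\<And>u v. (u, v) \<in> E \<Longrightarrow> u \<in> W \<longleftrightarrow> v \<in> W"
    and ij: "i \<in> I" "j \<in> I" "i \<noteq> j"
  shows "\<not> l ` W \<subseteq> {i, j}"
proof
  assume lW: "l ` W \<subseteq> {i, j}"
  define y where "y v = (if v \<in> W then if l v = i then 2 * c i j - x v else 2 * c j i - x v else x v)" for v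
  have "Q y u v = Q x u v" if uv: "(u, v) \<in> E" for u v
  proof (cases "u \<in> W")
    case False
    then show ?thesis using W(4)[OF uv] by (simp add: Q_def y_def)
  next
    case True
    have v: "v \<in> W" using W(4)[OF uv] True by simp
    have I: "l u \<in> I" using graph_onD(6)[OF g uv] by simp
    have lu: "l u = i \<or> l u = j" "l v = i \<or> l v = j" using lW True v by auto
    show ?thesis
    proof (cases "l u = l v")
      case eq: True
      have "(y u - y v)\<^sup>2 = (x u - x v)\<^sup>2" using True v eq by (auto simp: y_def power2_commute)
      then show ?thesis by (simp add: same_line_Q[OF eq I])
    next
      case False
      then show ?thesis
        using lu True v ij(3) q_reflect[of i j "x u" "x v"] q_reflect[of j i "x u" "x v"]
        by (auto simp: Q_def y_def)
    qed
  qed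
  then have co: "congruent_on x y V" by (rule rig)
  obtain w v where wv: "w \<in> W" "v \<in> V" "v \<notin> W" using W(1-3) by blast
  have wV: "w \<in> V" using wv W(1) by blast
  have "y w \<noteq> x w" using not_const[OF du wV ij(1,2)] not_const[OF du wV ij(2,1)] wv(1) by (auto simp: y_def)
  then show False using not_partially_fixed[OF du co wv(2) _ wV] wv(3) by (simp add: y_def)
qed

text \<open>A set \<open>T\<close> on line \<open>i\<close> whose only outside neighbour is
  \<open>s\<close> can be reflected at the foot of the perpendicular from \<open>s\<close>,
  everything else staying fixed. If it has no outside neighbour at all, it is a union of components
  and \<open>rigid_closed_set\<close> applies.\<close>

lemma rigid_no_lobe:
  assumes g: "graph_on E V" and du: "dual K V x \<Delta>" and cr: "\<exists>u\<in>V. \<exists>v\<in>V. l u \<noteq> l v"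
    and rig: "\<And>y. (\<And>u v. (u, v) \<in> E \<Longrightarrow> Q y u v = Q x u v) \<Longrightarrow> congruent_on x y V"
  shows "no_lobe E V"
  unfolding no_lobe_def
proof (intro allI impI, elim conjE, rule ccontr)
  fix T s assume T: "T \<subseteq> V" "T \<noteq> {}" "\<forall>t\<in>T. \<forall>t'\<in>T. l t = l t'"
    and n: "\<not> (\<exists>t\<in>T. \<exists>t'. (t, t') \<in> E \<and> t' \<notin> T \<and> t' \<noteq> s)"
  obtain t0 where t0: "t0 \<in> T" using T(2) by blast
  define i where "i = l t0"
  have li: "l t = i" if "t \<in> T" for t unfolding i_def using T(3) t0 that by blast
  have iI: "i \<in> I" using graph_onD(5)[OF g] T(1) t0 by (auto simp: i_def)
  have nb: "t' \<in> T \<or> t' = s" if "(t, t') \<in> E" "t \<in> T" for t t' using n that by blast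
  obtain v1 where v1: "v1 \<in> V" "l v1 \<noteq> i"
  proof -
    obtain u v where "u \<in> V" "v \<in> V" "l u \<noteq> l v" using cr by blast
    then show thesis using that[of u] that[of v] by (cases "l u = i") simp_all
  qed
  have TV: "T \<noteq> V" using v1 li by blast
  show False
  proof (cases "s \<in> V \<and> s \<notin> T")
    case False
    have jI: "l v1 \<in> I" using graph_onD(5)[OF g] v1(1) by blast
    have cl: "t' \<in> T" if "(t, t') \<in> E" "t \<in> T" for t t'
      using nb[OF that] graph_onD(6)[OF g that(1)] False by blast
    have cl': "u \<in> T \<longleftrightarrow> v \<in> T" if "(u, v) \<in> E" for u v
      using cl[OF that] cl[of v u] graph_onD(6)[OF g that] by blast
    have "\<not> l ` T \<subseteq> {i, l v1}"
      by (rule rigid_closed_set[OF g du rig T(1,2) TV cl' iI jI v1(2)[symmetric]])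
    then show False using li by blast
  next
    case True
    have sI: "l s \<in> I" using graph_onD(5)[OF g] True by auto
    \<comment> \<open>\<open>\<gamma> / 2\<close> is the parameter of the foot of the perpendicular
      from the point of \<open>s\<close> to line \<open>i\<close>: it minimises
      \<open>q i (l s)\<close> in the first argument.\<close>
    define \<gamma> where "\<gamma> = 2 * c i (l s) + 2 * B i (l s) / A i * (x s - c (l s) i)"
    define y where "y v = (if v \<in> T then \<gamma> - x v else x v)" for v
    have Ai: "0 < A i" by (rule A_pos[OF iI])
    have ts: "Q y t s = Q x t s" if "t \<in> T" for t
    proof -
      define a \<beta> s' t' where "a = A i" and "\<beta> = B i (l s)" and "s' = x s - c (l s) i" and "t' = x t - c i (l s)"
      have "y t - c i (l s) = 2 * \<beta> / a * s' - t'" using that by (simp add: y_def \<gamma>_def a_def \<beta>_def s'_def t'_def)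
      then have e: "a * (y t - c i (l s)) = 2 * \<beta> * s' - a * t'" using Ai by (simp add: a_def field_simps)
      have "a * (a * (y t - c i (l s))\<^sup>2 - 2 * \<beta> * (y t - c i (l s)) * s') =
          (a * (y t - c i (l s)))\<^sup>2 - 2 * \<beta> * (a * (y t - c i (l s))) * s'"
        by (simp add: power2_eq_square algebra_simps)
      also have "\<dots> = a * (a * t'\<^sup>2 - 2 * \<beta> * t' * s')"
        unfolding e by (simp add: power2_eq_square algebra_simps)
      finally have "a * (y t - c i (l s))\<^sup>2 - 2 * \<beta> * (y t - c i (l s)) * s' = a * t'\<^sup>2 - 2 * \<beta> * t' * s'"
        using Ai by (simp add: a_def)
      moreover have "y s = x s" using True by (simp add: y_def)
      ultimately show ?thesis
        by (simp add: Q_def q_def li[OF that] a_def \<beta>_def s'_def t'_def)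
    qed
    have "Q y u v = Q x u v" if uv: "(u, v) \<in> E" for u v
    proof -
      have I: "l u \<in> I" "l v \<in> I" "(v, u) \<in> E" using graph_onD(6)[OF g uv] by auto
      consider "u \<in> T" "v \<in> T" | "u \<in> T" "v = s" | "u = s" "v \<in> T" | "u \<notin> T" "v \<notin> T"
        using nb[OF uv] nb[OF I(3)] by blast
      then show ?thesis
      proof cases
        case 1
        then have e: "l u = l v" using li by simp
        have "(y u - y v)\<^sup>2 = (x u - x v)\<^sup>2" using 1 by (simp add: y_def power2_commute)
        then show ?thesis by (simp add: same_line_Q[OF e I(1)])
      next
        case 2
        then show ?thesis using ts by simp
      next
        case 3
        then show ?thesis using ts[of v] Q_sym[OF I(1,2)] by simp
      next
        case 4
        then show ?thesis by (simp add: Q_def y_def)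
      qed
    qed
    then have co: "congruent_on x y V" by (rule rig)
    have t0V: "t0 \<in> V" using t0 T(1) by blast
    have "y t0 \<noteq> x t0"
    proof
      assume "y t0 = x t0"
      then have "2 * x t0 = \<gamma>" using t0 by (simp add: y_def)
      then have e: "\<Delta> t0 (2 * x t0) = \<Delta> t0 \<gamma>" by simp
      note D = dualD(1)[OF du t0V]
      have "\<Delta> t0 (x s) = 0" using dualD(2)[OF du t0V] True t0 by auto
      then have "\<Delta> t0 \<gamma> = 0" using derivation_const[OF D iI sI] derivation_const[OF D sI iI] by (simp add: \<gamma>_def derivationD[OF D])
      then show False using e dualD(2)[OF du t0V t0V] by (simp add: derivationD[OF D])
    qed
    then show False using not_partially_fixed[OF du co _ _ t0V, of s] True by (simp add: y_def)
  qed
qed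

text \<open>Every component inherits \<open>no_lobe\<close>, and it is stably nontame because a
  noncongruent solution on it could be extended by \<open>x\<close> elsewhere. Thus
  \<open>solution_congruent\<close> applies to each component at \<open>x2\<close>. With several
  components none can be reflected, as none lies in two lines.\<close>

theorem rigidity_transfer:
  assumes g: "graph_on E V" and cr: "\<exists>u\<in>V. \<exists>v\<in>V. l u \<noteq> l v"
    and du: "dual K V x \<Delta>" and du2: "dual K V x2 \<Delta>2"
    and rig: "\<And>y. (\<And>u v. (u, v) \<in> E \<Longrightarrow> Q y u v = Q x u v) \<Longrightarrow> congruent_on x y V"
    and y: "\<And>u v. (u, v) \<in> E \<Longrightarrow> Q y u v = Q x2 u v"
  shows "congruent_on x2 y V"
proof -
  note 1 = rigid_no_lobe[OF g du cr rig]
  define comp where "comp v = E\<^sup>* `` {v}" for v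
  have sym: "sym E" using graph_onD(4)[OF g] .
  have co: "congruent_on x2 y (comp v) \<and> comp v \<subseteq> V \<and> v \<in> comp v \<and> (\<forall>a b. (a, b) \<in> E \<longrightarrow> (a \<in> comp v \<longleftrightarrow> b \<in> comp v))"
    if v: "v \<in> V" for v
  proof -
    let ?W = "comp v"
    let ?F = "induced E ?W"
    have cl: "a \<in> ?W \<longleftrightarrow> b \<in> ?W" if "(a, b) \<in> E" for a b
    proof -
      have "(b, a) \<in> E" using sym that by (auto dest: symD)
      then show ?thesis using that unfolding comp_def Image_singleton_iff by (meson rtrancl.rtrancl_into_rtrancl)
    qed
    have WV: "?W \<subseteq> V"
    proof
      fix w assume "w \<in> ?W"
      then have "(v, w) \<in> E\<^sup>*" by (simp add: comp_def)
      then show "w \<in> V" using v graph_onD(6)[OF g] by (cases rule: rtranclE) auto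
    qed
    have gW: "graph_on ?F ?W" by (rule graph_on_induced[OF g WV])
    have vW: "v \<in> ?W" by (simp add: comp_def)
    have to_v: "(v, w) \<in> ?F\<^sup>*" if "w \<in> ?W" for w
    proof -
      have "(v, w) \<in> E\<^sup>*" using that by (simp add: comp_def)
      then show ?thesis
      proof (induction rule: rtrancl_induct)
        case (step a b)
        have "a \<in> ?W" using step(1) by (simp add: comp_def)
        then have "(a, b) \<in> ?F" using step(2) cl by (auto simp: induced_def)
        with step.IH show ?case by (rule rtrancl.rtrancl_into_rtrancl)
      qed simp
    qed
    have cn: "conn_on ?F ?W"
      unfolding conn_on_def using to_v rtrancl_swap[OF sym_induced[OF sym]] by (meson rtrancl_trans)
    have c1: "no_lobe ?F ?W"
      unfolding no_lobe_def
    proof (intro allI impI, elim conjE)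
      fix T s assume T: "T \<subseteq> ?W" "T \<noteq> {}" "\<forall>t\<in>T. \<forall>t'\<in>T. l t = l t'"
      have TV: "T \<subseteq> V" using T(1) WV by blast
      have same: "l t = l t'" if "t \<in> T" "t' \<in> T" for t t' using T(3) that by blast
      obtain t t' where t: "t \<in> T" "(t, t') \<in> E" "t' \<notin> T" "t' \<noteq> s" by (rule no_lobeD[OF 1 TV T(2) same, of s])
      then have "(t, t') \<in> ?F" using T(1) cl by (auto simp: induced_def)
      then show "\<exists>t\<in>T. \<exists>t'. (t, t') \<in> ?F \<and> t' \<notin> T \<and> t' \<noteq> s" using t by blast
    qed
    have c3: "stably_nontame ?F"
      unfolding stably_nontame_def
    proof (intro allI impI, elim conjE, rule ccontr)
      fix a b assume ab: "(a, b) \<in> ?F" "l a \<noteq> l b" "(a, b) \<in> (delete_edge ?F a b)\<^sup>*" and n: "\<not> nontame (delete_edge ?F a b)"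
      obtain z where z: "\<And>u v. (u, v) \<in> ?F \<Longrightarrow> Q z u v = Q x u v" "\<not> congruent_on x z ?W"
      proof (rule tame_flexible[OF gW cn dual_subset[OF du WV] ab n])
        fix z assume "\<And>u v. (u, v) \<in> ?F \<Longrightarrow> Q z u v = Q x u v" "\<not> congruent_on x z ?W"
        then show thesis by (rule that)
      qed
      define z' where "z' w = (if w \<in> ?W then z w else x w)" for w
      have "Q z' p r = Q x p r" if pr: "(p, r) \<in> E" for p r
      proof (cases "p \<in> ?W")
        case True
        then have "r \<in> ?W" using cl[OF pr] by simp
        then have "Q z p r = Q x p r" using z(1)[of p r] True pr by (simp add: induced_def)
        then show ?thesis using True \<open>r \<in> ?W\<close> by (simp add: Q_def z'_def)
      next
        case False
        then show ?thesis using cl[OF pr] by (simp add: Q_def z'_def)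
      qed
      then have "congruent_on x z' V" by (rule rig)
      then have "congruent_on x z ?W" using WV by (rule congruent_on_subset_cong) (simp add: z'_def)
      then show False using z(2) by blast
    qed
    have ne: "?W \<noteq> {}" using vW by blast
    have "congruent_on x2 y ?W"
      by (rule solution_congruent[OF gW cn c1 c3 ne dual_subset[OF du2 WV]]) (use y in \<open>auto simp: induced_def\<close>)
    then show ?thesis using WV vW cl by blast
  qed
  show ?thesis
  proof (cases "\<exists>v\<in>V. comp v = V")
    case True
    then show ?thesis using co by metis
  next
    case False
    have "y v = x2 v" if v: "v \<in> V" for v
    proof -
      note c = co[OF v]
      have W: "comp v \<subseteq> V" "comp v \<noteq> {}" "comp v \<noteq> V" using c False v by auto
      have cv: "congruent_on x2 y (comp v)" and vv: "v \<in> comp v" using c by auto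
      from cv show ?thesis
      proof (cases rule: congruent_on_cases)
        case id
        then show ?thesis using vv by simp
      next
        case (reflect i j)
        have "l ` comp v \<subseteq> {i, j}" using reflect(4) by blast
        moreover have "\<not> l ` comp v \<subseteq> {i, j}"
          by (rule rigid_closed_set[OF g du rig W _ reflect(1-3)]) (use c in auto)
        ultimately show ?thesis by blast
      qed
    qed
    then show ?thesis by (simp add: congruent_on_def)
  qed
qed

end

section \<open>Fields of definition and lines\<close>

lemma ring_of_reals:
  defines "R \<equiv> (ring_of_type_algebra :: real ring)"
  shows "field R" "carrier R = UNIV" "\<one>\<^bsub>R\<^esub> = 1" "\<zero>\<^bsub>R\<^esub> = 0" "x \<oplus>\<^bsub>R\<^esub> y = x + y" "x \<otimes>\<^bsub>R\<^esub> y = x * y"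
    "\<ominus>\<^bsub>R\<^esub> x = - x" "x \<noteq> 0 \<Longrightarrow> inv\<^bsub>R\<^esub> x = inverse x"
proof -
  show f: "field R" unfolding R_def by (rule field_from_type_algebra)
  show s: "carrier R = UNIV" "\<one>\<^bsub>R\<^esub> = 1" "\<zero>\<^bsub>R\<^esub> = 0" "x \<oplus>\<^bsub>R\<^esub> y = x + y" "x \<otimes>\<^bsub>R\<^esub> y = x * y" for x y
    by (simp_all add: R_def ring_of_type_algebra_def)
  interpret field R by (rule f)
  show "\<ominus>\<^bsub>R\<^esub> x = - x" by (rule minus_equality) (simp_all add: s)
  show "inv\<^bsub>R\<^esub> x = inverse x" if "x \<noteq> 0" by (rule inv_char) (use that in \<open>simp_all add: s\<close>)
qed

lemma real_subring_of_subfield: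
  assumes "subfield F (ring_of_type_algebra :: real ring)"
  shows "real_subring F"
proof -
  have sr: "subring F (ring_of_type_algebra :: real ring)"
    using assms unfolding subfield_def subdomain_def subcring_def by blast
  show ?thesis
    unfolding real_subring_def using subringE(3,5-7)[OF sr] by (simp add: ring_of_reals)
qed

lemma kernel_subfield:
  assumes D: "derivation K D"
  shows "subfield {r. D r = 0} (ring_of_type_algebra :: real ring)"
proof (rule field.subfieldI'[OF ring_of_reals(1)])
  interpret field "ring_of_type_algebra :: real ring" by (rule ring_of_reals(1))
  show "subring {r. D r = 0} (ring_of_type_algebra :: real ring)"
    by (rule subringI) (simp_all add: ring_of_reals derivationD[OF D])
  show "inv\<^bsub>ring_of_type_algebra\<^esub> k \<in> {r. D r = 0}" if "k \<in> {r. D r = 0} - {\<zero>\<^bsub>ring_of_type_algebra\<^esub>}" for k :: real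
    using that by (simp add: ring_of_reals derivationD[OF D])
qed

lemma real_subring_field_generated_by: "real_subring (field_generated_by T)"
proof -
  have s: "real_subring F" if "subfield F (ring_of_type_algebra :: real ring)" for F by (rule real_subring_of_subfield[OF that])
  show ?thesis
    unfolding real_subring_def field_generated_by_def hull_def using s by (auto simp: real_subring_def)
qed

lemma subset_field_generated_by: "T \<subseteq> field_generated_by T"
  unfolding field_generated_by_def by (rule hull_subset)

text \<open>The kernel of a derivation is a subfield.\<close>

lemma derivation_field_generated_by:
  assumes D: "derivation K D" and T: "\<And>t. t \<in> T \<Longrightarrow> D t = 0" and r: "r \<in> field_generated_by T"
  shows "D r = 0"
proof -
  have "field_generated_by T \<subseteq> {r. D r = 0}"
    unfolding field_generated_by_def hull_def using kernel_subfield[OF D] T by blast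
  then show ?thesis using r by blast
qed

text \<open>If no independent set had size \<open>n\<close>, all sizes and hence their supremum
  would be at most \<open>n - 1\<close>, which is less than \<open>n\<close> because
  \<open>n \<noteq> 0\<close>.\<close>

lemma transcendence_degree_attained:
  assumes "transcendence_degree K F = enat n" "n \<noteq> 0"
  obtains S where "finite S" "S \<subseteq> F" "algebraically_independent K S" "card S = n"
proof (rule ccontr)
  note witness = that
  assume no: "\<not> thesis"
  let ?S = "{S. finite S \<and> S \<subseteq> F \<and> algebraically_independent K S}"
  have "enat (card S) \<le> enat (n - 1)" if S: "S \<in> ?S" for S
  proof -
    have "enat (card S) \<le> (SUP S\<in>?S. enat (card S))" by (rule SUP_upper[OF S])
    then have "card S \<le> n" using assms(1) by (simp add: transcendence_degree_def)
    moreover have "card S \<noteq> n" using no witness[of S] S by blast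
    ultimately show ?thesis by simp
  qed
  then have "(SUP S\<in>?S. enat (card S)) \<le> enat (n - 1)" by (rule SUP_least)
  then have "enat n \<le> enat (n - 1)" using assms(1) by (simp add: transcendence_degree_def)
  then show False using assms(2) by simp
qed

text \<open>Start from derivations dual to an independent set \<open>S\<close> of the right size. A
  combination that kills all \<open>x v\<close> kills the generators \<open>T\<close>, hence the
  whole field including \<open>S\<close>, and so is trivial; \<open>dual_transfer\<close> then
  passes from \<open>S\<close> to \<open>x\<close>. This takes the place of an exchange of
  transcendence bases.\<close>

lemma dual_of_transcendence_degree:
  assumes fin: "finite V" "V \<noteq> {}" and K: "real_subring K"
    and td: "transcendence_degree K (field_generated_by T) = enat (card V)"
    and gen: "\<And>D t. derivation K D \<Longrightarrow> (\<And>v. v \<in> V \<Longrightarrow> D (x v) = 0) \<Longrightarrow> t \<in> T \<Longrightarrow> D t = 0"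
  obtains \<Delta> where "dual K V x \<Delta>"
proof -
  have "card V \<noteq> 0" using fin by simp
  obtain S where S: "finite S" "S \<subseteq> field_generated_by T" "algebraically_independent K S" "card S = card V"
    by (rule transcendence_degree_attained[OF td \<open>card V \<noteq> 0\<close>])
  have "\<exists>D. derivation K D \<and> (\<forall>t\<in>S. D t = (if t = s then 1 else 0))" if "s \<in> S" for s
    using independent_derivation[OF K S(3) that] by metis
  then obtain D where D: "\<And>s. s \<in> S \<Longrightarrow> derivation K (D s)" "\<And>s t. s \<in> S \<Longrightarrow> t \<in> S \<Longrightarrow> D s t = (if t = s then 1 else 0)"
    by metis
  show thesis
  proof (rule dual_transfer[OF S(1) fin(1) S(4), of K D x])
    show "derivation K (D s)" if "s \<in> S" for s by (rule D(1)[OF that])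
  next
    fix e assume e: "\<And>w. w \<in> V \<Longrightarrow> (\<Sum>s\<in>S. e s * D s (x w)) = 0"
    define E where "E r = (\<Sum>s\<in>S. e s * D s r)" for r
    have E: "derivation K E" unfolding E_def by (rule derivation_lin_comb) (rule D(1))
    have "E t = 0" if "t \<in> T" for t by (rule gen[OF E _ that]) (use e in \<open>simp add: E_def\<close>)
    then have z: "E s = 0" if "s \<in> S" for s
      using derivation_field_generated_by[OF E, of T s] S(2) that by blast
    show "\<forall>s\<in>S. e s = 0"
    proof
      fix s assume s: "s \<in> S"
      have "E s = (\<Sum>t\<in>S. if s = t then e t else 0)"
        unfolding E_def by (intro sum.cong refl) (simp add: D(2)[OF _ s])
      also have "\<dots> = e s" using s S(1) by simp
      finally show "e s = 0" using z[OF s] by simp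
    qed
  next
    fix \<Delta> assume "dual K V x \<Delta>"
    then show thesis by (rule that)
  qed
qed

section \<open>Lines over the field of their standard equations\<close>

lemma line_through:
  assumes "is_line L"
  obtains a d where "d \<noteq> 0" "L = range (\<lambda>t. a + t *\<^sub>R d)"
proof -
  have L: "affine L" "aff_dim L = 1" using assms by (auto simp: is_line_def)
  have "L \<noteq> {}" using L(2) by auto
  then obtain a where a: "a \<in> L" by blast
  have "L \<noteq> {a}" using L(2) by auto
  then obtain b where b: "b \<in> L" "b \<noteq> a" using a by blast
  have "affine hull {a, b} \<subseteq> L" using a b L(1) by (simp add: hull_minimal)
  then have e: "affine hull {a, b} = L"
    by (intro affine_dim_equal affine_affine_hull L(1)) (use b L(2) in auto)
  have "range (\<lambda>t. a + t *\<^sub>R (b - a)) = affine hull {a, b}"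
  proof (intro equalityI subsetI)
    fix p assume "p \<in> range (\<lambda>t. a + t *\<^sub>R (b - a))"
    then obtain t where "p = a + t *\<^sub>R (b - a)" by blast
    then have "p = (1 - t) *\<^sub>R a + t *\<^sub>R b \<and> (1 - t) + t = 1" by (simp add: algebra_simps)
    then show "p \<in> affine hull {a, b}" unfolding affine_hull_2 by blast
  next
    fix p assume "p \<in> affine hull {a, b}"
    then obtain u v where uv: "p = u *\<^sub>R a + v *\<^sub>R b" "u + v = 1" unfolding affine_hull_2 by blast
    then have u: "u = 1 - v" by simp
    have "p = a + v *\<^sub>R (b - a)" unfolding uv(1) u by (simp add: algebra_simps)
    then show "p \<in> range (\<lambda>t. a + t *\<^sub>R (b - a))" by blast
  qed
  then show thesis using that[of "b - a" a] b e by simp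
qed

text \<open>With the last possible coordinate \<open>j0\<close> as the parameter of the line, its standard equation
  expresses each other coordinate as an affine function of that one.\<close>

lemma line_over_field:
  fixes L :: "(real ^ 'n::{finite,linorder}) set"
  assumes line: "is_line L" and LL: "L \<in> \<L>"
  obtains a d where "d \<noteq> 0" "L = range (\<lambda>t. a + t *\<^sub>R d)"
    "\<And>j. a $ j \<in> field_of_lines \<L>" "\<And>j. d $ j \<in> field_of_lines \<L>"
proof -
  obtain a0 d0 where 0: "d0 \<noteq> 0" "L = range (\<lambda>t. a0 + t *\<^sub>R d0)" by (rule line_through[OF line])
  define n where "n = CARD('n)"
  define ix where "ix j = sorted_list_of_set (UNIV :: 'n set) ! j" for j
  have len: "length (sorted_list_of_set (UNIV :: 'n set)) = n" by (simp add: n_def)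
  have ix_surj: "\<exists>j<n. ix j = i" for i
    unfolding ix_def using len by (metis UNIV_I finite in_set_conv_nth set_sorted_list_of_set)
  define J where "J = {j. j < n \<and> d0 $ ix j \<noteq> 0}"
  have "J \<noteq> {}"
  proof -
    obtain i where "d0 $ i \<noteq> 0"
    proof (rule ccontr)
      assume "\<not> thesis"
      then have "d0 $ i = 0" for i using that by blast
      then show False using 0(1) by (simp add: Finite_Cartesian_Product.vec_eq_iff)
    qed
    then show ?thesis using ix_surj[of i] by (auto simp: J_def)
  qed
  moreover have finJ: "finite J" by (simp add: J_def)
  ultimately have MJ: "Max J \<in> J" by (rule Max_in[rotated])
  define j0 where "j0 = Max J"
  have j0: "j0 < n" "d0 $ ix j0 \<noteq> 0" using MJ by (auto simp: j0_def J_def)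
  have above: "d0 $ ix j = 0" if "j0 < j" "j < n" for j
  proof (rule ccontr)
    assume "d0 $ ix j \<noteq> 0"
    then have "j \<le> Max J" using that by (intro Max_ge finJ) (simp add: J_def)
    then show False using that by (simp add: j0_def)
  qed
  \<comment> \<open>Normalised so that at coordinate \<open>j0\<close> the vector \<open>d\<close>
    has entry 1 and \<open>a\<close> has entry 0; that coordinate of a point is then its
    parameter.\<close>
  define d where "d = (1 / d0 $ ix j0) *\<^sub>R d0"
  define a where "a = a0 - (a0 $ ix j0) *\<^sub>R d"
  have dj0: "d $ ix j0 = 1" and aj0: "a $ ix j0 = 0" using j0 by (simp_all add: d_def a_def)
  have dab: "d $ ix j = 0" if "j0 < j" "j < n" for j using above[OF that] by (simp add: d_def)
  have d0d: "d0 = (d0 $ ix j0) *\<^sub>R d" using j0 by (simp add: d_def)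
  have Lad: "L = range (\<lambda>t. a + t *\<^sub>R d)"
  proof (intro equalityI subsetI)
    fix p assume "p \<in> L"
    then obtain t where t: "p = a0 + t *\<^sub>R d0" using 0(2) by blast
    have "p = a + (a0 $ ix j0 + t * d0 $ ix j0) *\<^sub>R d"
      unfolding t a_def by (subst d0d) (simp add: algebra_simps)
    then show "p \<in> range (\<lambda>t. a + t *\<^sub>R d)" by blast
  next
    fix p assume "p \<in> range (\<lambda>t. a + t *\<^sub>R d)"
    then obtain t where t: "p = a + t *\<^sub>R d" by blast
    have "p = a0 + ((t - a0 $ ix j0) / d0 $ ix j0) *\<^sub>R d0"
      unfolding t a_def d_def by (simp add: algebra_simps diff_divide_distrib)
    then show "p \<in> L" using 0(2) by blast
  qed
  \<comment> \<open>Row \<open>i\<close> expresses coordinate \<open>r i\<close>; the map skips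
    \<open>j0\<close>, the only column of \<open>M\<close> without a pivot.\<close>
  define r where "r i = (if i < j0 then i else Suc i)" for i :: nat
  define M where "M = Matrix.mat (n - 1) n (\<lambda>(i, j). if j = r i then 1 else if j = j0 then - (d $ ix (r i)) else 0 :: real)"
  define b where "b = Matrix.vec (n - 1) (\<lambda>i. a $ ix (r i))"
  have r: "r i < n" "r i \<noteq> j0" if "i < n - 1" for i using that j0(1) by (auto simp: r_def)
  have r_inj: "r i = r i' \<longleftrightarrow> i = i'" for i i' by (auto simp: r_def)
  have r_surj: "\<exists>i<n - 1. r i = j" if "j < n" "j \<noteq> j0" for j
  proof (cases "j < j0")
    case True
    then show ?thesis using j0(1) by (intro exI[of _ j]) (auto simp: r_def)
  next
    case False
    then show ?thesis using that by (intro exI[of _ "j - 1"]) (auto simp: r_def)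
  qed
  have cv: "vec_index (coordinate_vector p) j = p $ ix j" if "j < n" for p :: "real ^ 'n::{finite,linorder}" and j
    using that by (simp add: coordinate_vector_def n_def ix_def)
  have dimc: "dim_vec (coordinate_vector p) = n" for p :: "real ^ 'n::{finite,linorder}" by (simp add: coordinate_vector_def n_def)
  have row: "vec_index (M *\<^sub>v coordinate_vector p) i = p $ ix (r i) - d $ ix (r i) * p $ ix j0"
    if i: "i < n - 1" for p :: "real ^ 'n::{finite,linorder}" and i
  proof -
    have "vec_index (M *\<^sub>v coordinate_vector p) i =
        (\<Sum>j\<in>{0..<n}. (if j = r i then 1 else if j = j0 then - (d $ ix (r i)) else 0) * p $ ix j)"
      using i by (simp add: M_def scalar_prod_def dimc cv)
    also have "\<dots> = (\<Sum>j\<in>{0..<n}. (if j = r i then p $ ix (r i) else 0) + (if j = j0 then - (d $ ix (r i)) * p $ ix j0 else 0))"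
      using r[OF i] by (intro sum.cong refl) auto
    also have "\<dots> = p $ ix (r i) - d $ ix (r i) * p $ ix j0"
      using r[OF i] j0(1) by (simp add: sum.distrib)
    finally show ?thesis .
  qed
  have eqn: "L = {p. M *\<^sub>v coordinate_vector p = b}"
  proof (intro equalityI subsetI)
    fix p assume "p \<in> L"
    then obtain t where t: "p = a + t *\<^sub>R d" using Lad by blast
    have "M *\<^sub>v coordinate_vector p = b"
    proof (rule eq_vecI)
      show "dim_vec (M *\<^sub>v coordinate_vector p) = dim_vec b" by (simp add: M_def b_def)
      fix i assume "i < dim_vec b"
      then have i: "i < n - 1" by (simp add: b_def)
      then show "vec_index (M *\<^sub>v coordinate_vector p) i = vec_index b i"
        unfolding row[OF i] by (simp add: t b_def aj0 dj0)
    qed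
    then show "p \<in> {p. M *\<^sub>v coordinate_vector p = b}" by simp
  next
    fix p :: "real ^ 'n::{finite,linorder}"
    assume "p \<in> {p. M *\<^sub>v coordinate_vector p = b}"
    then have p: "M *\<^sub>v coordinate_vector p = b" by simp
    have "p = a + (p $ ix j0) *\<^sub>R d"
      unfolding Finite_Cartesian_Product.vec_eq_iff
    proof
      fix i0
      obtain j where j: "j < n" "ix j = i0" using ix_surj by blast
      show "p $ i0 = (a + (p $ ix j0) *\<^sub>R d) $ i0"
      proof (cases "j = j0")
        case True
        then have "ix j0 = i0" using j by simp
        then show ?thesis using aj0 dj0 by simp
      next
        case False
        then obtain i where i: "i < n - 1" "r i = j" using r_surj j(1) by blast
        have "vec_index (M *\<^sub>v coordinate_vector p) i = a $ ix (r i)" using i p by (simp add: b_def)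
        then show ?thesis using row[OF i(1), of p] i j by (simp add: algebra_simps)
      qed
    qed
    then show "p \<in> L" unfolding Lad by blast
  qed
  define aug where "aug = augmented_matrix M b"
  have dims: "dim_row aug = n - 1" "dim_col aug = n + 1" by (simp_all add: aug_def augmented_matrix_def M_def)
  have ent: "aug $$ (i, j) = (if j < n then if j = r i then 1 else if j = j0 then - (d $ ix (r i)) else 0 else a $ ix (r i))"
    if "i < n - 1" "j < n + 1" for i j
    using that by (auto simp: aug_def augmented_matrix_def M_def b_def)
  have ech: "row_echelon_form aug"
    unfolding row_echelon_form_def
  proof (rule exI[of _ r], rule pivot_funI[OF dims(1)])
    fix i assume i: "i < n - 1"
    show "r i \<le> dim_col aug" using r[OF i] dims by simp
    \<comment> \<open>If the pivot \<open>r i\<close> is to the right of \<open>j0\<close>, the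
      entry in column \<open>j0\<close> vanishes because \<open>j0\<close> is the last coordinate in
      which the direction is nonzero.\<close>
    show "aug $$ (i, j) = 0" if j: "j < r i" for j
    proof -
      have "d $ ix (r i) = 0" if "j = j0" using dab[of "r i"] j r[OF i] that by simp
      then show ?thesis using ent[OF i, of j] j r[OF i] by auto
    qed
    show "r i < r (Suc i) \<or> r (Suc i) = dim_col aug" by (auto simp: r_def)
    show "aug $$ (i, r i) = 1" using ent[OF i, of "r i"] r[OF i] by simp
    show "aug $$ (i', r i) = 0" if "i' < n - 1" "i' \<noteq> i" for i'
      using ent[OF that(1), of "r i"] r[OF i] r_inj that(2) by simp
  qed
  have "standard_equation L M b"
    unfolding standard_equation_def using ech eqn by (simp add: aug_def M_def b_def n_def)
  then have sub: "elements_mat aug \<subseteq> line_entries \<L>" unfolding line_entries_def aug_def using LL by blast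
  have mem: "aug $$ (i, j) \<in> field_of_lines \<L>" if "i < n - 1" "j < n + 1" for i j
  proof -
    have "aug $$ (i, j) \<in> elements_mat aug" by (rule elements_matI[of _ "n - 1" "n + 1"]) (use that dims in auto)
    then show ?thesis using sub subset_field_generated_by unfolding field_of_lines_def by blast
  qed
  have K: "real_subring (field_of_lines \<L>)" unfolding field_of_lines_def by (rule real_subring_field_generated_by)
  have "a $ i0 \<in> field_of_lines \<L> \<and> d $ i0 \<in> field_of_lines \<L>" for i0
  proof -
    obtain j where j: "j < n" "ix j = i0" using ix_surj by blast
    show ?thesis
    proof (cases "j = j0")
      case True
      then show ?thesis using j aj0 dj0 real_subringD(1,2)[OF K] by auto
    next
      case False
      then obtain i where i: "i < n - 1" "r i = j" using r_surj j(1) by blast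
      have "a $ i0 \<in> field_of_lines \<L>" using mem[OF i(1), of n] ent[OF i(1), of n] i j by simp
      moreover have "- (d $ i0) \<in> field_of_lines \<L>"
        using mem[OF i(1), of j0] ent[OF i(1), of j0] i j j0(1) False by simp
      then have "d $ i0 \<in> field_of_lines \<L>" using real_subringD(3)[OF K] by fastforce
      ultimately show ?thesis by blast
    qed
  qed
  moreover have "d \<noteq> 0" using dj0 by (metis zero_index zero_neq_one)
  ultimately show thesis using that[OF _ Lad] by blast
qed

lemma derivation_inner:
  fixes u v :: "real ^ 'n"
  assumes D: "derivation K D" and u: "\<And>j. u $ j \<in> K" and v: "\<And>j. v $ j \<in> K"
  shows "D (u \<bullet> v) = 0"
  unfolding inner_vec_def derivation_sum[OF D] by (rule sum.neutral) (simp add: derivationD(2,3)[OF D] u v)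

text \<open>The difference of the two sides is \<open>u \<bullet> u\<close> times the squared norm
  of the part of \<open>v\<close> orthogonal to \<open>u\<close>.\<close>

lemma inner_square_less:
  fixes u v :: "real ^ 'n"
  assumes u: "u \<noteq> 0" and no: "\<And>c. v \<noteq> c *\<^sub>R u"
  shows "(u \<bullet> v) * (u \<bullet> v) < (u \<bullet> u) * (v \<bullet> v)"
proof -
  have uu: "0 < u \<bullet> u" using u by simp
  define w where "w = v - ((u \<bullet> v) / (u \<bullet> u)) *\<^sub>R u"
  have "w \<noteq> 0" using no[of "(u \<bullet> v) / (u \<bullet> u)"] by (simp add: w_def)
  then have "0 < (u \<bullet> u) * (w \<bullet> w)" using uu by simp
  also have "(u \<bullet> u) * (w \<bullet> w) = (u \<bullet> u) * (v \<bullet> v) - (u \<bullet> v) * (u \<bullet> v)"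
    using uu by (simp add: w_def inner_diff_left inner_diff_right inner_commute[of v u] field_simps)
  finally show ?thesis by simp
qed

text \<open>Parametrised lines: for lines \<open>i\<close> and \<open>j\<close>, the parameters \<open>cc i j\<close> and \<open>cc j i\<close> solve the normal
  equations of their common perpendicular (both are \<open>0\<close> for \<open>i = j\<close>, by division by zero).\<close>

locale lines =
  fixes k :: nat and L :: "nat \<Rightarrow> (real ^ 'n::{finite,linorder}) set"
    and a d :: "nat \<Rightarrow> real ^ 'n::{finite,linorder}"
  assumes inj: "inj_on L {1..k}" and gp: "general_position (L ` {1..k})"
    and d_nz: "i \<in> {1..k} \<Longrightarrow> d i \<noteq> 0"
    and L_eq: "i \<in> {1..k} \<Longrightarrow> L i = range (\<lambda>t. a i + t *\<^sub>R d i)"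
    and a_K: "i \<in> {1..k} \<Longrightarrow> a i $ m \<in> field_of_lines (L ` {1..k})"
    and d_K: "i \<in> {1..k} \<Longrightarrow> d i $ m \<in> field_of_lines (L ` {1..k})"
begin

definition pt :: "nat \<Rightarrow> real \<Rightarrow> real ^ 'n::{finite,linorder}" where
  "pt i t = a i + t *\<^sub>R d i"

definition AA :: "nat \<Rightarrow> real" where "AA i = d i \<bullet> d i"

definition BB :: "nat \<Rightarrow> nat \<Rightarrow> real" where "BB i j = d i \<bullet> d j"

definition cc :: "nat \<Rightarrow> nat \<Rightarrow> real" where
  "cc i j = (BB i j * ((a i - a j) \<bullet> d j) - AA j * ((a i - a j) \<bullet> d i)) / (AA i * AA j - BB i j * BB i j)"

definition FF :: "nat \<Rightarrow> nat \<Rightarrow> real" where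
  "FF i j = (dist (pt i (cc i j)) (pt j (cc j i)))\<^sup>2"

abbreviation "KK \<equiv> field_of_lines (L ` {1..k})"

lemma ne_lines:
  assumes "i \<in> {1..k}" "j \<in> {1..k}" "i \<noteq> j"
  shows "\<not> affine_parallel (L i) (L j)" "\<not> perpendicular (L i) (L j)"
proof -
  have ne: "L i \<noteq> L j" using inj_on_eq_iff[OF inj assms(1,2)] assms(3) by simp
  have "\<forall>L1\<in>L ` {1..k}. \<forall>M\<in>L ` {1..k}. L1 \<noteq> M \<longrightarrow> \<not> affine_parallel L1 M \<and> \<not> perpendicular L1 M"
    using gp unfolding general_position_def by (rule conjunct1)
  from this[THEN bspec, OF imageI[OF assms(1)], THEN bspec, OF imageI[OF assms(2)]] ne
  show "\<not> affine_parallel (L i) (L j)" "\<not> perpendicular (L i) (L j)" by simp_all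
qed

lemma BB_nz:
  assumes ij: "i \<in> {1..k}" "j \<in> {1..k}"
  shows "BB i j \<noteq> 0"
proof (cases "i = j")
  case True
  then show ?thesis using d_nz[OF ij(1)] by (simp add: BB_def)
next
  case False
  show ?thesis
  proof
    assume "BB i j = 0"
    then have z: "d i \<bullet> d j = 0" by (simp add: BB_def)
    have "perpendicular (L i) (L j)"
      unfolding perpendicular_def L_eq[OF ij(1)] L_eq[OF ij(2)]
    proof (intro ballI)
      fix p p' q q'
      assume "p \<in> range (\<lambda>t. a i + t *\<^sub>R d i)" "p' \<in> range (\<lambda>t. a i + t *\<^sub>R d i)"
        "q \<in> range (\<lambda>t. a j + t *\<^sub>R d j)" "q' \<in> range (\<lambda>t. a j + t *\<^sub>R d j)"
      then obtain s s' t t' where p: "p = a i + s *\<^sub>R d i" "p' = a i + s' *\<^sub>R d i"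
        "q = a j + t *\<^sub>R d j" "q' = a j + t' *\<^sub>R d j" by blast
      have "p - p' = (s - s') *\<^sub>R d i" "q - q' = (t - t') *\<^sub>R d j" by (simp_all add: p algebra_simps)
      then show "Linear_Algebra.orthogonal (p - p') (q - q')" by (simp add: real_inner_class.orthogonal_def z)
    qed
    then show False using ne_lines(2)[OF ij False] by blast
  qed
qed

lemma BB_less:
  assumes ij: "i \<in> {1..k}" "j \<in> {1..k}" "i \<noteq> j"
  shows "BB i j * BB i j < AA i * AA j"
  unfolding BB_def AA_def
proof (rule inner_square_less[OF d_nz[OF ij(1)]])
  fix c show "d j \<noteq> c *\<^sub>R d i"
  proof
    assume e: "d j = c *\<^sub>R d i"
    then have c: "c \<noteq> 0" using d_nz[OF ij(2)] by auto
    have "L j = (\<lambda>p. (a j - a i) + p) ` L i"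
      unfolding L_eq[OF ij(1)] L_eq[OF ij(2)]
    proof (intro equalityI subsetI)
      fix p assume "p \<in> range (\<lambda>t. a j + t *\<^sub>R d j)"
      then obtain t where "p = a j + t *\<^sub>R d j" by blast
      then have "p = (a j - a i) + (a i + (t * c) *\<^sub>R d i)" by (simp add: e)
      then show "p \<in> (\<lambda>p. (a j - a i) + p) ` range (\<lambda>t. a i + t *\<^sub>R d i)" by blast
    next
      fix p assume "p \<in> (\<lambda>p. (a j - a i) + p) ` range (\<lambda>t. a i + t *\<^sub>R d i)"
      then obtain t where "p = (a j - a i) + (a i + t *\<^sub>R d i)" by blast
      then have "p = a j + (t / c) *\<^sub>R d j" using c by (simp add: e)
      then show "p \<in> range (\<lambda>t. a j + t *\<^sub>R d j)" by blast
    qed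
    then have "affine_parallel (L i) (L j)" unfolding affine_parallel_def by blast
    then show False using ne_lines(1)[OF ij] by blast
  qed
qed

lemma BB_sym: "BB i j = BB j i"
  by (simp add: BB_def inner_commute)

lemma cc_same: "cc i i = 0"
  by (simp add: cc_def AA_def BB_def)

text \<open>The vector \<open>m\<close> between the closest points is orthogonal to both directions,
  by Cramer's rule for the normal equations (it is zero for \<open>i = j\<close>), so Pythagoras
  splits off \<open>FF i j\<close>.\<close>

lemma dist_pt:
  assumes ij: "i \<in> {1..k}" "j \<in> {1..k}"
  shows "(dist (pt i s) (pt j t))\<^sup>2 =
    AA i * (s - cc i j)\<^sup>2 - 2 * BB i j * (s - cc i j) * (t - cc j i) + AA j * (t - cc j i)\<^sup>2 + FF i j"
proof -
  define w m where "w = a i - a j" and "m = pt i (cc i j) - pt j (cc j i)"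
  have m: "m = w + cc i j *\<^sub>R d i - cc j i *\<^sub>R d j" by (simp add: m_def w_def pt_def)
  have orth: "m \<bullet> d i = 0 \<and> m \<bullet> d j = 0"
  proof (cases "i = j")
    case True
    then show ?thesis by (simp add: m cc_same w_def)
  next
    case False
    define D where "D = AA i * AA j - BB i j * BB i j"
    have D: "D \<noteq> 0" using BB_less[OF ij False] by (simp add: D_def)
    have ci: "cc i j = (BB i j * (w \<bullet> d j) - AA j * (w \<bullet> d i)) / D" by (simp add: cc_def w_def D_def)
    have cj: "cc j i = (AA i * (w \<bullet> d j) - BB i j * (w \<bullet> d i)) / D"
    proof -
      have "a j - a i = - w" by (simp add: w_def)
      then have "cc j i = (BB i j * ((- w) \<bullet> d i) - AA i * ((- w) \<bullet> d j)) / (AA j * AA i - BB i j * BB i j)"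
        by (simp only: cc_def BB_sym[of j i])
      then show ?thesis by (simp add: D_def algebra_simps)
    qed
    have cD: "D * cc i j = BB i j * (w \<bullet> d j) - AA j * (w \<bullet> d i)" "D * cc j i = AA i * (w \<bullet> d j) - BB i j * (w \<bullet> d i)"
      using D by (simp_all add: ci cj)
    have 1: "m \<bullet> d i = w \<bullet> d i + cc i j * AA i - cc j i * BB i j" "m \<bullet> d j = w \<bullet> d j + cc i j * BB i j - cc j i * AA j"
      by (simp_all add: m inner_add_left inner_diff_left AA_def BB_def inner_commute[of "d j" "d i"])
    have "D * (m \<bullet> d i) = D * (w \<bullet> d i) + AA i * (D * cc i j) - BB i j * (D * cc j i)"
      unfolding 1 by (simp add: algebra_simps)
    also have "\<dots> = 0" unfolding cD by (simp add: D_def algebra_simps)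
    finally have i0: "m \<bullet> d i = 0" using D by simp
    have "D * (m \<bullet> d j) = D * (w \<bullet> d j) + BB i j * (D * cc i j) - AA j * (D * cc j i)"
      unfolding 1 by (simp add: algebra_simps)
    also have "\<dots> = 0" unfolding cD by (simp add: D_def algebra_simps)
    finally show ?thesis using i0 D by simp
  qed
  define S T where "S = s - cc i j" and "T = t - cc j i"
  have "pt i s - pt j t = m + (S *\<^sub>R d i - T *\<^sub>R d j)" by (simp add: m_def pt_def S_def T_def algebra_simps)
  then have "(dist (pt i s) (pt j t))\<^sup>2 = (m + (S *\<^sub>R d i - T *\<^sub>R d j)) \<bullet> (m + (S *\<^sub>R d i - T *\<^sub>R d j))"
    by (simp only: dist_norm power2_norm_eq_inner)
  also have "\<dots> = m \<bullet> m + (AA i * S\<^sup>2 - 2 * BB i j * S * T + AA j * T\<^sup>2)"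
  proof -
    have o: "m \<bullet> d i = 0" "m \<bullet> d j = 0" "d i \<bullet> m = 0" "d j \<bullet> m = 0" using orth by (simp_all add: inner_commute)
    have "d j \<bullet> d i = d i \<bullet> d j" by (rule inner_commute)
    then show ?thesis
      by (simp add: inner_add_left inner_add_right inner_diff_left inner_diff_right o AA_def BB_def
          power2_eq_square algebra_simps)
  qed
  also have "m \<bullet> m = FF i j" by (simp add: FF_def m_def dist_norm power2_norm_eq_inner)
  finally show ?thesis by (simp add: S_def T_def)
qed

lemma FF_nonneg: "0 \<le> FF i j" by (simp add: FF_def)

lemma form_nonneg:
  assumes ij: "i \<in> {1..k}" "j \<in> {1..k}" "i \<noteq> j"
  shows "0 \<le> AA i * s\<^sup>2 - 2 * BB i j * s * t + AA j * t\<^sup>2"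
proof -
  have A: "0 < AA i" using d_nz[OF ij(1)] by (simp add: AA_def)
  have "AA i * (AA i * s\<^sup>2 - 2 * BB i j * s * t + AA j * t\<^sup>2) = (AA i * s - BB i j * t)\<^sup>2 + (AA i * AA j - BB i j * BB i j) * t\<^sup>2"
    by (simp add: power2_eq_square algebra_simps)
  also have "0 \<le> \<dots>" using BB_less[OF ij] by simp
  finally show ?thesis using A by (simp add: zero_le_mult_iff)
qed

text \<open>Connects the formula for \<open>cc\<close> with weak concurrency, where closest points
  are minimisers of \<open>infdist\<close>: by \<open>dist_pt\<close> and \<open>form_nonneg\<close>
  no pair of points is nearer.\<close>

lemma closest:
  assumes ij: "i \<in> {1..k}" "j \<in> {1..k}" "i \<noteq> j"
  shows "closest_point_to_line (L i) (L j) (pt i (cc i j))"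
proof -
  have inL: "pt m t \<in> L m" if "m \<in> {1..k}" for m t using L_eq[OF that] by (auto simp: pt_def)
  have le: "infdist (pt i (cc i j)) (L j) \<le> infdist p (L j)" if p: "p \<in> L i" for p
  proof -
    obtain s where s: "p = pt i s" using p L_eq[OF ij(1)] by (auto simp: pt_def)
    have ne: "L j \<noteq> {}" using inL[OF ij(2)] by blast
    have "infdist (pt i (cc i j)) (L j) \<le> dist (pt i (cc i j)) (pt j (cc j i))"
      by (rule infdist_le[OF inL[OF ij(2)]])
    moreover have "dist (pt i (cc i j)) (pt j (cc j i)) \<le> dist p m" if mL: "m \<in> L j" for m
    proof -
      obtain t where t: "m = pt j t" using mL L_eq[OF ij(2)] by (auto simp: pt_def)
      have "(dist (pt i (cc i j)) (pt j (cc j i)))\<^sup>2 \<le> (dist p m)\<^sup>2"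
        unfolding s t dist_pt[OF ij(1,2)] using form_nonneg[OF ij, of "s - cc i j" "t - cc j i"] by simp
      then show ?thesis by (rule power2_le_imp_le) simp
    qed
    ultimately have "infdist (pt i (cc i j)) (L j) \<le> dist p m" if "m \<in> L j" for m using that by force
    then show ?thesis using ne by (simp add: infdist_def cINF_greatest)
  qed
  show ?thesis
    unfolding closest_point_to_line_def is_arg_min_def using inL[OF ij(1)] le by (auto simp: not_less)
qed

lemma derivation_KK:
  assumes D: "derivation KK D" and ij: "i \<in> {1..k}" "j \<in> {1..k}"
  shows "D (AA i) = 0 \<and> D (BB i j) = 0 \<and> D (cc i j) = 0"
proof -
  have 1: "D (d i \<bullet> d i) = 0" "D (d j \<bullet> d j) = 0" "D (d i \<bullet> d j) = 0"
    using derivation_inner[OF D d_K d_K] ij by blast+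
  have 2: "D (a i \<bullet> d j) = 0" "D (a i \<bullet> d i) = 0" "D (a j \<bullet> d j) = 0" "D (a j \<bullet> d i) = 0"
    using derivation_inner[OF D a_K d_K] ij by blast+
  show ?thesis
    by (simp add: AA_def BB_def cc_def inner_diff_left derivationD[OF D] 1 2)
qed

lemma line_data: "line_data KK {1..k} AA BB cc FF"
proof
  fix i j m
  show "0 < AA i" if "i \<in> {1..k}" using d_nz[OF that] by (simp add: AA_def)
  show "BB i j = BB j i" by (rule BB_sym)
  show "BB i i = AA i" by (simp add: AA_def BB_def)
  show "cc i i = 0" by (rule cc_same)
  show "FF i j = FF j i" by (simp add: FF_def dist_commute)
  show "FF i i = 0" by (simp add: FF_def)
  show "BB i j \<noteq> 0" if "i \<in> {1..k}" "j \<in> {1..k}" using BB_nz that .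
  show "BB i j * BB i j < AA i * AA j" if "i \<in> {1..k}" "j \<in> {1..k}" "i \<noteq> j" using BB_less that .
  show "cc i j \<noteq> cc i m" if ijm: "i \<in> {1..k}" "j \<in> {1..k}" "m \<in> {1..k}" "i \<noteq> j" "i \<noteq> m" "j \<noteq> m"
  proof
    assume e: "cc i j = cc i m"
    have cl: "closest_point_to_line (L i) (L j) (pt i (cc i j))" by (rule closest) (use ijm in auto)
    have cl': "closest_point_to_line (L i) (L m) (pt i (cc i j))" unfolding e by (rule closest) (use ijm in auto)
    note np = ne_lines(1)[OF ijm(1,2,4)] ne_lines(1)[OF ijm(1,3,5)] ne_lines(1)[OF ijm(2,3,6)]
    have wc: "weakly_concurrent (L i) (L j) (L m)" unfolding weakly_concurrent_def using cl cl' np by blast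
    have ds: "distinct [L i, L j, L m]"
      using inj_on_eq_iff[OF inj ijm(1,2)] inj_on_eq_iff[OF inj ijm(1,3)] inj_on_eq_iff[OF inj ijm(2,3)] ijm by simp
    have "\<forall>L1\<in>L ` {1..k}. \<forall>L2\<in>L ` {1..k}. \<forall>L3\<in>L ` {1..k}. distinct [L1, L2, L3] \<longrightarrow> \<not> weakly_concurrent L1 L2 L3"
      using gp unfolding general_position_def by (rule conjunct2)
    from this[THEN bspec, OF imageI[OF ijm(1)], THEN bspec, OF imageI[OF ijm(2)], THEN bspec, OF imageI[OF ijm(3)]] ds
    show False using wc by simp
  qed
  show "D (AA i) = 0 \<and> D (BB i j) = 0 \<and> D (cc i j) = 0" if "derivation KK D" "i \<in> {1..k}" "j \<in> {1..k}" for D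
    by (rule derivation_KK[OF that])
qed

end

section \<open>Frameworks\<close>

locale framework = lines k L a d
  for k :: nat and L :: "nat \<Rightarrow> (real ^ 'n::{finite,linorder}) set"
    and a d :: "nat \<Rightarrow> real ^ 'n::{finite,linorder}" +
  fixes G :: "'v pair_pre_digraph" and V :: "nat \<Rightarrow> 'v set"
  assumes pg: "partitioned_graph k G V" and cr: "crossing k V"
begin

definition label :: "'v \<Rightarrow> nat" where
  "label v = (THE i. i \<in> {1..k} \<and> v \<in> V i)"

sublocale ld: line_data "field_of_lines (L ` {1..k})" "{1..k}" AA BB cc FF label
  by (rule line_data)

lemma label_eq:
  assumes "i \<in> {1..k}" "v \<in> V i"
  shows "label v = i"
  unfolding label_def
proof (rule the_equality)
  show "i \<in> {1..k} \<and> v \<in> V i" using assms by blast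
  fix j assume j: "j \<in> {1..k} \<and> v \<in> V j"
  have "disjoint_family_on V {1..k}" using pg by (simp add: partitioned_graph_def)
  then have "j \<noteq> i \<Longrightarrow> V j \<inter> V i = {}" using j assms(1) by (intro disjoint_family_onD) auto
  then show "j = i" using j assms(2) by blast
qed

lemma verts_eq: "pverts G = (\<Union>i\<in>{1..k}. V i)"
  using pg by (simp add: partitioned_graph_def)

lemma label_verts:
  assumes "v \<in> pverts G"
  shows "label v \<in> {1..k}" "v \<in> V (label v)"
proof -
  obtain i where i: "i \<in> {1..k}" "v \<in> V i" using assms verts_eq by blast
  show "label v \<in> {1..k}" "v \<in> V (label v)" using i label_eq[OF i] by simp_all
qed

lemma graph: "ld.graph_on (parcs G) (pverts G)"
proof -
  have "pair_graph G" using pg by (simp add: partitioned_graph_def)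
  then interpret pair_graph G .
  have "parcs G \<subseteq> pverts G \<times> pverts G" using arc_fst_in_verts arc_snd_in_verts by (simp add: subset_iff mem_Times_iff)
  moreover have "irrefl (parcs G)" using pair_no_loops by (fastforce simp: irrefl_def)
  moreover have "sym (parcs G)" using arcs_symmetric by (auto simp: sym_def)
  ultimately show ?thesis using pair_finite_verts label_verts(1) unfolding ld.graph_on_def by blast
qed

lemma used_verts:
  assumes "i \<in> {1..k}" "V i \<noteq> {}"
  obtains v where "v \<in> pverts G" "label v = i"
proof -
  obtain v where "v \<in> V i" using assms(2) by blast
  then show thesis using that[of v] label_eq[OF assms(1)] verts_eq assms(1) by blast
qed

lemma two_used:
  obtains i j where "i \<in> {1..k}" "j \<in> {1..k}" "i \<noteq> j" "V i \<noteq> {}" "V j \<noteq> {}"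
proof -
  let ?S = "{i\<in>{1..k}. V i \<noteq> {}}"
  have "2 \<le> card ?S" using cr by (simp add: crossing_def)
  then have n: "\<not> card ?S \<le> Suc 0" by simp
  have fin: "finite ?S" by simp
  obtain i j where "i \<in> ?S" "j \<in> ?S" "i \<noteq> j" using n unfolding card_le_Suc0_iff_eq[OF fin] by blast
  then show thesis using that[of i j] by simp
qed

lemma crossing_verts: "\<exists>u\<in>pverts G. \<exists>v\<in>pverts G. label u \<noteq> label v"
proof -
  obtain i j where ij: "i \<in> {1..k}" "j \<in> {1..k}" "i \<noteq> j" "V i \<noteq> {}" "V j \<noteq> {}" by (rule two_used)
  obtain u where u: "u \<in> pverts G" "label u = i" by (rule used_verts[OF ij(1,4)])
  obtain v where v: "v \<in> pverts G" "label v = j" by (rule used_verts[OF ij(2,5)])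
  show ?thesis using u v ij(3) by blast
qed

lemma dist_q: "i \<in> {1..k} \<Longrightarrow> j \<in> {1..k} \<Longrightarrow> (dist (pt i s) (pt j t))\<^sup>2 = ld.q i j s t"
  by (simp add: dist_pt ld.q_def)

lemma dist_pt_eq_iff:
  assumes "i \<in> {1..k}" "j \<in> {1..k}"
  shows "dist (pt i s) (pt j t) = dist (pt i s') (pt j t') \<longleftrightarrow> ld.q i j s t = ld.q i j s' t'"
  unfolding dist_q[OF assms, symmetric] by (simp add: power2_eq_iff_nonneg)

lemma pt_inj: "i \<in> {1..k} \<Longrightarrow> pt i s = pt i t \<longleftrightarrow> s = t"
  using d_nz by (simp add: pt_def)

lemma L_pt: "i \<in> {1..k} \<Longrightarrow> L i = range (pt i)"
  using L_eq by (simp add: pt_def)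

section \<open>Placements as families of parameters\<close>

definition place :: "('v \<Rightarrow> real) \<Rightarrow> 'v \<Rightarrow> real ^ 'n::{finite,linorder}" where
  "place y = (\<lambda>v\<in>pverts G. pt (label v) (y v))"

lemma place_placement: "place y \<in> placements k L G V"
  unfolding placements_def
proof (intro CollectI conjI ballI)
  show "place y \<in> extensional (pverts G)" by (simp add: place_def)
  fix i assume i: "i \<in> {1..k}"
  show "place y ` V i \<subseteq> L i"
  proof
    fix p assume "p \<in> place y ` V i"
    then obtain v where v: "v \<in> V i" "p = place y v" by blast
    then have "v \<in> pverts G" using i verts_eq by blast
    then show "p \<in> L i" using v label_eq[OF i v(1)] L_pt[OF i] by (simp add: place_def)
  qed
qed

lemma placement_place:
  assumes p: "p \<in> placements k L G V"
  obtains x where "p = place x"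
proof -
  have "\<exists>t. p v = pt (label v) t" if v: "v \<in> pverts G" for v
  proof -
    have "p v \<in> L (label v)" using p label_verts[OF v] unfolding placements_def by blast
    then show ?thesis using L_pt[OF label_verts(1)[OF v]] by blast
  qed
  then obtain x where x: "\<And>v. v \<in> pverts G \<Longrightarrow> p v = pt (label v) (x v)" by metis
  have "p = place x"
  proof (rule extensionalityI[of _ "pverts G"])
    show "p \<in> extensional (pverts G)" using p by (simp add: placements_def)
  qed (simp_all add: place_def x)
  then show thesis by (rule that)
qed

lemma measurement_eq_iff:
  "measurement G (place y) = measurement G (place x) \<longleftrightarrow> (\<forall>(u, v)\<in>parcs G. ld.Q y u v = ld.Q x u v)"
proof -
  have Q: "(norm (place y u - place y v))\<^sup>2 = ld.Q y u v" if "(u, v) \<in> parcs G" for y u v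
  proof -
    have "u \<in> pverts G" "v \<in> pverts G" using ld.graph_onD(6)[OF graph that] by auto
    then show ?thesis using dist_q[of "label u" "label v"] label_verts(1) by (simp add: place_def ld.Q_def dist_norm)
  qed
  show ?thesis
  proof
    assume e: "measurement G (place y) = measurement G (place x)"
    show "\<forall>(u, v)\<in>parcs G. ld.Q y u v = ld.Q x u v"
    proof (intro ballI, clarify)
      fix u v assume uv: "(u, v) \<in> parcs G"
      have "measurement G (place y) (u, v) = measurement G (place x) (u, v)" using e by simp
      then show "ld.Q y u v = ld.Q x u v" using uv by (simp add: measurement_def Q)
    qed
  next
    assume e: "\<forall>(u, v)\<in>parcs G. ld.Q y u v = ld.Q x u v"
    show "measurement G (place y) = measurement G (place x)"
      unfolding measurement_def
    proof (rule restrict_ext)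
      fix w assume w: "w \<in> parcs G"
      obtain u v where uv: "w = (u, v)" by force
      have "ld.Q y u v = ld.Q x u v" using e w uv by blast
      then show "(case w of (u, v) \<Rightarrow> (norm (place y u - place y v))\<^sup>2) =
          (case w of (u, v) \<Rightarrow> (norm (place x u - place x v))\<^sup>2)"
        using w Q unfolding uv by simp
    qed
  qed
qed


text \<open>The coordinates of a point are affine in its parameter with coefficients in the field of
  the lines, so a derivation killing all parameters kills every generator of the field of the
  placement.\<close>

lemma generic_dual:
  assumes gen: "generic_placement (L ` {1..k}) G (place x)"
  obtains \<Delta> where "dual (field_of_lines (L ` {1..k})) (pverts G) x \<Delta>"
proof -
  define K where "K = field_of_lines (L ` {1..k})"
  define T where "T = K \<union> {place x v $ j | v j. v \<in> pverts G}"
  have K: "real_subring K" unfolding K_def field_of_lines_def by (rule real_subring_field_generated_by)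
  have fin: "finite (pverts G)" by (rule ld.graph_onD(1)[OF graph])
  have ne: "pverts G \<noteq> {}" using crossing_verts by blast
  have td: "transcendence_degree K (field_generated_by T) = enat (card (pverts G))"
    using gen by (simp add: generic_placement_def field_of_placement_def K_def T_def)
  have T: "D t = 0" if D: "derivation K D" and x: "\<And>v. v \<in> pverts G \<Longrightarrow> D (x v) = 0" and t: "t \<in> T" for D t
  proof (cases "t \<in> K")
    case True
    then show ?thesis by (rule derivationD(3)[OF D])
  next
    case False
    then obtain v j where v: "v \<in> pverts G" "t = place x v $ j" using t by (auto simp: T_def)
    then have "t = a (label v) $ j + x v * d (label v) $ j" by (simp add: place_def pt_def)
    moreover have "D (a (label v) $ j) = 0" "D (d (label v) $ j) = 0"
      using a_K d_K label_verts(1)[OF v(1)] derivationD(3)[OF D] by (simp_all add: K_def)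
    ultimately show ?thesis by (simp add: derivationD(1,2)[OF D] x[OF v(1)])
  qed
  show thesis
  proof (rule dual_of_transcendence_degree[OF fin ne K td, of x])
    fix D t assume "derivation K D" "\<And>v. v \<in> pverts G \<Longrightarrow> D (x v) = 0" "t \<in> T"
    then show "D t = 0" by (rule T)
  next
    fix \<Delta> assume "dual K (pverts G) x \<Delta>"
    then show thesis using that by (simp add: K_def)
  qed
qed

lemma in_used: "i \<in> {1..k} \<Longrightarrow> V i \<noteq> {} \<Longrightarrow> pt i t \<in> \<Union>(used_lines k L V)"
  using L_pt[of i] unfolding used_lines_def by blast

text \<open>On each used line the isometry acts by a map of parameters, and \<open>iso_pair\<close>
  controls any two of these. One identity spreads to all used lines; a reflection allows only two of
  them, since a third would demand a different centre on line \<open>i\<close>.\<close>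

lemma congruent_of_isometry:
  assumes \<theta>: "\<theta> \<in> line_isometries (used_lines k L V)"
    and y: "place y = compose (pverts G) \<theta> (place x)"
  shows "ld.congruent_on x y (pverts G)"
proof -
  let ?u = "\<lambda>i. i \<in> {1..k} \<and> V i \<noteq> {}"
  have iso: "dist (\<theta> p) (\<theta> q) = dist p q" if "p \<in> \<Union>(used_lines k L V)" "q \<in> \<Union>(used_lines k L V)" for p q
    using \<theta> that unfolding line_isometries_def by blast
  have img: "\<theta> ` L i = L i" if "?u i" for i
    using \<theta> that unfolding line_isometries_def used_lines_def by blast
  have "\<exists>s. \<theta> (pt i t) = pt i s" if u: "?u i" for i t
  proof -
    have "\<theta> (pt i t) \<in> L i" using img[OF u] L_pt[of i] u by blast
    then show ?thesis using L_pt[of i] u by blast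
  qed
  then obtain f where f: "\<And>i t. ?u i \<Longrightarrow> \<theta> (pt i t) = pt i (f i t)" by metis
  have q: "ld.q i j (f i s) (f j t) = ld.q i j s t" if "?u i" "?u j" for i j s t
  proof -
    have "dist (pt i (f i s)) (pt j (f j t)) = dist (pt i s) (pt j t)"
      using iso[OF in_used in_used, of i j s t] f that by simp
    then show ?thesis using dist_pt_eq_iff[of i j] that by blast
  qed
  have pair: "(\<forall>s. f i s = s) \<and> (\<forall>t. f j t = t) \<or> (\<forall>s. f i s = 2 * cc i j - s) \<and> (\<forall>t. f j t = 2 * cc j i - t)"
    if "?u i" "?u j" "i \<noteq> j" for i j
    by (rule ld.iso_pair) (use that q in auto)
  have yv: "y v = f (label v) (x v)" and uv: "?u (label v)" if v: "v \<in> pverts G" for v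
  proof -
    show u: "?u (label v)" using label_verts[OF v] by blast
    have "place y v = \<theta> (place x v)" using v by (simp add: y compose_def)
    then have "pt (label v) (y v) = pt (label v) (f (label v) (x v))" using v f[OF u] by (simp add: place_def)
    then show "y v = f (label v) (x v)" using pt_inj u by blast
  qed
  obtain i j where ij: "?u i" "?u j" "i \<noteq> j" using two_used by metis
  from pair[OF ij] show ?thesis
  proof
    assume id: "(\<forall>s. f i s = s) \<and> (\<forall>t. f j t = t)"
    have "f m t = t" if m: "?u m" for m t
    proof (cases "m = i")
      case False
      have "\<not> (\<forall>s. f i s = 2 * cc i m - s)"
      proof
        assume "\<forall>s. f i s = 2 * cc i m - s"
        then have "f i (cc i m + 1) = 2 * cc i m - (cc i m + 1)" by blast
        then show False using id by simp
      qed
      then show ?thesis using pair[OF ij(1) m] False by blast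
    qed (use id in blast)
    then have "y v = x v" if "v \<in> pverts G" for v using yv uv that by simp
    then show ?thesis by (rule ld.congruent_on_id)
  next
    assume r: "(\<forall>s. f i s = 2 * cc i j - s) \<and> (\<forall>t. f j t = 2 * cc j i - t)"
    have only: "m = i \<or> m = j" if m: "?u m" for m
    proof (rule ccontr)
      assume n: "\<not> (m = i \<or> m = j)"
      have fi: "f i (cc i j) = cc i j" "f i (cc i j + 1) = cc i j - 1" using r by simp_all
      from pair[OF ij(1) m] n have "\<forall>s. f i s = 2 * cc i m - s" using fi(2) by force
      then have "cc i j = cc i m" using fi(1) by (metis add_diff_cancel_right' mult_2 mult_cancel_left zero_neq_numeral diff_add_cancel)
      then show False using ld.c_distinct[of i j m] ij m n by blast
    qed
    show ?thesis
    proof (rule ld.congruent_on_reflect[of i j])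
      fix v assume v: "v \<in> pverts G"
      show "label v = i \<and> y v = 2 * cc i j - x v \<or> label v = j \<and> y v = 2 * cc j i - x v"
        using only[OF uv[OF v]] yv[OF v] r by auto
    qed (use ij in auto)
  qed
qed

text \<open>In the reflected case the used lines are just \<open>L i\<close> and \<open>L j\<close>,
  and the point reflections of these at their closest points fit together to an isometry of the
  union.\<close>

lemma isometry_of_congruent:
  assumes co: "ld.congruent_on x y (pverts G)"
  shows "\<exists>\<theta>\<in>line_isometries (used_lines k L V). place y = compose (pverts G) \<theta> (place x)"
  using co
proof (cases rule: ld.congruent_on_cases)
  case id
  let ?U = "\<Union>(used_lines k L V)"
  have inU: "place x v \<in> ?U" if v: "v \<in> pverts G" for v
    using in_used[of "label v" "x v"] label_verts[OF v] v by (auto simp: place_def)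
  have "place y = compose (pverts G) (restrict (\<lambda>p. p) ?U) (place x)"
  proof (rule extensionalityI[of _ "pverts G"])
    fix v assume v: "v \<in> pverts G"
    then show "place y v = compose (pverts G) (restrict (\<lambda>p. p) ?U) (place x) v"
      using inU[OF v] id[OF v] by (simp add: compose_def place_def)
  qed (simp_all add: place_def)
  moreover have "restrict (\<lambda>p. p) ?U \<in> line_isometries (used_lines k L V)"
    unfolding line_isometries_def
  proof (intro CollectI conjI ballI)
    show "restrict (\<lambda>p. p) ?U ` M = M" if M: "M \<in> used_lines k L V" for M
    proof -
      have "restrict (\<lambda>p. p) ?U p = p" if "p \<in> M" for p using M that by auto
      then show ?thesis by simp
    qed
  qed auto
  ultimately show ?thesis by blast
next
  case (reflect i j)
  note ij = reflect(1-3)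
  have used: "used_lines k L V = {L i, L j}"
  proof -
    have sub: "m = i \<or> m = j" if m: "m \<in> {1..k}" "V m \<noteq> {}" for m
    proof -
      obtain v where "v \<in> pverts G" "label v = m" by (rule used_verts[OF m])
      then show ?thesis using reflect(4) by blast
    qed
    obtain i' j' where "i' \<in> {1..k}" "j' \<in> {1..k}" "i' \<noteq> j'" "V i' \<noteq> {}" "V j' \<noteq> {}" by (rule two_used)
    then have "V i \<noteq> {} \<and> V j \<noteq> {}" using sub by metis
    then show ?thesis using sub ij(1,2) unfolding used_lines_def by blast
  qed
  define \<theta> where "\<theta> = (\<lambda>p\<in>L i \<union> L j. if p \<in> L i then 2 *\<^sub>R pt i (cc i j) - p else 2 *\<^sub>R pt j (cc j i) - p)"
  have refl: "2 *\<^sub>R pt m c - pt m t = pt m (2 * c - t)" for m c t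
    by (simp add: pt_def algebra_simps scaleR_2)
  have \<theta>i: "\<theta> (pt i t) = pt i (2 * cc i j - t)" for t
    using L_pt[OF ij(1)] by (simp add: \<theta>_def refl)
  \<comment> \<open>A common point of the two lines is the closest point on both and is fixed by
    either reflection, so the preference for \<open>L i\<close> in the definition of \<theta> is
    harmless.\<close>
  have \<theta>j: "\<theta> (pt j t) = pt j (2 * cc j i - t)" for t
  proof (cases "pt j t \<in> L i")
    case True
    then obtain s where s: "pt j t = pt i s" using L_pt[OF ij(1)] by blast
    then have "ld.q i j s t = 0" using dist_q[OF ij(1,2), of s t] by simp
    then have "AA i * (s - cc i j)\<^sup>2 - 2 * BB i j * (s - cc i j) * (t - cc j i) + AA j * (t - cc j i)\<^sup>2 \<le> 0"
      using FF_nonneg[of i j] by (simp add: ld.q_def)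
    then have "s - cc i j = 0 \<and> t - cc j i = 0" by (rule ld.form_zero[OF ij])
    then have st: "s = cc i j" "t = cc j i" by simp_all
    have "\<theta> (pt j t) = pt i s" unfolding s \<theta>i by (simp add: st)
    then show ?thesis using s by (simp add: st)
  next
    case False
    then show ?thesis using L_pt[OF ij(2)] by (simp add: \<theta>_def refl)
  qed
  have cases_U: "(\<exists>t. p = pt i t) \<or> (\<exists>t. p = pt j t)" if "p \<in> L i \<union> L j" for p
    using that L_pt[OF ij(1)] L_pt[OF ij(2)] by blast
  have same: "ld.q m m (2 * e - s) (2 * e - t) = ld.q m m s t" if "m \<in> {1..k}" for m e s t
    using ld.B_same[OF that] ld.c_same[OF that] by (simp add: ld.q_def power2_eq_square algebra_simps)
  have iso: "dist (\<theta> p) (\<theta> p') = dist p p'" if pp: "p \<in> L i \<union> L j" "p' \<in> L i \<union> L j" for p p'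
  proof -
    have ii: "dist (\<theta> (pt i s)) (\<theta> (pt i t)) = dist (pt i s) (pt i t)" for s t
      unfolding \<theta>i dist_pt_eq_iff[OF ij(1,1)] by (rule same[OF ij(1)])
    have jj: "dist (\<theta> (pt j s)) (\<theta> (pt j t)) = dist (pt j s) (pt j t)" for s t
      unfolding \<theta>j dist_pt_eq_iff[OF ij(2,2)] by (rule same[OF ij(2)])
    have ij': "dist (\<theta> (pt i s)) (\<theta> (pt j t)) = dist (pt i s) (pt j t)" for s t
      unfolding \<theta>i \<theta>j dist_pt_eq_iff[OF ij(1,2)] by (rule ld.q_reflect)
    have ji: "dist (\<theta> (pt j s)) (\<theta> (pt i t)) = dist (pt j s) (pt i t)" for s t
      using ij'[of t s] by (simp only: dist_commute)
    from cases_U[OF pp(1)] cases_U[OF pp(2)] show ?thesis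
      by (elim disjE exE) (simp_all only: ii jj ij' ji)
  qed
  have img: "\<theta> ` L m = L m" if m: "m \<in> {1..k}" and e: "\<And>t. \<theta> (pt m t) = pt m (2 * e - t)" for m e
  proof -
    have "\<theta> ` L m = range (\<lambda>t. pt m (2 * e - t))" unfolding L_pt[OF m] image_image e ..
    also have "\<dots> = range (pt m)"
    proof (intro equalityI subsetI)
      fix p assume "p \<in> range (pt m)"
      then obtain t where "p = pt m t" by blast
      then have "p = pt m (2 * e - (2 * e - t))" by simp
      then show "p \<in> range (\<lambda>t. pt m (2 * e - t))" by blast
    qed blast
    finally show ?thesis unfolding L_pt[OF m] .
  qed
  have "\<theta> \<in> line_isometries {L i, L j}"
    unfolding line_isometries_def
  proof (intro CollectI conjI ballI)
    show "\<theta> \<in> \<Union>{L i, L j} \<rightarrow>\<^sub>E \<Union>{L i, L j}"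
    proof (rule PiE_I)
      fix p assume "p \<in> \<Union>{L i, L j}"
      then show "\<theta> p \<in> \<Union>{L i, L j}" using img[OF ij(1) \<theta>i] img[OF ij(2) \<theta>j] by blast
    next
      fix p assume "p \<notin> \<Union>{L i, L j}"
      then show "\<theta> p = undefined" by (simp add: \<theta>_def)
    qed
    fix p q assume "p \<in> \<Union>{L i, L j}" "q \<in> \<Union>{L i, L j}"
    then show "dist (\<theta> p) (\<theta> q) = dist p q" by (intro iso) simp_all
  next
    fix M assume "M \<in> {L i, L j}"
    then show "\<theta> ` M = M" using img[OF ij(1) \<theta>i] img[OF ij(2) \<theta>j] by blast
  qed
  moreover have "place y = compose (pverts G) \<theta> (place x)"
  proof (rule extensionalityI[of _ "pverts G"])
    fix v assume v: "v \<in> pverts G"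
    from reflect(4)[OF v] have "pt (label v) (y v) = \<theta> (pt (label v) (x v))" by (elim disjE conjE) (simp_all add: \<theta>i \<theta>j)
    then show "place y v = compose (pverts G) \<theta> (place x) v" using v by (simp add: compose_def place_def)
  qed (simp_all add: place_def)
  ultimately show ?thesis unfolding used by blast
qed

lemma globally_rigid_iff:
  "globally_rigid k L G V (place x) \<longleftrightarrow>
    (\<forall>y. (\<forall>(u, v)\<in>parcs G. ld.Q y u v = ld.Q x u v) \<longrightarrow> ld.congruent_on x y (pverts G))"
proof
  assume r: "globally_rigid k L G V (place x)"
  show "\<forall>y. (\<forall>(u, v)\<in>parcs G. ld.Q y u v = ld.Q x u v) \<longrightarrow> ld.congruent_on x y (pverts G)"
  proof (intro allI impI)
    fix y assume "\<forall>(u, v)\<in>parcs G. ld.Q y u v = ld.Q x u v"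
    then have "measurement G (place y) = measurement G (place x)" by (simp only: measurement_eq_iff)
    then obtain \<theta> where "\<theta> \<in> line_isometries (used_lines k L V)" "place y = compose (pverts G) \<theta> (place x)"
      using r place_placement[of y] unfolding globally_rigid_def by blast
    then show "ld.congruent_on x y (pverts G)" by (rule congruent_of_isometry)
  qed
next
  assume r: "\<forall>y. (\<forall>(u, v)\<in>parcs G. ld.Q y u v = ld.Q x u v) \<longrightarrow> ld.congruent_on x y (pverts G)"
  show "globally_rigid k L G V (place x)"
    unfolding globally_rigid_def
  proof (intro ballI impI)
    fix q assume q: "q \<in> placements k L G V" "measurement G q = measurement G (place x)"
    obtain y where y: "q = place y" by (rule placement_place[OF q(1)])
    have "ld.congruent_on x y (pverts G)" using r q(2) unfolding y measurement_eq_iff by blast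
    then show "\<exists>\<theta>\<in>line_isometries (used_lines k L V). q = compose (pverts G) \<theta> (place x)"
      unfolding y by (rule isometry_of_congruent)
  qed
qed

end

theorem corollary7p8:
  fixes k :: nat
    and L :: "nat \<Rightarrow> (real ^ 'n::{finite,linorder}) set"
    and G :: "'v pair_pre_digraph"
    and V :: "nat \<Rightarrow> 'v set"
    and p :: "'v \<Rightarrow> real ^ 'n::{finite,linorder}"
  assumes "\<And>i. i \<in> {1..k} \<Longrightarrow> is_line (L i)"
    and "inj_on L {1..k}"
    and "general_position (L ` {1..k})"
    and "partitioned_graph k G V"
    and "crossing k V"
    and "p \<in> placements k L G V"
    and "generic_placement (L ` {1..k}) G p"
    and "globally_rigid k L G V p"
  shows "generically_globally_rigid k L G V"
proof -
  let ?K = "field_of_lines (L ` {1..k})"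
  have "\<exists>a d. d \<noteq> 0 \<and> L i = range (\<lambda>t. a + t *\<^sub>R d) \<and> (\<forall>j. a $ j \<in> ?K) \<and> (\<forall>j. d $ j \<in> ?K)"
    if i: "i \<in> {1..k}" for i
    by (rule line_over_field[OF assms(1)[OF i] imageI[OF i, of L]]) blast
  then obtain a d where ad: "\<And>i. i \<in> {1..k} \<Longrightarrow> d i \<noteq> 0 \<and> L i = range (\<lambda>t. a i + t *\<^sub>R d i) \<and>
      (\<forall>j. a i $ j \<in> ?K) \<and> (\<forall>j. d i $ j \<in> ?K)" by metis
  interpret framework k L a d G V
    by unfold_locales (use ad assms(2-5) in blast)+
  obtain x where x: "p = place x" by (rule placement_place[OF assms(6)])
  obtain \<Delta> where du: "dual ?K (pverts G) x \<Delta>" by (rule generic_dual[OF assms(7)[unfolded x]])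
  have rig: "ld.congruent_on x y (pverts G)" if "\<And>u v. (u, v) \<in> parcs G \<Longrightarrow> ld.Q y u v = ld.Q x u v" for y
    using assms(8)[unfolded x globally_rigid_iff] that by blast
  show ?thesis
    unfolding generically_globally_rigid_def
  proof (intro ballI impI)
    fix p' assume p': "p' \<in> placements k L G V" "generic_placement (L ` {1..k}) G p'"
    obtain x2 where x2: "p' = place x2" by (rule placement_place[OF p'(1)])
    obtain \<Delta>2 where du2: "dual ?K (pverts G) x2 \<Delta>2" by (rule generic_dual[OF p'(2)[unfolded x2]])
    show "globally_rigid k L G V p'"
      unfolding x2 globally_rigid_iff
    proof (intro allI impI)
      fix y assume y: "\<forall>(u, v)\<in>parcs G. ld.Q y u v = ld.Q x2 u v"
      have yQ: "ld.Q y u v = ld.Q x2 u v" if "(u, v) \<in> parcs G" for u v using y that by blast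
      show "ld.congruent_on x2 y (pverts G)"
        by (rule ld.rigidity_transfer[OF graph crossing_verts du du2 rig yQ])
    qed
  qed
qed

end
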